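(* Let $k>0$. Suppose that $\phi=\phi_1+\phi_2$ where $\phi_1\in L^2(\mathbb{R})$ is compactly supported and $\phi_2\in C(\mathbb{R})$, and that $\phi$ satisfies $$\phi(t)=\begin{cases}c_+\,\mathrm{e}^{\mathrm{i}k|t|}|t|^{-1/2}+O(|t|^{-p}),& t\to+\infty,\\ c_-\,\mathrm{e}^{\mathrm{i}k|t|}|t|^{-1/2}+O(|t|^{-p}),& t\to-\infty,\end{cases}$$ for some constants $c_+,c_-\in\mathbb{C}$ and $p>1$. Define, for $\boldsymbol{x}=(x_1,x_2)\in\mathbb{R}^2_+:=(0,\infty)\times\mathbb{R}$, $$u(\boldsymbol{x}):=\int_{\mathbb{R}}\mathcal{H}(k;x_1,x_2-t)\,\phi(t)\,\mathrm{d}t .$$ Then: (i) there exist two constants $C>0$ and $R>0$ such that $|u(\boldsymbol{x})|\le C(1+|\boldsymbol{x}|)^{-1/2}$ for all $\boldsymbol{x}\in\mathbb{R}^2_+$ with $|\boldsymbol{x}|>R$; (ii) for all $\varepsilon>0$, $$\lim_{R\to+\infty}R^{1/2}\sup\left\{\left|\frac{\partial u(\boldsymbol{x})}{\partial r}-\mathrm{i}ku(\boldsymbol{x})\right|:\ x_1>\varepsilon\text{ and }|\boldsymbol{x}|=R\right\}=0,$$ where $r=|\boldsymbol{x}|$.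
   Context: The kernel is $\mathcal{H}(k;x_1,x_2):=\dfrac{\mathrm{i}kx_1}{2}\dfrac{H^{(1)}_1(k|\boldsymbol{x}|)}{|\boldsymbol{x}|}$ for $\boldsymbol{x}=(x_1,x_2)$ with $x_1>0$, where $H^{(1)}_1$ is the Hankel function of the first kind of order 1. $\partial/\partial r$ denotes the radial derivative. *)

theory Defs
  imports "HOL-Analysis.Analysis" "HOL-Library.Landau_Symbols"
begin

definition bessel_J :: "nat \<Rightarrow> real \<Rightarrow> real" where
  "bessel_J n x = (\<Sum>m. (-1) ^ m / (fact m * fact (n + m)) * (x / 2) ^ (n + 2 * m))"

text \<open>
  The function of the second kind of integer order \<open>n\<close>, by its ascending series for \<open>x > 0\<close>.
  The digamma values of the usual series are written as
  \<open>\<psi> (m + 1) = harm m - euler_mascheroni\<close>, with the Euler constant collected in the logarithmic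
  term. For \<open>x \<le> 0\<close> the value carries no meaning.
\<close>

definition bessel_Y :: "nat \<Rightarrow> real \<Rightarrow> real" where
  "bessel_Y n x =
     2 / pi * (ln (x / 2) + euler_mascheroni) * bessel_J n x
     - 1 / pi * (\<Sum>m<n. fact (n - 1 - m) / fact m * (x / 2) powi (2 * int m - int n))
     - 1 / pi * (\<Sum>m. (-1) ^ m / (fact m * fact (n + m)) * (x / 2) ^ (n + 2 * m)
                        * (harm m + harm (n + m)))"

definition hankel1 :: "nat \<Rightarrow> real \<Rightarrow> complex" where
  "hankel1 n x = complex_of_real (bessel_J n x) + \<i> * complex_of_real (bessel_Y n x)"

definition half_plane_kernel :: "real \<Rightarrow> real \<Rightarrow> real \<Rightarrow> complex" where
  "half_plane_kernel k x\<^sub>1 x\<^sub>2 =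
     \<i> * of_real k * of_real x\<^sub>1 / 2 * (hankel1 1 (k * norm (x\<^sub>1, x\<^sub>2)) / of_real (norm (x\<^sub>1, x\<^sub>2)))"

definition half_plane_potential :: "real \<Rightarrow> (real \<Rightarrow> complex) \<Rightarrow> real \<times> real \<Rightarrow> complex" where
  "half_plane_potential k \<phi> = (\<lambda>(x\<^sub>1, x\<^sub>2). LINT t|lebesgue. half_plane_kernel k x\<^sub>1 (x\<^sub>2 - t) * \<phi> t)"

definition radial_deriv :: "('a::real_normed_vector \<Rightarrow> 'b::real_normed_vector) \<Rightarrow> 'a \<Rightarrow> 'b" where
  "radial_deriv u x = vector_derivative (\<lambda>r. u (r *\<^sub>R sgn x)) (at (norm x))"

definition square_integrable :: "(real \<Rightarrow> complex) \<Rightarrow> bool" where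
  "square_integrable f \<longleftrightarrow>
     f \<in> borel_measurable lebesgue \<and> integrable lebesgue (\<lambda>t. (norm (f t))\<^sup>2)"

text \<open>
  Elements of \<open>L\<^sup>2\<close> are classes modulo null sets, so the support is the essential one.
\<close>

definition compactly_supported :: "(real \<Rightarrow> complex) \<Rightarrow> bool" where
  "compactly_supported f \<longleftrightarrow> (\<exists>K. compact K \<and> (AE t in lebesgue. t \<notin> K \<longrightarrow> f t = 0))"

end

theory Submission
  imports Defs "HOL-Real_Asymp.Real_Asymp" "HOL-Probability.Sinc_Integral"
begin

text \<open>
  The kernel is \<open>- (\<i> / 2)\<close> times the normal derivative of the outgoing wave \<open>w(y) = H\<^sub>0\<^sup>(\<^sup>1\<^sup>)(k \<bar>y\<bar>)\<close>.
  A suitable combination of two such waves with sources at \<open>(-1, 0)\<close> and \<open>(-1, \<pi> / (2 k))\<close> has a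
  boundary trace with the same leading terms as \<open>\<phi>\<close> at both \<open>\<plusminus>\<infinity>\<close>, so that \<open>\<phi>\<close> is this trace plus an
  integrable density \<open>\<psi>\<close> of order \<open>\<bar>t\<bar>\<close> to the power \<open>- min p (3/2)\<close>. The half-plane potential of the trace is the
  combination itself, by Green's identity in its flux form: the flux between two outgoing
  waves through a vertical line does not depend on the line, vanishes to the right of both sources,
  and jumps at a source by the value of the other wave. The potential of \<open>\<psi>\<close> is estimated directly.

  The behaviour of the Hankel functions at infinity comes from the Laplace integral
  \<open>H\<^sub>0\<^sup>(\<^sup>1\<^sup>)(z) = - (2 \<i> / \<pi>) exp (\<i> z) \<integral>\<^sub>0\<^sup>\<infinity> exp (- z s) / sqrt (s\<^sup>2 - 2 \<i> s) ds\<close>, which solves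
  the same differential equation as the ascending series and has the same expansion up to
  \<open>o(1)\<close> at the origin.
\<close>

section \<open>Ascending series and the Bessel equation\<close>

text \<open>A direct estimate fails because \<phi> is only of order |t|^(-1/2): against a kernel of
  order x1 * dist^(-3/2), absolute values leave the part with |t| at least of size |x| bounded but
  not decaying. The oscillation must be used exactly, and subtracting genuine outgoing waves does
  so, since their potentials are known. The trace of a source at height 0 is even and matches only
  equal constants at the two ends; raising a source by a quarter wavelength multiplies the leading
  term of its trace by - \<i> at +infinity and by \<i> at -infinity, so two sources match any pair.
  What remains decays faster than 1 / |t|, which suffices for both claims; 3/2 is the order of the
  next term in the trace. The Hankel functions are given by series at the origin, while decay is
  needed at infinity. The Laplace integral comes from the Mehler-Sommerfeld integral of exp (\<i> z
  t) / sqrt (t^2 - 1) over t > 1 by turning the path to t = 1 + \<i> s. One cancellation drives all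
  later estimates: H1 + \<i> H0 is of order z^(-3/2), one power better than either term.\<close>

definition entire_coeffs :: "(nat \<Rightarrow> real) \<Rightarrow> bool" where
  "entire_coeffs c \<longleftrightarrow> (\<forall>y. summable (\<lambda>m. c m * y ^ m))"

definition power_sum :: "(nat \<Rightarrow> real) \<Rightarrow> real \<Rightarrow> real" where
  "power_sum c y = (\<Sum>m. c m * y ^ m)"

text \<open>Comparison with the exponential series. The Bessel coefficients contain two factorials,
  so one may be spent on the harmonic numbers.\<close>

lemma entire_coeffsI:
  assumes "\<And>m. \<bar>c m\<bar> \<le> B / fact m"
  shows "entire_coeffs c"
  unfolding entire_coeffs_def
proof
  fix y :: real
  have "summable (\<lambda>m. B * (inverse (fact m) * \<bar>y\<bar> ^ m))"
    by (intro summable_mult summable_exp)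
  then show "summable (\<lambda>m. c m * y ^ m)"
    by (rule summable_comparison_test'[of _ 0])
       (use assms in \<open>auto simp: abs_mult power_abs divide_inverse intro!: mult_right_mono simp flip: mult.assoc\<close>)
qed

lemma power_sum_deriv:
  assumes "entire_coeffs c"
  shows "(power_sum c has_real_derivative power_sum (diffs c) y) (at y)"
  using termdiffs_strong_converges_everywhere[of c y] assms
  unfolding entire_coeffs_def power_sum_def[abs_def] by auto

lemma entire_coeffs_diffs: "entire_coeffs c \<Longrightarrow> entire_coeffs (diffs c)"
  unfolding entire_coeffs_def using termdiff_converges_all by blast

lemma power_sum_add:
  "entire_coeffs c \<Longrightarrow> entire_coeffs d \<Longrightarrow> power_sum (\<lambda>m. c m + d m) y = power_sum c y + power_sum d y"
  unfolding entire_coeffs_def power_sum_def by (simp add: distrib_right suminf_add)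

text \<open>Pulling out one factor y is what later defeats the logarithm: near the origin
  \<open>bessel_J 0\<close> differs from 1 by a multiple of x^2, and x^2 * ln x tends to 0.\<close>

lemma power_sum_shift:
  assumes "entire_coeffs c"
  shows "entire_coeffs (\<lambda>m. c (Suc m))" "power_sum c y = c 0 + y * power_sum (\<lambda>m. c (Suc m)) y"
proof -
  have s: "summable (\<lambda>m. c (Suc m) * y ^ m)" for y
  proof (cases "y = 0")
    case False
    have "summable (\<lambda>m. c (Suc m) * y ^ Suc m)"
      using assms unfolding entire_coeffs_def by (subst summable_Suc_iff) auto
    then have "summable (\<lambda>m. (1 / y) * (c (Suc m) * y ^ Suc m))"
      by (rule summable_mult)
    then show ?thesis using False by (simp add: field_simps)
  next
    case True
    then show ?thesis
      by (metis sums_summable powser_sums_zero)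
  qed
  then show "entire_coeffs (\<lambda>m. c (Suc m))" by (simp add: entire_coeffs_def)
  have "power_sum c y = c 0 + (\<Sum>m. c (Suc m) * y ^ Suc m)"
    unfolding power_sum_def using suminf_split_head[of "\<lambda>m. c m * y ^ m"] assms
    by (simp add: entire_coeffs_def)
  also have "(\<Sum>m. c (Suc m) * y ^ Suc m) = y * power_sum (\<lambda>m. c (Suc m)) y"
    unfolding power_sum_def by (subst suminf_mult[symmetric, OF s]) (simp add: mult_ac)
  finally show "power_sum c y = c 0 + y * power_sum (\<lambda>m. c (Suc m)) y" .
qed

section \<open>Coefficients of the Bessel series and the first-order Bessel system\<close>

text \<open>In the variable y = x^2 / 4, \<open>bessel_p0\<close> and \<open>bessel_p1\<close> are
  the coefficients of J_0 and of J_1 / (x/2), while \<open>bessel_q0\<close> and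
  \<open>bessel_q1\<close> are those of the harmonic-number sums in Y_0 and Y_1, the latter also
  divided by x/2.\<close>

definition bessel_p0 :: "nat \<Rightarrow> real" where "bessel_p0 m = (-1) ^ m / (fact m)\<^sup>2"
definition bessel_p1 :: "nat \<Rightarrow> real" where "bessel_p1 m = (-1) ^ m / (fact m * fact (Suc m))"
definition bessel_q0 :: "nat \<Rightarrow> real" where "bessel_q0 m = bessel_p0 m * (2 * harm m)"
definition bessel_q1 :: "nat \<Rightarrow> real" where "bessel_q1 m = bessel_p1 m * (harm m + harm (Suc m))"

text \<open>Crude, but it cancels exactly one of the two factorials in the Bessel coefficients, and
  \<open>entire_coeffsI\<close> needs only the other.\<close>

lemma harm_le_fact: "(harm m :: real) \<le> fact m"
proof (induction m)
  case (Suc m)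
  show ?case
  proof (cases "m = 0")
    case False
    then have "inverse (real (Suc m)) \<le> 1" by (simp add: field_simps)
    also have "1 \<le> (fact m :: real)" by simp
    also have "\<dots> \<le> real m * fact m" using False by simp
    finally have "inverse (real (Suc m)) \<le> real m * fact m" by simp
    with Suc show ?thesis by (simp add: harm_Suc algebra_simps)
  qed (simp add: harm_Suc harm_def)
qed (simp add: harm_def)

lemma harm_nonneg': "(harm m :: real) \<ge> 0"
  by (simp add: harm_def sum_nonneg)

lemma entire_bessel_coeffs:
  "entire_coeffs bessel_p0" "entire_coeffs bessel_p1" "entire_coeffs bessel_q0" "entire_coeffs bessel_q1"
proof -
  have f: "(1::real) \<le> fact m" for m by simp
  show "entire_coeffs bessel_p0"
    by (rule entire_coeffsI[of _ 1]) (use f in \<open>simp add: bessel_p0_def field_simps power2_eq_square\<close>)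
  show "entire_coeffs bessel_p1"
    by (rule entire_coeffsI[of _ 1]) (use f in \<open>simp add: bessel_p1_def field_simps del: fact_Suc\<close>)
  show "entire_coeffs bessel_q0"
    by (rule entire_coeffsI[of _ 2])
       (use harm_le_fact harm_nonneg' in \<open>simp add: bessel_q0_def bessel_p0_def field_simps power2_eq_square abs_mult\<close>)
  have "harm m + harm (Suc m) \<le> 2 * (fact (Suc m) :: real)" for m
  proof -
    have "harm m \<le> (harm (Suc m) :: real)" by (simp add: harm_Suc)
    then show ?thesis using harm_le_fact[of "Suc m"] by linarith
  qed
  moreover have "\<bar>harm m + harm (Suc m)\<bar> = harm m + (harm (Suc m)::real)" for m
    using harm_nonneg'[of m] harm_nonneg'[of "Suc m"] by simp
  ultimately show "entire_coeffs bessel_q1"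
    by (intro entire_coeffsI[of _ 2])
       (simp add: bessel_q1_def bessel_p1_def abs_mult divide_simps del: fact_Suc)
qed

lemma bessel_J_power_sum:
  "bessel_J 0 x = power_sum bessel_p0 (x\<^sup>2 / 4)" "bessel_J 1 x = x / 2 * power_sum bessel_p1 (x\<^sup>2 / 4)"
proof -
  have e: "(x / 2) ^ (2 * m) = (x\<^sup>2 / 4) ^ m" for m
    by (simp add: power_mult power_divide)
  show "bessel_J 0 x = power_sum bessel_p0 (x\<^sup>2 / 4)"
    unfolding bessel_J_def power_sum_def bessel_p0_def by (simp add: power2_eq_square[of "fact _"] flip: e)
  show "bessel_J 1 x = x / 2 * power_sum bessel_p1 (x\<^sup>2 / 4)"
    unfolding bessel_J_def power_sum_def
    apply (subst suminf_mult[symmetric])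
    subgoal using entire_bessel_coeffs(2) by (simp add: entire_coeffs_def)
    subgoal by (simp add: bessel_p1_def mult_ac del: fact_Suc flip: e)
    done
qed

lemma bessel_Y_power_sum:
  assumes "x > 0"
  shows "bessel_Y 0 x = 2 / pi * (ln (x / 2) + euler_mascheroni) * bessel_J 0 x - 1 / pi * power_sum bessel_q0 (x\<^sup>2 / 4)"
    and "bessel_Y 1 x = 2 / pi * (ln (x / 2) + euler_mascheroni) * bessel_J 1 x - 2 / (pi * x)
      - 1 / pi * (x / 2 * power_sum bessel_q1 (x\<^sup>2 / 4))"
proof -
  have e: "(x / 2) ^ (2 * m) = (x\<^sup>2 / 4) ^ m" for m
    by (simp add: power_mult power_divide)
  have "(\<Sum>m. (-1) ^ m / (fact m * fact (0 + m)) * (x / 2) ^ (0 + 2 * m) * (harm m + harm (0 + m)))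
     = power_sum bessel_q0 (x\<^sup>2 / 4)"
    unfolding power_sum_def
    by (rule suminf_cong) (simp add: bessel_q0_def bessel_p0_def power2_eq_square[of "fact _"] mult_ac flip: e)
  then show "bessel_Y 0 x = 2 / pi * (ln (x / 2) + euler_mascheroni) * bessel_J 0 x - 1 / pi * power_sum bessel_q0 (x\<^sup>2 / 4)"
    unfolding bessel_Y_def by simp
  have "(\<Sum>m. (-1) ^ m / (fact m * fact (1 + m)) * (x / 2) ^ (1 + 2 * m) * (harm m + harm (1 + m)))
     = x / 2 * power_sum bessel_q1 (x\<^sup>2 / 4)"
    unfolding power_sum_def
    apply (subst suminf_mult[symmetric])
    subgoal using entire_bessel_coeffs(4) by (simp add: entire_coeffs_def)
    subgoal by (rule suminf_cong) (simp add: bessel_q1_def bessel_p1_def mult_ac del: fact_Suc flip: e)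
    done
  then show "bessel_Y 1 x = 2 / pi * (ln (x / 2) + euler_mascheroni) * bessel_J 1 x - 2 / (pi * x)
      - 1 / pi * (x / 2 * power_sum bessel_q1 (x\<^sup>2 / 4))"
    unfolding bessel_Y_def using assms by (simp add: power_int_def field_simps)
qed

text \<open>These are J_0' = - J_1, J_1' = J_0 - J_1 / x and the corresponding rules for Y, stripped
  of the logarithm and of powers of x/2. In the last two, the terms in \<open>bessel_p0\<close> and
  \<open>bessel_p1\<close> come from differentiating the logarithm, the 1 from the polar term of
  Y_1.\<close>

lemma power_sum_bessel_relations:
  shows "power_sum (diffs bessel_p0) y = - power_sum bessel_p1 y"
    and "power_sum bessel_p1 y + y * power_sum (diffs bessel_p1) y = power_sum bessel_p0 y"
    and "power_sum bessel_p0 y - 1 - y * power_sum (diffs bessel_q0) y = y * power_sum bessel_q1 y"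
    and "power_sum bessel_q1 y + y * power_sum (diffs bessel_q1) y = power_sum bessel_p1 y + power_sum bessel_q0 y"
proof -
  note E = entire_bessel_coeffs
  have b1: "bessel_p1 m = bessel_p0 m / (real m + 1)" for m
    by (simp add: bessel_p0_def bessel_p1_def power2_eq_square add_ac)
  have b0: "bessel_p0 (Suc m) = - bessel_p0 m / (real m + 1)\<^sup>2" for m
    by (simp add: bessel_p0_def power2_eq_square add_ac)
  have n0: "real m + 1 \<noteq> 0" for m by linarith
  have b2: "bessel_p0 (Suc m) = - bessel_p1 m / (real m + 1)" for m
    by (simp add: b0 b1 power2_eq_square)
  then have d0: "diffs bessel_p0 = (\<lambda>m. - bessel_p1 m)"
    by (intro ext) (use n0 in \<open>simp add: diffs_def add_ac\<close>)
  show "power_sum (diffs bessel_p0) y = - power_sum bessel_p1 y"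
    unfolding d0 power_sum_def using suminf_minus[of "\<lambda>m. bessel_p1 m * y ^ m"] E(2)
    by (simp add: entire_coeffs_def)
  \<comment> \<open>The operator y d/dy multiplies the m-th coefficient by m, so each mixed identity
    reduces to one between coefficients.\<close>
  have sc: "y * power_sum (diffs c) y = power_sum (\<lambda>m. real m * c m) y \<and> entire_coeffs (\<lambda>m. real m * c m)"
    if "entire_coeffs c" for c y
  proof -
    have s: "summable (\<lambda>m. diffs c m * z ^ m)" for z
      using entire_coeffs_diffs[OF that] by (simp add: entire_coeffs_def)
    have *: "summable (\<lambda>m. real m * c m * z ^ m)" for z
    proof -
      have "summable (\<lambda>m. real (Suc m) * c (Suc m) * z ^ Suc m)"
        using summable_mult[OF s, of z z] by (simp add: diffs_def mult_ac)
      then show ?thesis by (subst (asm) summable_Suc_iff)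
    qed
    then have e: "entire_coeffs (\<lambda>m. real m * c m)" by (simp add: entire_coeffs_def)
    show ?thesis using power_sum_shift(2)[OF e, of y] e by (simp add: diffs_def)
  qed
  have "power_sum bessel_p1 y + power_sum (\<lambda>m. real m * bessel_p1 m) y = power_sum (\<lambda>m. bessel_p1 m + real m * bessel_p1 m) y"
    by (rule power_sum_add[symmetric]) (use E sc[OF E(2)] in auto)
  also have "(\<lambda>m. bessel_p1 m + real m * bessel_p1 m) = bessel_p0"
  proof
    fix m
    have "bessel_p1 m + real m * bessel_p1 m = (real m + 1) * bessel_p1 m" by (simp add: algebra_simps)
    then show "bessel_p1 m + real m * bessel_p1 m = bessel_p0 m" using n0[of m] by (simp add: b1)
  qed
  finally show "power_sum bessel_p1 y + y * power_sum (diffs bessel_p1) y = power_sum bessel_p0 y"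
    using sc[OF E(2), of y] by simp
  have "power_sum bessel_q1 y + power_sum (\<lambda>m. real m * bessel_q1 m) y = power_sum (\<lambda>m. bessel_q1 m + real m * bessel_q1 m) y"
    by (rule power_sum_add[symmetric]) (use E sc[OF E(4)] in auto)
  also have "(\<lambda>m. bessel_q1 m + real m * bessel_q1 m) = (\<lambda>m. bessel_p1 m + bessel_q0 m)"
  proof
    fix m
    show "bessel_q1 m + real m * bessel_q1 m = bessel_p1 m + bessel_q0 m"
    proof -
      have h: "bessel_q1 m = bessel_p1 m * (2 * harm m + 1 / (real m + 1))"
        by (simp add: bessel_q1_def harm_Suc divide_inverse add_ac)
      have "bessel_q1 m + real m * bessel_q1 m = (real m + 1) * bessel_q1 m"
        by (simp add: distrib_right)
      also have "\<dots> = ((real m + 1) * bessel_p1 m) * (2 * harm m + 1 / (real m + 1))"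
        unfolding h by (simp only: mult.assoc)
      also have "(real m + 1) * bessel_p1 m = bessel_p0 m"
        using n0[of m] by (simp add: b1)
      finally show ?thesis
        by (simp add: bessel_q0_def b1 distrib_left)
    qed
  qed
  also have "power_sum \<dots> y = power_sum bessel_p1 y + power_sum bessel_q0 y" by (rule power_sum_add) (use E in auto)
  finally show "power_sum bessel_q1 y + y * power_sum (diffs bessel_q1) y = power_sum bessel_p1 y + power_sum bessel_q0 y"
    using sc[OF E(4), of y] by simp
  have "power_sum bessel_p0 y - 1 = y * power_sum (\<lambda>m. bessel_p0 (Suc m)) y"
    using power_sum_shift(2)[OF E(1), of y] by (simp add: bessel_p0_def)
  moreover have "power_sum (diffs bessel_q0) y + power_sum bessel_q1 y = power_sum (\<lambda>m. diffs bessel_q0 m + bessel_q1 m) y"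
    by (rule power_sum_add[symmetric]) (use E entire_coeffs_diffs in auto)
  moreover have "(\<lambda>m. diffs bessel_q0 m + bessel_q1 m) = (\<lambda>m. bessel_p0 (Suc m))"
  proof
    fix m
    show "diffs bessel_q0 m + bessel_q1 m = bessel_p0 (Suc m)"
    proof -
      have "real (Suc m) * bessel_p0 (Suc m) = - bessel_p1 m"
        using n0[of m] by (simp add: b2 add_ac)
      then have "diffs bessel_q0 m = - bessel_p1 m * (2 * harm (Suc m))"
        unfolding diffs_def bessel_q0_def by (simp only: of_nat_id flip: mult.assoc)
      then show ?thesis
        by (simp add: bessel_q1_def b2 harm_Suc divide_inverse add_ac algebra_simps)
    qed
  qed
  ultimately show "power_sum bessel_p0 y - 1 - y * power_sum (diffs bessel_q0) y = y * power_sum bessel_q1 y"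
    by (metis add_diff_cancel_left' distrib_left)
qed

text \<open>The first-order system stands in for Bessel's equation: uniqueness and all derivatives
  of waves rest on these two rules.\<close>

lemma hankel1_deriv:
  assumes "x > 0"
  shows "(hankel1 0 has_vector_derivative - hankel1 1 x) (at x)"
    and "(hankel1 1 has_vector_derivative hankel1 0 x - hankel1 1 x / of_real x) (at x)"
proof -
  note E = entire_bessel_coeffs and R = power_sum_bessel_relations[of "x\<^sup>2 / 4"]
  have D: "((\<lambda>x. power_sum c (x\<^sup>2 / 4)) has_real_derivative power_sum (diffs c) (x\<^sup>2 / 4) * (x / 2)) (at x)"
    if "entire_coeffs c" for c
    by (rule DERIV_chain2[OF power_sum_deriv[OF that]]) (auto intro!: derivative_eq_intros)
  note D' = D[OF E(1)] D[OF E(2)] D[OF E(3)] D[OF E(4)]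

  have J0: "(bessel_J 0 has_real_derivative - bessel_J 1 x) (at x)"
    unfolding bessel_J_power_sum[abs_def]
    by (rule DERIV_cong[OF D'(1)]) (use R(1) in simp)
  have J1: "(bessel_J 1 has_real_derivative bessel_J 0 x - bessel_J 1 x / x) (at x)"
    unfolding bessel_J_power_sum[abs_def]
    apply (rule DERIV_cong[OF DERIV_mult[OF DERIV_cdivide[OF DERIV_ident] D'(2)]])
    using assms R(2) apply (simp add: field_simps power2_eq_square)
    done
  have lnD: "((\<lambda>x. 2 / pi * (ln (x / 2) + euler_mascheroni)) has_real_derivative 2 / (pi * x)) (at x)"
    using assms by (auto intro!: derivative_eq_intros simp: field_simps)
  have invD: "((\<lambda>x. 2 / (pi * x)) has_real_derivative - 2 / (pi * x\<^sup>2)) (at x)"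
    using assms by (auto intro!: derivative_eq_intros simp: field_simps power2_eq_square)
  \<comment> \<open>The rewriting of Y by power sums is available only for positive arguments, so
    the derivative is computed for the series and transferred on a neighbourhood inside the positive
    axis.\<close>
  have ev: "eventually (\<lambda>x. x \<in> {0<..}) (nhds x)"
    using assms by (intro eventually_nhds_in_open) auto
  have Y0: "(bessel_Y 0 has_real_derivative - bessel_Y 1 x) (at x)"
  proof -
    have "((\<lambda>x. 2 / pi * (ln (x / 2) + euler_mascheroni) * bessel_J 0 x - 1 / pi * power_sum bessel_q0 (x\<^sup>2 / 4))
       has_real_derivative - bessel_Y 1 x) (at x)"
      unfolding bessel_Y_power_sum(2)[OF assms]
    proof (rule DERIV_cong[OF DERIV_diff[OF DERIV_mult[OF lnD J0] DERIV_cmult[OF D'(3)]]])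
      have "power_sum bessel_p0 (x\<^sup>2 / 4) = 1 + x\<^sup>2 / 4 * (power_sum (diffs bessel_q0) (x\<^sup>2 / 4) + power_sum bessel_q1 (x\<^sup>2 / 4))"
        using R(3) by (simp add: algebra_simps)
      then have "2 / (pi * x) * bessel_J 0 x = 2 / (pi * x)
          + x / (2 * pi) * (power_sum (diffs bessel_q0) (x\<^sup>2 / 4) + power_sum bessel_q1 (x\<^sup>2 / 4))"
        unfolding bessel_J_power_sum(1) using assms
        by (simp add: distrib_left power2_eq_square)
      then show "2 / (pi * x) * bessel_J 0 x
          + - bessel_J 1 x * (2 / pi * (ln (x / 2) + euler_mascheroni))
          - 1 / pi * (power_sum (diffs bessel_q0) (x\<^sup>2 / 4) * (x / 2))
        = - (2 / pi * (ln (x / 2) + euler_mascheroni) * bessel_J 1 x - 2 / (pi * x) - 1 / pi * (x / 2 * power_sum bessel_q1 (x\<^sup>2 / 4)))"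
        by (simp add: algebra_simps)
    qed
    then show ?thesis
      by (subst DERIV_cong_ev[OF refl _ refl]) (use ev bessel_Y_power_sum(1) in \<open>auto elim!: eventually_mono\<close>)
  qed
  have Y1: "(bessel_Y 1 has_real_derivative bessel_Y 0 x - bessel_Y 1 x / x) (at x)"
  proof -
    have "((\<lambda>x. 2 / pi * (ln (x / 2) + euler_mascheroni) * bessel_J 1 x - 2 / (pi * x)
      - 1 / pi * (x / 2 * power_sum bessel_q1 (x\<^sup>2 / 4)))
       has_real_derivative bessel_Y 0 x - bessel_Y 1 x / x) (at x)"
      unfolding bessel_Y_power_sum[OF assms]
    proof (rule DERIV_cong[OF DERIV_diff[OF DERIV_diff[OF DERIV_mult[OF lnD J1] invD]
            DERIV_cmult[OF DERIV_mult[OF DERIV_cdivide[OF DERIV_ident] D'(4)]]]])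
      have alg: "2 / (pi * x) * (x / 2 * a) + (j - j1 / x) * A - - 2 / (pi * x\<^sup>2) - 1 / pi * (1 / 2 * q + q' * (x / 2) * (x / 2))
        = A * j - 1 / pi * q0 - (A * j1 - 2 / (pi * x) - 1 / pi * (x / 2 * q)) / x"
        if "q + x\<^sup>2 / 4 * q' = a + q0" for a j j1 q q' q0 A
      proof -
        have q0: "q0 = q + x\<^sup>2 / 4 * q' - a" using that by simp
        show ?thesis unfolding q0 using assms by (simp add: field_simps power2_eq_square)
      qed
      show "2 / (pi * x) * bessel_J 1 x
          + (bessel_J 0 x - bessel_J 1 x / x) * (2 / pi * (ln (x / 2) + euler_mascheroni)) - - 2 / (pi * x\<^sup>2)
          - 1 / pi * (1 / 2 * power_sum bessel_q1 (x\<^sup>2 / 4) + power_sum (diffs bessel_q1) (x\<^sup>2 / 4) * (x / 2) * (x / 2))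
        = 2 / pi * (ln (x / 2) + euler_mascheroni) * bessel_J 0 x - 1 / pi * power_sum bessel_q0 (x\<^sup>2 / 4)
          - (2 / pi * (ln (x / 2) + euler_mascheroni) * bessel_J 1 x - 2 / (pi * x) - 1 / pi * (x / 2 * power_sum bessel_q1 (x\<^sup>2 / 4))) / x"
        using alg[OF R(4)] by (simp only: bessel_J_power_sum(2))
    qed
    then show ?thesis
      by (subst DERIV_cong_ev[OF refl _ refl]) (use ev bessel_Y_power_sum(2) in \<open>auto elim!: eventually_mono\<close>)
  qed
  show "(hankel1 0 has_vector_derivative - hankel1 1 x) (at x)"
    unfolding hankel1_def[abs_def]
    by (rule derivative_eq_intros has_vector_derivative_of_real
          J0[THEN has_vector_derivative_of_real] Y0[THEN has_vector_derivative_of_real] refl)+ simp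
  show "(hankel1 1 has_vector_derivative hankel1 0 x - hankel1 1 x / of_real x) (at x)"
    unfolding hankel1_def[abs_def]
    by (rule derivative_eq_intros has_vector_derivative_of_real
          J1[THEN has_vector_derivative_of_real] Y1[THEN has_vector_derivative_of_real] refl)+
       (use assms in \<open>simp add: field_simps\<close>)
qed

section \<open>Differentiation under the integral sign\<close>

lemma has_vector_derivative_iff_quotient:
  "(f has_vector_derivative D) (at x) \<longleftrightarrow> ((\<lambda>y. (f y - f x) /\<^sub>R (y - x)) \<longlongrightarrow> D) (at x)"
proof -
  have *: "norm (f y - f x - (y - x) *\<^sub>R D) / norm (y - x) = norm ((f y - f x) /\<^sub>R (y - x) - D)"
    if "y \<noteq> x" for y
  proof -
    have "(f y - f x) /\<^sub>R (y - x) - D = (f y - f x - (y - x) *\<^sub>R D) /\<^sub>R (y - x)"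
      using that by (simp add: scaleR_diff_right)
    then show ?thesis by (simp add: divide_inverse_commute)
  qed
  have "(f has_vector_derivative D) (at x) \<longleftrightarrow>
      ((\<lambda>y. norm (f y - f x - (y - x) *\<^sub>R D) / norm (y - x)) \<longlongrightarrow> 0) (at x)"
    by (simp add: has_vector_derivative_def has_derivative_iff_norm bounded_linear_scaleR_left)
  also have "\<dots> \<longleftrightarrow> ((\<lambda>y. norm ((f y - f x) /\<^sub>R (y - x) - D)) \<longlongrightarrow> 0) (at x)"
    by (rule filterlim_cong) (use * in \<open>auto simp: eventually_at_filter\<close>)
  also have "\<dots> \<longleftrightarrow> ((\<lambda>y. (f y - f x) /\<^sub>R (y - x)) \<longlongrightarrow> D) (at x)"
    unfolding tendsto_norm_zero_iff by (rule LIM_zero_iff)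
  finally show ?thesis .
qed

text \<open>Dominated convergence for difference quotients: the mean value inequality turns the
  bound on \<open>f'\<close> into the same bound on the quotients, and measurability of
  \<open>f' x0\<close> follows since it is a limit of measurable quotients.\<close>

lemma has_vector_derivative_integral:
  fixes f f' :: "real \<Rightarrow> 'a \<Rightarrow> 'b::{banach, second_countable_topology}"
  assumes x0: "a < x0" "x0 < b"
    and int: "\<And>x. a < x \<Longrightarrow> x < b \<Longrightarrow> integrable M (f x)"
    and der: "\<And>x t. a < x \<Longrightarrow> x < b \<Longrightarrow> t \<in> space M \<Longrightarrow> ((\<lambda>x. f x t) has_vector_derivative f' x t) (at x)"
    and bnd: "\<And>x t. a < x \<Longrightarrow> x < b \<Longrightarrow> t \<in> space M \<Longrightarrow> norm (f' x t) \<le> w t"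
    and w: "integrable M w"
  shows "integrable M (f' x0)"
    and "((\<lambda>x. \<integral>t. f x t \<partial>M) has_vector_derivative (\<integral>t. f' x0 t \<partial>M)) (at x0)"
proof -
  define q where "q = (\<lambda>x t. (f x t - f x0 t) /\<^sub>R (x - x0))"
  have ev: "eventually (\<lambda>x. x \<in> {a<..<b} - {x0}) (at x0)"
    using x0 by (intro eventually_at_in_open) auto
  have qlim: "((\<lambda>x. q x t) \<longlongrightarrow> f' x0 t) (at x0)" if "t \<in> space M" for t
    using der[OF x0 that] unfolding q_def has_vector_derivative_iff_quotient .
  have qint: "integrable M (q x)" if "x \<in> {a<..<b} - {x0}" for x
    unfolding q_def using that x0 by (intro integrable_scaleR_right Bochner_Integration.integrable_diff int) auto
  have qb: "norm (q x t) \<le> w t" if "x \<in> {a<..<b} - {x0}" "t \<in> space M" for x t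
  proof -
    have "norm (f x t - f x0 t) \<le> w t * norm (x - x0)"
    proof (rule differentiable_bound)
      show "convex {a<..<b}" by simp
      show "((\<lambda>x. f x t) has_derivative (\<lambda>h. h *\<^sub>R f' y t)) (at y within {a<..<b})" if "y \<in> {a<..<b}" for y
        using der[of y t] that \<open>t \<in> space M\<close>
        by (auto simp: has_vector_derivative_def intro: has_derivative_at_withinI)
      show "onorm (\<lambda>h. h *\<^sub>R f' y t) \<le> w t" if "y \<in> {a<..<b}" for y
        using bnd[of y t] that \<open>t \<in> space M\<close> by (simp add: onorm_scaleR_left onorm_id)
    qed (use that x0 in auto)
    then show ?thesis using that(1)
      by (simp add: q_def divide_simps mult.commute)
  qed
  \<comment> \<open>Stated for every sequence approaching \<open>x0\<close>, because the limit along
    the filter is recovered from sequences; the countable form of dominated convergence is then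
    enough.\<close>
  have seq: "(\<lambda>n. \<integral>t. q (X n) t \<partial>M) \<longlonglongrightarrow> (\<integral>t. f' x0 t \<partial>M) \<and> integrable M (f' x0)"
    if X: "\<And>n. X n \<in> {a<..<b} - {x0}" "X \<longlonglongrightarrow> x0" for X :: "nat \<Rightarrow> real"
  proof -
    have Xf: "filterlim X (at x0) sequentially"
      using X by (auto simp: filterlim_at)
    have lim: "AE t in M. (\<lambda>n. q (X n) t) \<longlonglongrightarrow> f' x0 t"
      by (intro AE_I2 filterlim_compose[OF qlim Xf])
    have meas: "f' x0 \<in> borel_measurable M"
      by (rule borel_measurable_LIMSEQ_metric[where f = "\<lambda>n. q (X n)"])
         (use qint X in \<open>auto intro!: borel_measurable_integrable filterlim_compose[OF qlim Xf]\<close>)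
    have b: "AE t in M. norm (q (X n) t) \<le> w t" for n
      by (intro AE_I2 qb X)
    show ?thesis
      using integral_dominated_convergence[OF meas _ w lim b]
        integrable_dominated_convergence[OF meas _ w lim b] qint X
      by (auto intro!: borel_measurable_integrable)
  qed
  \<comment> \<open>One explicit sequence is needed to conclude integrability; the offset 2 keeps
    its first term strictly below \<open>b\<close>.\<close>
  define X where "X = (\<lambda>n. x0 + (b - x0) / (real n + 2))"
  have "X \<longlonglongrightarrow> x0" unfolding X_def by real_asymp
  moreover have "X n \<in> {a<..<b} - {x0}" for n
  proof -
    have "(b - x0) / (real n + 2) < (b - x0) / 1"
      using x0 by (intro divide_strict_left_mono) auto
    moreover have "0 < (b - x0) / (real n + 2)" using x0 by (intro divide_pos_pos) auto
    moreover have "X n - x0 = (b - x0) / (real n + 2)" by (simp add: X_def)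
    ultimately have "x0 < X n" "X n < b" by simp_all
    then show ?thesis using x0 by auto
  qed
  ultimately show "integrable M (f' x0)" using seq by blast
  have "((\<lambda>x. \<integral>t. q x t \<partial>M) \<longlongrightarrow> (\<integral>t. f' x0 t \<partial>M)) (at x0 within {a<..<b})"
    unfolding tendsto_at_iff_sequentially comp_def using seq by blast
  moreover have "at x0 within {a<..<b} = at x0"
    using x0 by (intro at_within_open) auto
  moreover have "(\<integral>t. q x t \<partial>M) = ((\<integral>t. f x t \<partial>M) - (\<integral>t. f x0 t \<partial>M)) /\<^sub>R (x - x0)"
    if "x \<in> {a<..<b}" for x
    unfolding q_def using int[of x] int[of x0] x0 that by simp
  then have "eventually (\<lambda>x. (\<integral>t. q x t \<partial>M) = ((\<integral>t. f x t \<partial>M) - (\<integral>t. f x0 t \<partial>M)) /\<^sub>R (x - x0)) (at x0)"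
    using ev by (auto elim!: eventually_mono)
  ultimately show "((\<lambda>x. \<integral>t. f x t \<partial>M) has_vector_derivative (\<integral>t. f' x0 t \<partial>M)) (at x0)"
    unfolding has_vector_derivative_iff_quotient by (simp add: tendsto_cong)
qed

section \<open>The Laplace integral\<close>

text \<open>The known Gamma integral is a gauge integral at z = 1. A nonnegative integrand makes it
  a Lebesgue integral, and the substitution s -> z s gives every z > 0.\<close>

lemma gamma_laplace_integral:
  fixes z c :: real
  assumes "z > 0" "c > 0"
  shows "integrable lborel (\<lambda>s. indicator {0<..} s * (s powr (c - 1) * exp (- z * s)))"
    and "(LINT s|lborel. indicator {0<..} s * (s powr (c - 1) * exp (- z * s))) = Gamma c / z powr c"
proof -
  define f where "f = (\<lambda>z s::real. indicator {0<..} s * (s powr (c - 1) * exp (- z * s)))"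
  have meas: "f 1 \<in> borel_measurable borel" unfolding f_def by measurable
  have "((\<lambda>t. t powr (c - 1) / exp t) has_integral Gamma c) {0..}"
    by (rule Gamma_integral_real) fact
  then have "((\<lambda>t. t powr (c - 1) / exp t) has_integral Gamma c) {0<..}"
    by (rule has_integral_spike_set_eq[THEN iffD1, rotated 2]) (auto intro: negligible_subset[OF negligible_sing[of 0]])
  then have hi: "((\<lambda>t. t powr (c - 1) * exp (- 1 * t)) has_integral Gamma c) {0<..}"
    by (rule has_integral_eq[rotated]) (simp add: exp_minus divide_inverse)
  then have ai: "(\<lambda>t. t powr (c - 1) * exp (- 1 * t)) absolutely_integrable_on {0<..}"
    by (intro nonnegative_absolutely_integrable_1) (auto simp: integrable_on_def)
  have "integrable lebesgue (f 1)"
    using ai by (simp add: set_integrable_def f_def)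
  then have i1: "integrable lborel (f 1)"
    using integrable_completion[of "f 1" lborel] meas by simp
  have "(LINT s|lborel. f 1 s) = (LINT s|lebesgue. f 1 s)"
    using integral_completion[of "f 1" lborel] meas by simp
  also have "\<dots> = Gamma c"
    using set_lebesgue_integral_eq_integral(2)[OF ai] integral_unique[OF hi]
    by (simp add: set_lebesgue_integral_def f_def)
  finally have v1: "(LINT s|lborel. f 1 s) = Gamma c" .
  have sc: "f 1 (0 + z * s) = z powr (c - 1) * f z s" for s
    using assms by (simp add: f_def powr_mult zero_less_mult_iff indicator_def)
  have "integrable lborel (\<lambda>s. z powr (c - 1) * f z s)"
    using lborel_integrable_real_affine[OF i1, of z 0] assms unfolding sc by simp
  then show iz: "integrable lborel (\<lambda>s. indicator {0<..} s * (s powr (c - 1) * exp (- z * s)))"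
    using assms by (simp add: f_def)
  have "Gamma c = z * (z powr (c - 1) * (LINT s|lborel. f z s))"
    using lborel_integral_real_affine[of z "f 1" 0] assms v1 unfolding sc by simp
  moreover have "z powr c = z * z powr (c - 1)"
    using assms by (simp add: powr_diff)
  ultimately show "(LINT s|lborel. indicator {0<..} s * (s powr (c - 1) * exp (- z * s))) = Gamma c / z powr c"
    using assms by (simp add: field_simps f_def)
qed

text \<open>The root of s^2 - 2 \<i> s. For s > 0 this number lies in the open fourth quadrant, so
  the principal branch is smooth there and has positive real part. Up to the factor \<i> it is sqrt
  (t^2 - 1) at t = 1 + \<i> s.\<close>

definition lap_sqrt :: "real \<Rightarrow> complex" where
  "lap_sqrt s = csqrt (Complex (s\<^sup>2) (- 2 * s))"

definition lap_density :: "real \<Rightarrow> complex" where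
  "lap_density s = inverse (lap_sqrt s)"

lemma lap_sqrt_square: "lap_sqrt s ^ 2 = Complex (s\<^sup>2) (- 2 * s)"
  by (simp add: lap_sqrt_def)

lemma norm_lap_sqrt_square: "s > 0 \<Longrightarrow> (norm (lap_sqrt s))\<^sup>2 = s * sqrt (s\<^sup>2 + 4)"
proof -
  assume s: "s > 0"
  have "(norm (lap_sqrt s))\<^sup>2 = norm (Complex (s\<^sup>2) (- 2 * s))"
    by (metis lap_sqrt_square norm_power)
  also have "\<dots> = sqrt (s\<^sup>2 * (s\<^sup>2 + 4))" by (simp add: cmod_def algebra_simps power2_eq_square)
  also have "\<dots> = s * sqrt (s\<^sup>2 + 4)" using s by (simp add: real_sqrt_mult)
  finally show ?thesis .
qed

text \<open>The size bounds follow from |s^2 - 2 \<i> s| = s * sqrt (s^2 + 4). The lower bound sqrt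
  s gives integrability of the density at 0, the lower bound s controls the rescaling by T, and the
  upper bound removes boundary terms.\<close>

lemma lap_sqrt_bounds:
  assumes "s > 0"
  shows "norm (lap_sqrt s) \<ge> s" "norm (lap_sqrt s) \<ge> sqrt s" "norm (lap_sqrt s) \<le> 2 * sqrt s * (1 + s)" "Re (lap_sqrt s) > 0"
    "lap_sqrt s \<noteq> 0"
proof -
  have 1: "sqrt (s\<^sup>2 + 4) \<ge> sqrt (s\<^sup>2)" by (intro real_sqrt_le_mono) simp
  have 2: "sqrt (s\<^sup>2 + 4) \<ge> sqrt 1" by (intro real_sqrt_le_mono) (simp add: add_increasing)
  have 3: "sqrt (s\<^sup>2 + 4) \<le> s + 2"
    using assms by (intro real_le_lsqrt) (auto simp: power2_eq_square algebra_simps)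
  note n = norm_lap_sqrt_square[OF assms]
  have "s\<^sup>2 \<le> (norm (lap_sqrt s))\<^sup>2"
    unfolding n using 1 assms by (simp add: power2_eq_square)
  then show "norm (lap_sqrt s) \<ge> s" using power2_le_imp_le norm_ge_zero by blast
  have "(sqrt s)\<^sup>2 \<le> (norm (lap_sqrt s))\<^sup>2"
    unfolding n using 2 assms by simp
  then show "norm (lap_sqrt s) \<ge> sqrt s" using power2_le_imp_le norm_ge_zero by blast
  have "(norm (lap_sqrt s))\<^sup>2 \<le> s * (s + 2)" unfolding n using 3 assms by simp
  also have "\<dots> \<le> s * (2 * (1 + s))\<^sup>2"
    using assms by (intro mult_left_mono) (auto simp: power2_eq_square algebra_simps)
  also have "\<dots> = (2 * sqrt s * (1 + s))\<^sup>2"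
    using assms by (simp only: power_mult_distrib) simp
  finally show "norm (lap_sqrt s) \<le> 2 * sqrt s * (1 + s)"
    by (rule power2_le_imp_le) (use assms in simp)
  have "Re (Complex (s\<^sup>2) (- 2 * s)) > 0" using assms by simp
  then have "0 < cmod (Complex (s\<^sup>2) (- 2 * s)) + Re (Complex (s\<^sup>2) (- 2 * s))"
    by (rule add_nonneg_pos[OF norm_ge_zero])
  then show "Re (lap_sqrt s) > 0" unfolding lap_sqrt_def csqrt.sel
    by (simp only: real_sqrt_gt_0_iff) (rule divide_pos_pos, auto)
  then show "lap_sqrt s \<noteq> 0" by auto
qed

lemma lap_sqrt_deriv:
  assumes "s > 0"
  shows "(lap_sqrt has_vector_derivative (of_real s - \<i>) * lap_density s) (at s)"
proof -
  have d: "((\<lambda>s. Complex (s\<^sup>2) (- 2 * s)) has_vector_derivative 2 * (of_real s - \<i>)) (at s)"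
    unfolding Complex_eq power2_eq_square of_real_mult
    by (auto intro!: derivative_eq_intros has_vector_derivative_of_real simp: algebra_simps)
  have "(csqrt has_field_derivative inverse (2 * csqrt (Complex (s\<^sup>2) (- 2 * s)))) (at (Complex (s\<^sup>2) (- 2 * s)))"
    using assms by (intro has_field_derivative_csqrt) (auto simp: complex_nonpos_Reals_iff)
  from field_vector_diff_chain_at[OF d this]
  have "(lap_sqrt has_vector_derivative 2 * (of_real s - \<i>) * inverse (2 * lap_sqrt s)) (at s)"
    by (simp add: o_def lap_sqrt_def[abs_def])
  also have "2 * (of_real s - \<i>) * inverse (2 * lap_sqrt s) = (of_real s - \<i>) * lap_density s"
    by (simp add: lap_density_def)
  finally show ?thesis .
qed

lemma lap_density_bounds:
  assumes "s > 0"
  shows "norm (lap_density s) \<le> 1 / s" "norm (lap_density s) \<le> s powr (-1/2)"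
proof -
  have "norm (lap_density s) \<le> inverse s"
    unfolding lap_density_def norm_inverse using lap_sqrt_bounds(1)[OF assms] assms by (rule le_imp_inverse_le)
  then show "norm (lap_density s) \<le> 1 / s" by (simp add: divide_inverse)
  have "norm (lap_density s) \<le> inverse (sqrt s)"
    unfolding lap_density_def norm_inverse using lap_sqrt_bounds(2)[OF assms] assms by (intro le_imp_inverse_le) auto
  also have "inverse (sqrt s) = s powr (-1/2)"
    using assms powr_minus[of s "1/2"] by (simp add: powr_half_sqrt)
  finally show "norm (lap_density s) \<le> s powr (-1/2)" .
qed

text \<open>Only at s = 0 does the number under the root meet the branch cut, and one exceptional
  point does not affect measurability.\<close>

lemma lap_sqrt_measurable [measurable]: "lap_sqrt \<in> borel_measurable borel"
proof (rule borel_measurable_continuous_countable_exceptions[of "{0}"])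
  show "continuous_on (- {0}) lap_sqrt"
    unfolding lap_sqrt_def[abs_def] Complex_eq
    by (rule continuous_on_compose2[OF continuous_on_csqrt])
       (auto simp: complex_nonpos_Reals_iff intro!: continuous_intros)
qed auto

lemma lap_density_measurable [measurable]: "lap_density \<in> borel_measurable borel"
  unfolding lap_density_def[abs_def] by measurable

text \<open>Each derivative in z brings down a factor - s, so \<open>j\<close> counts derivatives,
  and \<open>j\<close> = 0, 1, 2 suffice for a second-order equation.\<close>

definition lap_integrand :: "nat \<Rightarrow> real \<Rightarrow> real \<Rightarrow> complex" where
  "lap_integrand j z s = indicator {0<..} s *\<^sub>R (of_real (s ^ j * exp (- z * s)) * lap_density s)"

definition lap_integral :: "nat \<Rightarrow> real \<Rightarrow> complex" where
  "lap_integral j z = (LINT s|lborel. lap_integrand j z s)"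

text \<open>Allowing a smaller \<open>z0\<close> in the exponent makes the Gamma integrand a
  majorant uniform over a half-line of \<open>z\<close>, as differentiation under the integral
  requires.\<close>

lemma lap_integrand_bound:
  assumes "z0 \<le> z"
  shows "norm (lap_integrand j z s) \<le> indicator {0<..} s * (s powr ((real j + 1/2) - 1) * exp (- z0 * s))"
proof (cases "s > 0")
  case True
  have "norm (lap_integrand j z s) = s ^ j * exp (- z * s) * norm (lap_density s)"
    using True by (simp add: lap_integrand_def norm_mult norm_power)
  also have "\<dots> \<le> s ^ j * exp (- z0 * s) * s powr (-1/2)"
    using True assms lap_density_bounds[OF True] by (intro mult_mono) auto
  also have "s ^ j * exp (- z0 * s) * s powr (-1/2) = s powr ((real j + 1/2) - 1) * exp (- z0 * s)"
    using True by (simp add: powr_realpow[symmetric] flip: powr_add)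
  finally show ?thesis using True by simp
qed (simp add: lap_integrand_def)

lemma lap_integrand_integrable:
  assumes "z > 0"
  shows "integrable lborel (lap_integrand j z)"
proof (rule Bochner_Integration.integrable_bound)
  show "integrable lborel (\<lambda>s. indicator {0<..} s * (s powr ((real j + 1/2) - 1) * exp (- z * s)))"
    by (rule gamma_laplace_integral) (use assms in auto)
  show "lap_integrand j z \<in> borel_measurable lborel" unfolding lap_integrand_def[abs_def] by measurable
  show "AE s in lborel. norm (lap_integrand j z s) \<le> norm (indicator {0<..} s * (s powr ((real j + 1/2) - 1) * exp (- z * s)))"
    using lap_integrand_bound[of z z j] by (auto intro!: AE_I2 order_trans[OF _ abs_ge_self])
qed

lemma lap_integral_bound:
  assumes "z > 0"
  shows "norm (lap_integral j z) \<le> Gamma (real j + 1/2) / z powr (real j + 1/2)"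
proof -
  have "norm (lap_integral j z) \<le> (LINT s|lborel. norm (lap_integrand j z s))"
    unfolding lap_integral_def by (rule integral_norm_bound)
  also have "\<dots> \<le> (LINT s|lborel. indicator {0<..} s * (s powr ((real j + 1/2) - 1) * exp (- z * s)))"
    by (rule integral_mono) (use lap_integrand_integrable[OF assms]
      gamma_laplace_integral(1)[OF assms, of "real j + 1/2"] lap_integrand_bound[of z z j] in auto)
  also have "\<dots> = Gamma (real j + 1/2) / z powr (real j + 1/2)"
    by (rule gamma_laplace_integral) (use assms in auto)
  finally show ?thesis .
qed

lemma lap_integral_deriv:
  assumes "z > 0"
  shows "(lap_integral j has_vector_derivative - lap_integral (Suc j) z) (at z)"
proof -
  have "((\<lambda>z. LINT s|lborel. lap_integrand j z s) has_vector_derivative (LINT s|lborel. - lap_integrand (Suc j) z s)) (at z)"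
  \<comment> \<open>The lower end z / 2 stays positive, so the Gamma integrand at z / 2 is an
    integrable majorant on the whole interval.\<close>
  proof (rule has_vector_derivative_integral(2)[of "z / 2" z "z + 1"])
    show "integrable lborel (lap_integrand j x)" if "z / 2 < x" for x
      using that assms by (intro lap_integrand_integrable) auto
    show "((\<lambda>x. lap_integrand j x s) has_vector_derivative - lap_integrand (Suc j) x s) (at x)" for x s
      unfolding lap_integrand_def
      by (auto intro!: derivative_eq_intros has_vector_derivative_of_real)
    show "norm (- lap_integrand (Suc j) x s) \<le> indicator {0<..} s * (s powr ((real (Suc j) + 1/2) - 1) * exp (- (z/2) * s))"
      if "z / 2 < x" for x s
      using lap_integrand_bound[of "z/2" x "Suc j" s] that by simp
    show "integrable lborel (\<lambda>s. indicator {0<..} s * (s powr ((real (Suc j) + 1/2) - 1) * exp (- (z/2) * s)))"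
      by (rule gamma_laplace_integral) (use assms in auto)
  qed (use assms in auto)
  then show ?thesis by (simp add: lap_integral_def[abs_def])
qed

text \<open>The combined integrand is the s-derivative of - exp (- z s) * \<open>lap_sqrt s\<close>,
  which vanishes at 0 and at infinity. The relation \<open>lap_sqrt s\<close> = (s^2 - 2 \<i> s) *
  \<open>lap_density s\<close> turns every term into a moment of the density.\<close>

lemma lap_integral_ode:
  assumes "z > 0"
  shows "of_real z * lap_integral 2 z - (2 * \<i> * of_real z + 1) * lap_integral 1 z + \<i> * lap_integral 0 z = 0"
proof -
  define f where "f = (\<lambda>s. of_real z * lap_integrand 2 z s - (2 * \<i> * of_real z + 1) * lap_integrand 1 z s + \<i> * lap_integrand 0 z s)"
  define g where "g = (\<lambda>s. of_real (exp (- z * s)) * (\<i> * lap_density s - of_real s * lap_density s + of_real z * lap_sqrt s))"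
  have fg: "f s = indicator {0<..} s *\<^sub>R g s" for s
  proof (cases "s > 0")
    case True
    have "lap_sqrt s = lap_sqrt s ^ 2 * lap_density s"
      using lap_sqrt_bounds(5)[OF True] by (simp add: lap_density_def power2_eq_square)
    moreover have "lap_sqrt s ^ 2 = of_real (s ^ 2) - 2 * \<i> * of_real s"
      unfolding lap_sqrt_square by (simp add: Complex_eq)
    ultimately have h: "lap_sqrt s = (of_real (s ^ 2) - 2 * \<i> * of_real s) * lap_density s"
      by metis
    show ?thesis unfolding g_def h using True
      by (simp add: f_def lap_integrand_def algebra_simps power2_eq_square Complex_eq)
  qed (simp add: f_def lap_integrand_def)
  have fi: "integrable lborel f"
    unfolding f_def using lap_integrand_integrable[OF assms]
    by (intro Bochner_Integration.integrable_add Bochner_Integration.integrable_diff integrable_mult_right) auto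
  have "(LINT s|lborel. f s) = of_real z * lap_integral 2 z - (2 * \<i> * of_real z + 1) * lap_integral 1 z + \<i> * lap_integral 0 z"
    unfolding f_def lap_integral_def using lap_integrand_integrable[OF assms]
    by (simp add: Bochner_Integration.integrable_diff)
  moreover have "(LBINT s=0..\<infinity>. g s) = 0 - 0"
  proof (rule interval_integral_FTC_integrable)
    let ?F = "\<lambda>s. - of_real (exp (- z * s)) * lap_sqrt s"
    show "(?F has_vector_derivative g s) (at s)" if "0 < ereal s" "ereal s < \<infinity>" for s
    proof -
      have "s > 0" using that by simp
      show ?thesis unfolding g_def
        apply (rule derivative_eq_intros has_vector_derivative_of_real lap_sqrt_deriv[OF \<open>s > 0\<close>] refl)+
        apply (simp add: algebra_simps Complex_eq)
        done
    qed
    have gc: "isCont lap_density s" if "s > 0" for s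
      unfolding lap_density_def[abs_def] using lap_sqrt_deriv[OF that] lap_sqrt_bounds(5)[OF that]
      by (intro continuous_intros) (auto dest: has_vector_derivative_continuous)
    show "isCont g s" if "0 < ereal s" "ereal s < \<infinity>" for s
      unfolding g_def using that gc[of s] lap_sqrt_deriv[of s]
      by (intro continuous_intros) (auto dest: has_vector_derivative_continuous)
    show "set_integrable lborel (einterval 0 \<infinity>) g"
      using fi unfolding set_integrable_def fg[symmetric] by (simp add: fg[abs_def] einterval_def greaterThan_def)
    have nb: "norm (?F s) \<le> exp (- z * s) * (2 * sqrt s * (1 + s))" if "s > 0" for s
      using lap_sqrt_bounds(3)[OF that] by (simp add: norm_mult)
    have "(?F \<longlongrightarrow> 0) (at_right 0)"
    proof (rule Lim_null_comparison)
      show "eventually (\<lambda>s. norm (?F s) \<le> exp (- z * s) * (2 * sqrt s * (1 + s))) (at_right 0)"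
        using nb by (auto simp: eventually_at_right_field intro!: exI[of _ 1])
      have "((\<lambda>s. exp (- z * s) * (2 * sqrt s * (1 + s))) \<longlongrightarrow> exp (- z * 0) * (2 * sqrt 0 * (1 + 0))) (at_right 0)"
        by (intro tendsto_intros)
      then show "((\<lambda>s. exp (- z * s) * (2 * sqrt s * (1 + s))) \<longlongrightarrow> 0) (at_right 0)" by simp
    qed
    then show "((?F \<circ> real_of_ereal) \<longlongrightarrow> 0) (at_right 0)"
      unfolding zero_ereal_def by (simp only: ereal_tendsto_simps)
    have "(?F \<longlongrightarrow> 0) at_top"
    proof (rule Lim_null_comparison)
      show "eventually (\<lambda>s. norm (?F s) \<le> exp (- z * s) * (2 * sqrt s * (1 + s))) at_top"
        by (rule eventually_mono[OF eventually_gt_at_top[of 0]]) (rule nb)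
      show "((\<lambda>s. exp (- z * s) * (2 * sqrt s * (1 + s))) \<longlongrightarrow> 0) at_top"
        using assms by real_asymp
    qed
    then show "((?F \<circ> real_of_ereal) \<longlongrightarrow> 0) (at_left \<infinity>)"
      by (simp only: ereal_tendsto_simps)
  qed simp
  moreover have "(LBINT s=0..\<infinity>. g s) = (LINT s|lborel. f s)"
    unfolding interval_lebesgue_integral_def set_lebesgue_integral_def fg
    by (simp add: einterval_def greaterThan_def)
  ultimately show ?thesis by simp
qed

section \<open>Behaviour of the Laplace integrals at the origin\<close>

lemma lborel_integral_from_HK:
  fixes f :: "real \<Rightarrow> real"
  assumes "f \<in> borel_measurable borel" "S \<in> sets borel" "\<And>x. x \<in> S \<Longrightarrow> f x \<ge> 0"
    and "(f has_integral I) S"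
  shows "integrable lborel (\<lambda>x. indicator S x * f x)" "(LINT x|lborel. indicator S x * f x) = I"
proof -
  have ai: "f absolutely_integrable_on S"
    using assms by (intro nonnegative_absolutely_integrable_1) (auto simp: integrable_on_def)
  have m: "(\<lambda>x. indicator S x * f x) \<in> borel_measurable lborel"
    using assms(1,2) by simp
  have "integrable lebesgue (\<lambda>x. indicator S x * f x)"
    using ai by (simp add: set_integrable_def)
  then show "integrable lborel (\<lambda>x. indicator S x * f x)"
    using integrable_completion[of "\<lambda>x. indicator S x * f x" lborel] m by simp
  have "(LINT x|lborel. indicator S x * f x) = (LINT x|lebesgue. indicator S x * f x)"
    using integral_completion[of "\<lambda>x. indicator S x * f x" lborel] m by simp
  also have "\<dots> = I"
    using set_lebesgue_integral_eq_integral(2)[OF ai] integral_unique[OF assms(4)]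
    by (simp add: set_lebesgue_integral_def)
  finally show "(LINT x|lborel. indicator S x * f x) = I" .
qed

lemma powr_integral_from_0:
  fixes a T :: real
  assumes "a > 0" "T \<ge> 0"
  shows "integrable lborel (\<lambda>x. indicator {0..T} x * x powr (a - 1))"
    "(LINT x|lborel. indicator {0..T} x * x powr (a - 1)) = T powr a / a"
  using lborel_integral_from_HK[OF _ _ _ has_integral_powr_from_0[of "a - 1" T]] assms by auto

lemma exp_minus_integral:
  "integrable lborel (\<lambda>t::real. indicator {0<..} t * exp (- t))"
  "(LINT t|lborel. indicator {0<..} t * exp (- t::real)) = 1"
proof -
  have *: "(\<lambda>s::real. indicator {0<..} s * (s powr (1 - 1) * exp (- 1 * s))) = (\<lambda>t. indicator {0<..} t * exp (- t))"
    by (auto simp: fun_eq_iff indicator_def)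
  show "integrable lborel (\<lambda>t::real. indicator {0<..} t * exp (- t))"
    "(LINT t|lborel. indicator {0<..} t * exp (- t::real)) = 1"
    using gamma_laplace_integral[of 1 1] unfolding * by simp_all
qed

text \<open>The value is the derivative of Gamma at 1. Replacing 1 / t by t^(1/T - 1) lets the two
  parts be integrated separately, to Gamma(1/T) and T, and Gamma(1/T) - T is the difference quotient
  of Gamma at 1 with step 1/T.\<close>

lemma euler_mascheroni_integral:
  defines "d \<equiv> \<lambda>t::real. indicator {0<..} t * ((exp (- t) - indicator {..1} t) / t)"
  shows "integrable lborel d" "(LINT t|lborel. d t) = - euler_mascheroni"
proof -
  define f where "f = (\<lambda>T t::real. indicator {0<..} t * (t powr (1 / T - 1) * (exp (- t) - indicator {..1} t)))"
  \<comment> \<open>On (0, 1] the factor exp (- t) - 1 is at most t in size and compensates the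
    singular power; beyond 1 the power is at most 1. This gives one majorant for all T >= 1.\<close>
  define w where "w = (\<lambda>t::real. indicator {0..1} t + indicator {0<..} t * exp (- t))"
  have w: "integrable lborel w"
    unfolding w_def using exp_minus_integral(1) by (intro Bochner_Integration.integrable_add) auto
  have dm: "d \<in> borel_measurable lborel" unfolding d_def by measurable
  have fm: "f T \<in> borel_measurable lborel" for T unfolding f_def by measurable
  have lim: "AE t in lborel. ((\<lambda>T. f T t) \<longlongrightarrow> d t) at_top"
  proof (rule AE_I2)
    fix t :: real
    show "((\<lambda>T. f T t) \<longlongrightarrow> d t) at_top"
    proof (cases "t > 0")
      case True
      have "((\<lambda>T. 1 / T - 1) \<longlongrightarrow> (-1::real)) at_top" by real_asymp
      then have "((\<lambda>T. t powr (1 / T - 1)) \<longlongrightarrow> t powr (-1)) at_top"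
        using True by (intro tendsto_intros) auto
      then have "((\<lambda>T. t powr (1 / T - 1) * (exp (- t) - indicator {..1} t)) \<longlongrightarrow> t powr (-1) * (exp (- t) - indicator {..1} t)) at_top"
        by (intro tendsto_mult tendsto_const)
      then show ?thesis using True by (simp add: f_def d_def powr_minus divide_inverse mult.commute)
    qed (simp add: f_def d_def)
  qed
  have bound: "\<forall>\<^sub>F T in at_top. AE t in lborel. norm (f T t) \<le> w t"
  proof (rule eventually_mono[OF eventually_ge_at_top[of 1]], rule AE_I2)
    fix T t :: real assume T: "1 \<le> T"
    show "norm (f T t) \<le> w t"
    proof (cases "t > 0")
      case t: True
      show ?thesis
      proof (cases "t \<le> 1")
        case True
        have "1 - exp (- t) \<le> t" using exp_ge_add_one_self[of "- t"] by simp
        moreover have "exp (- t) \<le> 1" using t by simp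
        ultimately have "norm (f T t) \<le> t powr (1 / T - 1) * t"
          using True t by (simp add: f_def abs_mult mult_left_mono)
        also have "\<dots> = t powr (1 / T)" using t by (simp add: powr_diff)
        also have "\<dots> \<le> 1" using t True T by (intro powr_le1) auto
        finally show ?thesis using True t by (simp add: w_def add_increasing2)
      next
        case False
        then have "t powr (1 / T - 1) \<le> t powr 0" using T by (intro powr_mono) auto
        then have "t powr (1 / T - 1) \<le> 1" using t by simp
        then show ?thesis using False by (simp add: f_def w_def abs_mult mult_left_le_one_le)
      qed
    qed (simp add: f_def w_def)
  qed
  show "integrable lborel d"
    by (rule integrable_dominated_convergence_at_top[OF dm fm w lim bound]) 
  have L1: "((\<lambda>T. LINT t|lborel. f T t) \<longlongrightarrow> (LINT t|lborel. d t)) at_top"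
    by (rule integral_dominated_convergence_at_top[OF dm fm w lim bound])
  have val: "(LINT t|lborel. f T t) = (Gamma (1 + 1 / T) - Gamma 1) / (1 / T)" if "T > 0" for T
  proof -
    have "f T = (\<lambda>t. indicator {0<..} t * (t powr (1/T - 1) * exp (- 1 * t)) - indicator {0..1} t * t powr (1 / T - 1))"
      by (auto simp: f_def fun_eq_iff indicator_def algebra_simps)
    then have "(LINT t|lborel. f T t) = Gamma (1 / T) - T"
      using gamma_laplace_integral[of 1 "1 / T"] powr_integral_from_0[of "1 / T" 1] that by simp
    also have "\<dots> = (Gamma (1 + 1 / T) - Gamma 1) / (1 / T)"
    proof -
      have "1 / T \<notin> \<int>\<^sub>\<le>\<^sub>0"
        using that by (metis divide_pos_pos nonpos_Ints_nonpos not_le zero_less_one)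
      then have "Gamma (1 + 1 / T) = 1 / T * Gamma (1 / T)"
        using Gamma_plus1[of "1 / T"] by (simp add: add.commute)
      then show ?thesis using that by (simp add: field_simps)
    qed
    finally show ?thesis .
  qed
  have "(Gamma has_real_derivative Gamma 1 * Digamma 1) (at (1::real))"
    by (rule has_field_derivative_Gamma) auto
  then have "((\<lambda>h. (Gamma (1 + h) - Gamma 1) / h) \<longlongrightarrow> - euler_mascheroni) (at (0::real))"
    by (simp add: DERIV_def)
  moreover have "filterlim (\<lambda>T::real. 1 / T) (at 0) at_top"
    by real_asymp
  ultimately have "((\<lambda>T. (Gamma (1 + 1 / T) - Gamma 1) / (1 / T)) \<longlongrightarrow> - (euler_mascheroni::real)) at_top"
    by (rule filterlim_compose)
  then have "((\<lambda>T. LINT t|lborel. f T t) \<longlongrightarrow> - euler_mascheroni) at_top"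
    by (rule Lim_transform_eventually)
       (auto simp: val intro!: eventually_mono[OF eventually_gt_at_top[of 0]])
  with L1 show "(LINT t|lborel. d t) = - euler_mascheroni"
    by (intro tendsto_unique[of at_top]) auto
qed

text \<open>Under scaling the linear term acquires a factor 1 / T, so for large T the root looks
  like T t. The principal branch is respected because T is positive.\<close>

lemma lap_sqrt_scale:
  assumes "T > 0"
  shows "lap_sqrt (T * t) = of_real T * csqrt (Complex (t\<^sup>2) (- 2 * t / T))"
proof -
  have "Complex ((T * t)\<^sup>2) (- 2 * (T * t)) = (of_real T * csqrt (Complex (t\<^sup>2) (- 2 * t / T)))\<^sup>2"
    unfolding power_mult_distrib power2_csqrt using assms by (simp add: complex_eq_iff power2_eq_square)
  moreover have "csqrt ((of_real T * csqrt (Complex (t\<^sup>2) (- 2 * t / T)))\<^sup>2) = of_real T * csqrt (Complex (t\<^sup>2) (- 2 * t / T))"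
  proof (rule csqrt_unique[OF refl])
    have "0 < Re (csqrt w) \<or> Re (csqrt w) = 0 \<and> 0 \<le> Im (csqrt w)" for w
      by (rule csqrt_principal)
    then show "0 < Re (of_real T * csqrt (Complex (t\<^sup>2) (- 2 * t / T))) \<or>
      Re (of_real T * csqrt (Complex (t\<^sup>2) (- 2 * t / T))) = 0 \<and>
      0 \<le> Im (of_real T * csqrt (Complex (t\<^sup>2) (- 2 * t / T)))"
      using assms by (simp only: Re_complex_of_real Im_complex_of_real times_complex.sel)
        (simp add: zero_less_mult_iff zero_le_mult_iff del: csqrt.sel)
  qed
  ultimately show ?thesis by (simp only: lap_sqrt_def)
qed

lemma lap_density_scale_limit:
  assumes "t > 0"
  shows "((\<lambda>T. of_real T * lap_density (T * t)) \<longlongrightarrow> of_real (1 / t)) at_top"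
proof -
  have "((\<lambda>T. Complex (t\<^sup>2) (- 2 * t / T)) \<longlongrightarrow> Complex (t\<^sup>2) 0) at_top"
    by (intro tendsto_Complex) real_asymp+
  moreover have "isCont csqrt (Complex (t\<^sup>2) 0)"
    using assms by (intro continuous_at_csqrt) (auto simp: complex_nonpos_Reals_iff)
  ultimately have "((\<lambda>T. csqrt (Complex (t\<^sup>2) (- 2 * t / T))) \<longlongrightarrow> csqrt (Complex (t\<^sup>2) 0)) at_top"
    by (rule isCont_tendsto_compose[rotated])
  moreover have "csqrt (Complex (t\<^sup>2) 0) = of_real t"
    using assms by (simp add: real_sqrt_abs del: csqrt.simps)
  ultimately have *: "((\<lambda>T. inverse (csqrt (Complex (t\<^sup>2) (- 2 * t / T)))) \<longlongrightarrow> of_real (1 / t)) at_top"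
    using assms by (auto intro!: tendsto_eq_intros simp: divide_inverse simp del: csqrt.simps)
  show ?thesis
    by (rule Lim_transform_eventually[OF *])
       (auto simp: lap_density_def lap_sqrt_scale simp del: csqrt.simps intro!: eventually_mono[OF eventually_gt_at_top[of 0]])
qed

text \<open>With w = \<open>lap_sqrt s\<close>, the function Ln (s - \<i> + w) is a primitive
  because w' = (s - \<i>) / w, and for s > 0 its argument stays in the right half-plane. Its limit
  at s = 0 is Ln (- \<i>) = - \<i> pi / 2.\<close>

lemma lap_density_integral:
  assumes "T > 0"
  shows "integrable lborel (\<lambda>s. indicator {0<..T} s *\<^sub>R lap_density s)"
    "(LINT s|lborel. indicator {0<..T} s *\<^sub>R lap_density s) = Ln (of_real T - \<i> + lap_sqrt T) + \<i> * (pi / 2)"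
proof -
  have int: "integrable lborel (\<lambda>s. indicator {0<..T} s *\<^sub>R lap_density s)"
  proof (rule Bochner_Integration.integrable_bound)
    show "integrable lborel (\<lambda>x. indicator {0..T} x * x powr (1/2 - 1))"
      by (rule powr_integral_from_0) (use assms in auto)
    show "AE s in lborel. norm (indicator {0<..T} s *\<^sub>R lap_density s) \<le> norm (indicator {0..T} s * s powr (1/2 - 1))"
      using lap_density_bounds(2) by (auto simp: indicator_def)
  qed measurable
  then show "integrable lborel (\<lambda>s. indicator {0<..T} s *\<^sub>R lap_density s)" .
  have Rp: "Re (of_real s - \<i> + lap_sqrt s) > 0" if "s > 0" for s
    using lap_sqrt_bounds(4)[OF that] that by simp
  have hc: "isCont lap_sqrt s" if "s > 0" for s
    using lap_sqrt_deriv[OF that] by (auto dest: has_vector_derivative_continuous)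
  have "(LBINT s=0..T. lap_density s) = Ln (of_real T - \<i> + lap_sqrt T) - Ln (- \<i>)"
  proof (rule interval_integral_FTC_integrable)
    let ?F = "\<lambda>s. Ln (of_real s - \<i> + lap_sqrt s)"
    show "(?F has_vector_derivative lap_density s) (at s)" if "0 < ereal s" "ereal s < ereal T" for s
    proof -
      have s: "s > 0" using that by simp
      have d: "((\<lambda>s. of_real s - \<i> + lap_sqrt s) has_vector_derivative (1 + (of_real s - \<i>) * lap_density s)) (at s)"
        by (rule derivative_eq_intros has_vector_derivative_of_real lap_sqrt_deriv[OF s] refl)+ simp
      have "(Ln has_field_derivative inverse (of_real s - \<i> + lap_sqrt s)) (at (of_real s - \<i> + lap_sqrt s))"
        by (rule has_field_derivative_Ln) (use Rp[OF s] in \<open>auto simp: complex_nonpos_Reals_iff\<close>)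
      from field_vector_diff_chain_at[OF d this]
      have "(?F has_vector_derivative (1 + (of_real s - \<i>) * lap_density s) * inverse (of_real s - \<i> + lap_sqrt s)) (at s)"
        by (simp add: o_def)
      also have "(1 + (of_real s - \<i>) * lap_density s) * inverse (of_real s - \<i> + lap_sqrt s) = lap_density s"
      proof -
        have "of_real s - \<i> + lap_sqrt s \<noteq> 0" using Rp[OF s] by (metis less_irrefl zero_complex.sel(1))
        moreover have "1 + (of_real s - \<i>) * lap_density s = lap_density s * (of_real s - \<i> + lap_sqrt s)"
          using lap_sqrt_bounds(5)[OF s] by (simp add: lap_density_def algebra_simps)
        ultimately show ?thesis by simp
      qed
      finally show ?thesis .
    qed
    show "isCont lap_density s" if "0 < ereal s" "ereal s < ereal T" for s
      unfolding lap_density_def[abs_def] using hc[of s] lap_sqrt_bounds(5)[of s] that by (intro continuous_intros) auto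
    have "integrable lborel (\<lambda>s. indicator {0<..<T} s *\<^sub>R (indicator {0<..T} s *\<^sub>R lap_density s))"
      using integrable_mult_indicator[OF _ int, of "{0<..<T}"] by simp
    also have "(\<lambda>s. indicator {0<..<T} s *\<^sub>R (indicator {0<..T} s *\<^sub>R lap_density s)) = (\<lambda>s. indicator {0<..<T} s *\<^sub>R lap_density s)"
      by (auto simp: indicator_def)
    finally show "set_integrable lborel (einterval 0 (ereal T)) lap_density"
      by (simp add: set_integrable_def zero_ereal_def)
    have "(lap_sqrt \<longlongrightarrow> 0) (at_right 0)"
    proof (rule Lim_null_comparison)
      show "eventually (\<lambda>s. norm (lap_sqrt s) \<le> 2 * sqrt s * (1 + s)) (at_right 0)"
        using lap_sqrt_bounds(3) by (auto simp: eventually_at_right_field intro!: exI[of _ 1])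
      have "((\<lambda>s. 2 * sqrt s * (1 + s)) \<longlongrightarrow> 2 * sqrt 0 * (1 + 0)) (at_right (0::real))"
        by (intro tendsto_intros)
      then show "((\<lambda>s. 2 * sqrt s * (1 + s)) \<longlongrightarrow> 0) (at_right (0::real))" by simp
    qed
    then have "((\<lambda>s. of_real s - \<i> + lap_sqrt s) \<longlongrightarrow> of_real 0 - \<i> + 0) (at_right 0)"
      by (intro tendsto_intros)
    then have "(?F \<longlongrightarrow> Ln (of_real 0 - \<i> + 0)) (at_right 0)"
      by (rule tendsto_Ln) (auto simp: complex_nonpos_Reals_iff)
    then show "((?F \<circ> real_of_ereal) \<longlongrightarrow> Ln (- \<i>)) (at_right 0)"
      unfolding zero_ereal_def by (simp only: ereal_tendsto_simps) simp
    have "isCont ?F T"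
      using hc[OF assms] Rp[OF assms] by (intro continuous_intros) (auto simp: complex_nonpos_Reals_iff)
    then have "(?F \<longlongrightarrow> ?F T) (at_left T)"
      unfolding isCont_def by (rule tendsto_within_subset) auto
    then show "((?F \<circ> real_of_ereal) \<longlongrightarrow> ?F T) (at_left (ereal T))"
      by (simp only: ereal_tendsto_simps)
  qed (use assms in auto)
  moreover have "(LBINT s=0..T. lap_density s) = (LINT s|lborel. indicator {0<..T} s *\<^sub>R lap_density s)"
    unfolding zero_ereal_def using assms 
    by (simp add: interval_integral_Ioc set_lebesgue_integral_def)
  ultimately show "(LINT s|lborel. indicator {0<..T} s *\<^sub>R lap_density s) = Ln (of_real T - \<i> + lap_sqrt T) + \<i> * (pi / 2)"
    by simp
qed

text \<open>The argument of the logarithm is asymptotic to 2 T; here the ln 2 in ln (z / 2)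
  originates.\<close>

lemma lap_density_integral_asymp:
  "((\<lambda>T. Ln (of_real T - \<i> + lap_sqrt T) - of_real (ln T)) \<longlongrightarrow> of_real (ln 2)) at_top"
proof -
  have "((\<lambda>T. Complex 1 (- 2 / T)) \<longlongrightarrow> Complex 1 0) at_top"
    by (intro tendsto_Complex) real_asymp+
  moreover have "isCont csqrt (Complex 1 0)"
    by (intro continuous_at_csqrt) (auto simp: complex_nonpos_Reals_iff)
  ultimately have "((\<lambda>T. csqrt (Complex 1 (- 2 / T))) \<longlongrightarrow> csqrt (Complex 1 0)) at_top"
    by (rule isCont_tendsto_compose[rotated])
  then have c: "((\<lambda>T. csqrt (Complex 1 (- 2 / T))) \<longlongrightarrow> 1) at_top"
    by (simp add: Complex_eq del: csqrt.simps)
  have "((\<lambda>T::real. 1 / T) \<longlongrightarrow> 0) at_top" by real_asymp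
  then have "((\<lambda>T. 1 - \<i> * of_real (1 / T) + csqrt (Complex 1 (- 2 / T))) \<longlongrightarrow> 1 - \<i> * of_real 0 + 1) at_top"
    by (intro tendsto_intros c)
  then have "((\<lambda>T. Ln (1 - \<i> * of_real (1 / T) + csqrt (Complex 1 (- 2 / T)))) \<longlongrightarrow> Ln (1 - \<i> * of_real 0 + 1)) at_top"
    by (rule tendsto_Ln) (auto simp: complex_nonpos_Reals_iff)
  also have "Ln (1 - \<i> * of_real 0 + 1) = of_real (ln 2)"
    using Ln_of_real[of 2] by simp
  finally show ?thesis
  proof (rule Lim_transform_eventually, intro eventually_mono[OF eventually_gt_at_top[of 0]])
    fix T :: real assume T: "T > 0"
    define q where "q = csqrt (Complex 1 (- 2 / T))"
    have q: "lap_sqrt T = of_real T * q" using lap_sqrt_scale[OF T, of 1] by (simp add: q_def del: csqrt.simps)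
    have eq: "of_real T - \<i> + lap_sqrt T = of_real T * (1 - \<i> * of_real (1 / T) + q)"
      unfolding q using T by (simp add: algebra_simps)
    have "Re (of_real T - \<i> + lap_sqrt T) > 0" using lap_sqrt_bounds(4)[OF T] T by simp
    then have "of_real T - \<i> + lap_sqrt T \<noteq> 0" by (metis less_irrefl zero_complex.sel(1))
    then have "1 - \<i> * of_real (1 / T) + q \<noteq> 0" unfolding eq by (metis mult_zero_right)
    then show "Ln (1 - \<i> * of_real (1 / T) + csqrt (Complex 1 (- 2 / T))) = Ln (of_real T - \<i> + lap_sqrt T) - of_real (ln T)"
      unfolding eq q_def[symmetric] using Ln_times_of_real[OF T] Ln_of_real[OF T] by (simp del: csqrt.simps)
  qed
qed

text \<open>Pointwise T * \<open>lap_density\<close> (T t) tends to 1 / t, and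
  |\<open>lap_density s\<close>| <= 1 / s makes |m t| / t a majorant for every T > 0.\<close>

lemma lap_dominated_scaling:
  fixes m :: "real \<Rightarrow> real"
  assumes m: "m \<in> borel_measurable borel" and i: "integrable lborel (\<lambda>t. indicator {0<..} t * (m t / t))"
  shows "((\<lambda>T. LINT t|lborel. indicator {0<..} t *\<^sub>R (of_real (m t) * (of_real T * lap_density (T * t)))) \<longlongrightarrow>
    of_real (LINT t|lborel. indicator {0<..} t * (m t / t))) at_top"
proof -
  define d where "d = (\<lambda>t. indicator {0<..} t * (m t / t))"
  define f where "f = (\<lambda>T t. indicator {0<..} t *\<^sub>R (of_real (m t) * (of_real T * lap_density (T * t))))"
  have w: "integrable lborel (\<lambda>t. norm (d t))" using i unfolding d_def by (rule integrable_norm)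
  have dm: "(\<lambda>t. complex_of_real (d t)) \<in> borel_measurable lborel" unfolding d_def using m by measurable
  have fm: "f T \<in> borel_measurable lborel" for T unfolding f_def using m by measurable
  have lim: "AE t in lborel. ((\<lambda>T. f T t) \<longlongrightarrow> of_real (d t)) at_top"
  proof (rule AE_I2)
    fix t :: real
    show "((\<lambda>T. f T t) \<longlongrightarrow> of_real (d t)) at_top"
    proof (cases "t > 0")
      case True
      have "((\<lambda>T. of_real (m t) * (of_real T * lap_density (T * t))) \<longlongrightarrow> of_real (m t) * of_real (1 / t)) at_top"
        by (intro tendsto_mult tendsto_const lap_density_scale_limit True)
      then show ?thesis using True by (simp add: f_def d_def)
    qed (simp add: f_def d_def)
  qed
  have bound: "\<forall>\<^sub>F T in at_top. AE t in lborel. norm (f T t) \<le> norm (d t)"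
  proof (rule eventually_mono[OF eventually_gt_at_top[of 0]], rule AE_I2)
    fix T t :: real assume T: "0 < T"
    show "norm (f T t) \<le> norm (d t)"
    proof (cases "t > 0")
      case True
      have nh: "norm (of_real T * lap_density (T * t)) \<le> 1 / t"
        using lap_density_bounds(1)[of "T * t"] T True by (simp add: norm_mult field_simps)
      have "norm (f T t) = \<bar>m t\<bar> * norm (of_real T * lap_density (T * t))"
        unfolding f_def norm_scaleR norm_mult norm_of_real using True by simp
      also have "\<dots> \<le> \<bar>m t\<bar> * (1 / t)" using nh by (intro mult_left_mono) auto
      finally show ?thesis using True by (simp add: d_def abs_mult)
    qed (simp add: f_def)
  qed
  have "((\<lambda>T. LINT t|lborel. f T t) \<longlongrightarrow> (LINT t|lborel. of_real (d t))) at_top"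
    by (rule integral_dominated_convergence_at_top[OF dm fm w lim bound])
  then show ?thesis unfolding integral_complex_of_real f_def d_def .
qed

text \<open>After s = T t, with z = 1 / T, the integral diverges as T grows because the limiting
  density is 1 / t near 0. Subtracting the integral over t <= 1, known in closed form, leaves an
  integral that converges to - \<open>euler_mascheroni\<close>.\<close>

lemma lap_integral0_small:
  "((\<lambda>T. lap_integral 0 (1 / T) - of_real (ln T)) \<longlongrightarrow> of_real (ln 2 - euler_mascheroni) + \<i> * (pi / 2)) at_top"
proof -
  define m where "m = (\<lambda>t::real. exp (- t) - indicator {..1} t)"
  define f where "f = (\<lambda>T t. indicator {0<..} t *\<^sub>R (of_real (m t) * (of_real T * lap_density (T * t))))"
  have fi: "((\<lambda>T. LINT t|lborel. f T t) \<longlongrightarrow> of_real (- euler_mascheroni)) at_top"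
    unfolding f_def euler_mascheroni_integral(2)[symmetric] m_def
    by (rule lap_dominated_scaling) (measurable, rule euler_mascheroni_integral)
  have val: "(LINT t|lborel. f T t) = lap_integral 0 (1 / T) - (Ln (of_real T - \<i> + lap_sqrt T) + \<i> * (pi / 2))" if T: "T > 0" for T
  proof -
    have "integrable lborel (\<lambda>t. lap_integrand 0 (1 / T) (0 + T * t))"
      by (rule lborel_integrable_real_affine) (use T lap_integrand_integrable in auto)
    moreover have "integrable lborel (\<lambda>t. indicator {0<..T} (0 + T * t) *\<^sub>R lap_density (0 + T * t))"
      by (rule lborel_integrable_real_affine) (use T lap_density_integral in auto)
    moreover have "f T = (\<lambda>t. T *\<^sub>R lap_integrand 0 (1 / T) (0 + T * t) - T *\<^sub>R (indicator {0<..T} (0 + T * t) *\<^sub>R lap_density (0 + T * t)))"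
      using T by (auto simp: f_def m_def lap_integrand_def fun_eq_iff indicator_def zero_less_mult_iff scaleR_conv_of_real algebra_simps)
    ultimately have "(LINT t|lborel. f T t) = T *\<^sub>R (LINT t|lborel. lap_integrand 0 (1 / T) (0 + T * t))
        - T *\<^sub>R (LINT t|lborel. indicator {0<..T} (0 + T * t) *\<^sub>R lap_density (0 + T * t))"
      by (simp only: Bochner_Integration.integral_diff integrable_scaleR_right integral_scaleR_right)
    then show ?thesis
      using lborel_integral_real_affine[of T "lap_integrand 0 (1 / T)" 0]
        lborel_integral_real_affine[of T "\<lambda>s. indicator {0<..T} s *\<^sub>R lap_density s" 0] T lap_density_integral(2)[OF T]
      by (simp add: lap_integral_def)
  qed
  have *: "((\<lambda>T. (LINT t|lborel. f T t) + (Ln (of_real T - \<i> + lap_sqrt T) - of_real (ln T)) + \<i> * (pi / 2)) \<longlongrightarrow>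
     of_real (- euler_mascheroni) + of_real (ln 2) + \<i> * (pi / 2)) at_top"
    by (intro tendsto_add fi lap_density_integral_asymp tendsto_const)
  have "((\<lambda>T. lap_integral 0 (1 / T) - of_real (ln T)) \<longlongrightarrow> of_real (- euler_mascheroni) + of_real (ln 2) + \<i> * (pi / 2)) at_top"
    by (rule Lim_transform_eventually[OF *])
       (auto simp: val intro!: eventually_mono[OF eventually_gt_at_top[of 0]])
  then show ?thesis by simp
qed

text \<open>The extra factor t cancels the limiting density 1 / t and leaves the integral of exp (-
  t), which is 1.\<close>

lemma lap_integral1_small: "((\<lambda>T. lap_integral 1 (1 / T) / of_real T) \<longlongrightarrow> 1) at_top"
proof -
  define f where "f = (\<lambda>T t. indicator {0<..} t *\<^sub>R (of_real (t * exp (- t)) * (of_real T * lap_density (T * t))))"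
  have e: "(\<lambda>t::real. indicator {0<..} t * (t * exp (- t) / t)) = (\<lambda>t. indicator {0<..} t * exp (- t))"
    by (auto simp: indicator_def)
  have fi: "((\<lambda>T. LINT t|lborel. f T t) \<longlongrightarrow> 1) at_top"
    using lap_dominated_scaling[of "\<lambda>t. t * exp (- t)"] exp_minus_integral unfolding e f_def by simp
  have val: "(LINT t|lborel. f T t) = lap_integral 1 (1 / T) / of_real T" if T: "T > 0" for T
  proof -
    have "f T = (\<lambda>t. lap_integrand 1 (1 / T) (0 + T * t))"
      using T by (auto simp: f_def lap_integrand_def fun_eq_iff indicator_def zero_less_mult_iff)
    then show ?thesis
      using lborel_integral_real_affine[of T "lap_integrand 1 (1 / T)" 0] T
      by (simp add: lap_integral_def scaleR_conv_of_real)
  qed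
  show ?thesis
    by (rule Lim_transform_eventually[OF fi])
       (auto simp: val intro!: eventually_mono[OF eventually_gt_at_top[of 0]])
qed

section \<open>Identification of the Hankel functions with the Laplace integrals\<close>

text \<open>The energy |h|^2 + |g|^2 has derivative - 2 |g|^2 / z and so never increases; it
  suffices that it becomes arbitrarily small near 0.\<close>

lemma bessel_ode_unique:
  fixes h g :: "real \<Rightarrow> complex"
  assumes h: "\<And>z. z > 0 \<Longrightarrow> (h has_vector_derivative - g z) (at z)"
    and g: "\<And>z. z > 0 \<Longrightarrow> (g has_vector_derivative h z - g z / of_real z) (at z)"
    and h0: "(h \<longlongrightarrow> 0) (at_right 0)" and g0: "((\<lambda>z. of_real z * g z) \<longlongrightarrow> 0) (at_right 0)"
    and z: "z > 0"
  shows "h z = 0" "g z = 0"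
proof -
  define E where "E = (\<lambda>z. h z \<bullet> h z + g z \<bullet> g z)"
  have E': "(E has_vector_derivative - 2 * (g z \<bullet> g z) / z) (at z)" if "z > 0" for z
  proof -
    have 1: "((\<lambda>z. h z \<bullet> h z) has_vector_derivative h z \<bullet> (- g z) + (- g z) \<bullet> h z) (at z)"
      by (rule bounded_bilinear.has_vector_derivative[OF bounded_bilinear_inner h[OF that] h[OF that]])
    have 2: "((\<lambda>z. g z \<bullet> g z) has_vector_derivative g z \<bullet> (h z - g z / of_real z) + (h z - g z / of_real z) \<bullet> g z) (at z)"
      by (rule bounded_bilinear.has_vector_derivative[OF bounded_bilinear_inner g[OF that] g[OF that]])
    have "g z / of_real z = (1 / z) *\<^sub>R g z" by (simp add: scaleR_conv_of_real)
    then have "h z \<bullet> (- g z) + (- g z) \<bullet> h z + (g z \<bullet> (h z - g z / of_real z) + (h z - g z / of_real z) \<bullet> g z)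
        = - 2 * (g z \<bullet> g z) / z"
      by (simp add: inner_diff_left inner_diff_right inner_commute)
    then show ?thesis using has_vector_derivative_add[OF 1 2] by (simp add: E_def)
  qed
  have dec: "E y \<le> E x" if "0 < x" "x \<le> y" for x y
  proof (rule DERIV_nonpos_imp_nonincreasing[OF \<open>x \<le> y\<close>])
    fix t assume "x \<le> t" "t \<le> y"
    then have "t > 0" using that by simp
    then show "\<exists>d. DERIV E t :> d \<and> d \<le> 0"
      using E'[of t] by (auto simp: has_real_derivative_iff_has_vector_derivative divide_nonpos_pos intro!: exI)
  qed
  have "E z \<le> 0"
  proof (rule field_le_epsilon)
    fix e :: real assume e: "e > 0"
    define \<eta> where "\<eta> = sqrt (e / 2)"
    have \<eta>: "\<eta> > 0" "\<eta>\<^sup>2 = e / 2" using e by (auto simp: \<eta>_def)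
    from tendstoD[OF h0 \<eta>(1)] obtain b where b: "b > 0" "\<And>x. 0 < x \<Longrightarrow> x < b \<Longrightarrow> norm (h x) < \<eta>"
      unfolding eventually_at_right_field by auto
    define x where "x = min (min (b / 2) 1) z"
    have x: "0 < x" "x < b" "x \<le> 1" "x \<le> z" using b(1) z by (auto simp: x_def)
    \<comment> \<open>The hypothesis on g is only that z g tends to 0. Since (z g)' = z h,
      integrating from 0 upgrades it to |g x| <= \<eta> wherever |h| < \<eta> up to x.\<close>
    have D: "((\<lambda>z. of_real z * g z) has_vector_derivative of_real t * h t) (at t)" if "t > 0" for t
      apply (rule derivative_eq_intros has_vector_derivative_of_real g[OF that] refl)+
      using that by (simp add: field_simps)
    have *: "norm (of_real x * g x) \<le> norm (of_real s * g s) + \<eta> * x" if s: "0 < s" "s \<le> x" for s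
    proof -
      have "norm (of_real x * g x - of_real s * g s) \<le> \<eta> * norm (x - s)"
      proof (rule differentiable_bound[of "{s..x}"])
        show "((\<lambda>z. of_real z * g z) has_derivative (\<lambda>k. k *\<^sub>R (of_real t * h t))) (at t within {s..x})" if "t \<in> {s..x}" for t
          using D[of t] that s by (auto simp: has_vector_derivative_def intro: has_derivative_at_withinI)
        show "onorm (\<lambda>k. k *\<^sub>R (of_real t * h t)) \<le> \<eta>" if "t \<in> {s..x}" for t
        proof -
          have "norm (of_real t * h t) \<le> 1 * \<eta>"
            unfolding norm_mult using that s x b(2)[of t] by (intro mult_mono) auto
          then show ?thesis by (simp add: onorm_scaleR_left onorm_id)
        qed
      qed (use s in auto)
      also have "\<dots> \<le> \<eta> * x" using s \<eta> by (intro mult_left_mono) auto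
      finally show ?thesis
        using norm_triangle_sub[of "of_real x * g x" "of_real s * g s"] by linarith
    qed
    have "norm (of_real x * g x) \<le> 0 + \<eta> * x"
    proof (rule tendsto_lowerbound)
      show "((\<lambda>s. norm (of_real s * g s) + \<eta> * x) \<longlongrightarrow> 0 + \<eta> * x) (at_right 0)"
        using tendsto_norm_zero[OF g0] by (intro tendsto_intros)
      show "\<forall>\<^sub>F s in at_right 0. norm (of_real x * g x) \<le> norm (of_real s * g s) + \<eta> * x"
        unfolding eventually_at_right_field using * x(1) by (intro exI[of _ x]) auto
    qed simp
    then have "norm (g x) \<le> \<eta>" using x by (simp add: norm_mult mult.commute)
    moreover have "norm (h x) \<le> \<eta>" using b(2)[of x] x by auto
    ultimately have "(norm (h x))\<^sup>2 + (norm (g x))\<^sup>2 \<le> \<eta>\<^sup>2 + \<eta>\<^sup>2"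
      by (intro add_mono power_mono) auto
    then have "E x \<le> e" using \<eta> by (simp add: E_def power2_norm_eq_inner)
    then show "E z \<le> 0 + e" using dec[of x z] x by simp
  qed
  moreover have "h z \<bullet> h z \<ge> 0" "g z \<bullet> g z \<ge> 0" by auto
  ultimately have "h z \<bullet> h z = 0" "g z \<bullet> g z = 0" unfolding E_def by linarith+
  then show "h z = 0" "g z = 0" by auto
qed

definition lap_hankel0 :: "real \<Rightarrow> complex" where
  "lap_hankel0 z = - (2 * \<i> / pi) * (exp (\<i> * z) * lap_integral 0 z)"

text \<open>Minus the derivative of \<open>lap_hankel0\<close>, in accordance with H0' = -
  H1.\<close>

definition lap_hankel1 :: "real \<Rightarrow> complex" where
  "lap_hankel1 z = - (2 * \<i> / pi) * (exp (\<i> * z) * (lap_integral 1 z - \<i> * lap_integral 0 z))"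

lemma lap_hankel_deriv:
  assumes z: "z > 0"
  shows "(lap_hankel0 has_vector_derivative - lap_hankel1 z) (at z)"
    "(lap_hankel1 has_vector_derivative lap_hankel0 z - lap_hankel1 z / of_real z) (at z)"
proof -
  have e: "((\<lambda>z. exp (\<i> * of_real z)) has_vector_derivative \<i> * exp (\<i> * of_real z)) (at z)"
    by (rule has_vector_derivative_real_field) (auto intro!: derivative_eq_intros)
  note l = lap_integral_deriv[OF z, of 0] lap_integral_deriv[OF z, of 1]
  have F: "((\<lambda>z. exp (\<i> * of_real z) * lap_integral 0 z) has_vector_derivative
      exp (\<i> * of_real z) * (- lap_integral (Suc 0) z) + \<i> * exp (\<i> * of_real z) * lap_integral 0 z) (at z)"
    by (rule has_vector_derivative_mult[OF e l(1)])
  have G: "((\<lambda>z. exp (\<i> * of_real z) * (lap_integral 1 z - \<i> * lap_integral 0 z)) has_vector_derivative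
      exp (\<i> * of_real z) * (- lap_integral (Suc 1) z - \<i> * (- lap_integral (Suc 0) z)) + \<i> * exp (\<i> * of_real z) * (lap_integral 1 z - \<i> * lap_integral 0 z)) (at z)"
    by (intro has_vector_derivative_mult[OF e] has_vector_derivative_diff l has_vector_derivative_mult_right)
  show "(lap_hankel0 has_vector_derivative - lap_hankel1 z) (at z)"
    unfolding lap_hankel0_def[abs_def] lap_hankel1_def
    by (rule has_vector_derivative_eq_rhs[OF has_vector_derivative_mult_right[OF F]]) (simp add: algebra_simps)
  \<comment> \<open>The moment relation eliminates the second derivative of the integral; beyond the
    product rule nothing else enters.\<close>
  have "of_real z * lap_integral 2 z = (2 * \<i> * of_real z + 1) * lap_integral 1 z - \<i> * lap_integral 0 z"
    using lap_integral_ode[OF z] by (simp add: algebra_simps)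
  then have ode: "lap_integral 2 z = ((2 * \<i> * of_real z + 1) * lap_integral 1 z - \<i> * lap_integral 0 z) / of_real z"
    using z by (simp add: field_simps)
  have "exp (\<i> * of_real z) * (- lap_integral (Suc 1) z - \<i> * (- lap_integral (Suc 0) z)) + \<i> * exp (\<i> * of_real z) * (lap_integral 1 z - \<i> * lap_integral 0 z)
     = exp (\<i> * of_real z) * lap_integral 0 z - exp (\<i> * of_real z) * (lap_integral 1 z - \<i> * lap_integral 0 z) / of_real z"
    using z unfolding Suc_1 ode by (simp add: field_simps)
  note G' = has_vector_derivative_mult_right[OF G, of "- (2 * \<i> / pi)", unfolded this]
  show "(lap_hankel1 has_vector_derivative lap_hankel0 z - lap_hankel1 z / of_real z) (at z)"
    unfolding lap_hankel0_def lap_hankel1_def[abs_def]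
    by (rule has_vector_derivative_eq_rhs[OF G']) (simp add: algebra_simps)
qed

lemma power_sum_tendsto: "entire_coeffs c \<Longrightarrow> ((\<lambda>z. power_sum c (z\<^sup>2 / 4)) \<longlongrightarrow> c 0) (at_right 0)"
proof -
  assume c: "entire_coeffs c"
  have "isCont (\<lambda>z. power_sum c (z\<^sup>2 / 4)) 0"
    by (rule isCont_o2[OF _ DERIV_isCont[OF power_sum_deriv[OF c]]]) (intro continuous_intros, simp)
  then have "((\<lambda>z. power_sum c (z\<^sup>2 / 4)) \<longlongrightarrow> power_sum c 0) (at 0)" by (simp add: isCont_def)
  moreover have "power_sum c 0 = c 0" using power_sum_shift(2)[OF c, of 0] by simp
  ultimately show ?thesis by (simp add: filterlim_at_split)
qed

text \<open>In Y_0 the logarithm times \<open>bessel_J 0\<close> - 1 vanishes like z^2 ln z, and in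
  z Y_1 only the polar term survives.\<close>

lemma hankel1_small:
  "((\<lambda>z. hankel1 0 z - (1 + 2 * \<i> / pi * of_real (ln (z / 2) + euler_mascheroni))) \<longlongrightarrow> 0) (at_right 0)"
  "((\<lambda>z. of_real z * hankel1 1 z) \<longlongrightarrow> - 2 * \<i> / pi) (at_right 0)"
proof -
  note E = entire_bessel_coeffs
  have pos: "eventually (\<lambda>z. z > 0) (at_right (0::real))" by (simp add: eventually_at_right_less)
  have id: "((\<lambda>z. z) \<longlongrightarrow> 0) (at_right (0::real))" by (rule tendsto_ident_at)
  have J: "(bessel_J 0 \<longlongrightarrow> 1) (at_right 0)"
    using power_sum_tendsto[OF E(1)] unfolding bessel_J_power_sum[abs_def] by (simp add: bessel_p0_def)
  have zln: "((\<lambda>z::real. z\<^sup>2 / 4 * (ln (z / 2) + euler_mascheroni)) \<longlongrightarrow> 0) (at_right 0)"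
  proof -
    have "((\<lambda>z::real. z\<^sup>2 * ln (z / 2)) \<longlongrightarrow> 0) (at_right 0)" by real_asymp
    then have "((\<lambda>z::real. (z\<^sup>2 * ln (z / 2)) / 4 + z\<^sup>2 / 4 * euler_mascheroni) \<longlongrightarrow> 0 / 4 + 0\<^sup>2 / 4 * euler_mascheroni) (at_right 0)"
      by (intro tendsto_intros) auto
    then show ?thesis by (simp add: distrib_left)
  qed
  have "((\<lambda>z. 2 / pi * ((z\<^sup>2 / 4 * (ln (z / 2) + euler_mascheroni)) * power_sum (\<lambda>m. bessel_p0 (Suc m)) (z\<^sup>2 / 4)) - 1 / pi * power_sum bessel_q0 (z\<^sup>2 / 4))
      \<longlongrightarrow> 2 / pi * (0 * bessel_p0 (Suc 0)) - 1 / pi * bessel_q0 0) (at_right 0)"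
    by (intro tendsto_intros zln power_sum_tendsto power_sum_shift(1) E)
  then have "((\<lambda>z. bessel_Y 0 z - 2 / pi * (ln (z / 2) + euler_mascheroni)) \<longlongrightarrow> 2 / pi * (0 * bessel_p0 (Suc 0)) - 1 / pi * bessel_q0 0) (at_right 0)"
  proof (rule Lim_transform_eventually, intro eventually_mono[OF pos])
    fix z :: real assume "z > 0"
    then show "2 / pi * ((z\<^sup>2 / 4 * (ln (z / 2) + euler_mascheroni)) * power_sum (\<lambda>m. bessel_p0 (Suc m)) (z\<^sup>2 / 4)) - 1 / pi * power_sum bessel_q0 (z\<^sup>2 / 4)
       = bessel_Y 0 z - 2 / pi * (ln (z / 2) + euler_mascheroni)"
      using power_sum_shift(2)[OF E(1), of "z\<^sup>2 / 4"]
      by (simp add: bessel_Y_power_sum bessel_J_power_sum bessel_p0_def algebra_simps)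
  qed
  then have Y: "((\<lambda>z. bessel_Y 0 z - 2 / pi * (ln (z / 2) + euler_mascheroni)) \<longlongrightarrow> 0) (at_right 0)"
    by (simp add: bessel_q0_def harm_def)
  have "((\<lambda>z. of_real (bessel_J 0 z) - 1 + \<i> * of_real (bessel_Y 0 z - 2 / pi * (ln (z / 2) + euler_mascheroni))) \<longlongrightarrow> of_real 1 - 1 + \<i> * of_real 0) (at_right 0)"
    by (intro tendsto_intros J Y)
  then show "((\<lambda>z. hankel1 0 z - (1 + 2 * \<i> / pi * of_real (ln (z / 2) + euler_mascheroni))) \<longlongrightarrow> 0) (at_right 0)"
    by (simp add: hankel1_def algebra_simps)
  have zln1: "((\<lambda>z::real. z * (ln (z / 2) + euler_mascheroni)) \<longlongrightarrow> 0) (at_right 0)"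
  proof -
    have "((\<lambda>z::real. z * ln (z / 2)) \<longlongrightarrow> 0) (at_right 0)" by real_asymp
    then have "((\<lambda>z::real. (z * ln (z / 2)) + z * euler_mascheroni) \<longlongrightarrow> 0 + 0 * euler_mascheroni) (at_right 0)"
      by (intro tendsto_intros) auto
    then show ?thesis by (simp add: algebra_simps)
  qed
  have J1: "(bessel_J 1 \<longlongrightarrow> 0 / 2 * bessel_p1 0) (at_right 0)"
    unfolding bessel_J_power_sum[abs_def] by (intro tendsto_intros power_sum_tendsto E) auto
  have "((\<lambda>z. 2 / pi * ((z * (ln (z / 2) + euler_mascheroni)) * bessel_J 1 z) - 2 / pi - 1 / pi * (z * z / 2 * power_sum bessel_q1 (z\<^sup>2 / 4)))
      \<longlongrightarrow> 2 / pi * (0 * (0 / 2 * bessel_p1 0)) - 2 / pi - 1 / pi * (0 * 0 / 2 * bessel_q1 0)) (at_right 0)"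
    by (intro tendsto_intros zln1 power_sum_tendsto E J1) auto
  then have "((\<lambda>z. z * bessel_Y 1 z) \<longlongrightarrow> 2 / pi * (0 * (0 / 2 * bessel_p1 0)) - 2 / pi - 1 / pi * (0 * 0 / 2 * bessel_q1 0)) (at_right 0)"
  proof (rule Lim_transform_eventually, intro eventually_mono[OF pos])
    fix z :: real assume "z > 0"
    then show "2 / pi * ((z * (ln (z / 2) + euler_mascheroni)) * bessel_J 1 z) - 2 / pi - 1 / pi * (z * z / 2 * power_sum bessel_q1 (z\<^sup>2 / 4))
      = z * bessel_Y 1 z"
      unfolding bessel_Y_power_sum(2)[OF \<open>z > 0\<close>] by (simp add: field_simps)
  qed
  then have Y1: "((\<lambda>z. z * bessel_Y 1 z) \<longlongrightarrow> - 2 / pi) (at_right 0)" by simp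
  have "((\<lambda>z. of_real (z * bessel_J 1 z) + \<i> * of_real (z * bessel_Y 1 z)) \<longlongrightarrow> of_real (0 * (0 / 2 * bessel_p1 0)) + \<i> * of_real (- 2 / pi)) (at_right 0)"
    by (intro tendsto_intros J1 Y1)
  then show "((\<lambda>z. of_real z * hankel1 1 z) \<longlongrightarrow> - 2 * \<i> / pi) (at_right 0)"
    by (simp add: hankel1_def algebra_simps)
qed

text \<open>Both pairs solve the first-order Bessel system on z > 0, so they coincide once H0 and z
  H1 agree up to o(1) at the origin.\<close>

lemma hankel1_laplace:
  assumes z: "z > 0"
  shows "hankel1 0 z = lap_hankel0 z" "hankel1 1 z = lap_hankel1 z"
proof -
  have inv: "filterlim (\<lambda>z::real. 1 / z) at_top (at_right 0)" by real_asymp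
  have pos: "eventually (\<lambda>z. z > 0) (at_right (0::real))" by (simp add: eventually_at_right_less)
  have id: "((\<lambda>z. z) \<longlongrightarrow> 0) (at_right (0::real))" by (rule tendsto_ident_at)
  \<comment> \<open>Multiplied by - 2 \<i> / pi, the summand \<i> pi / 2 becomes the 1 of J_0, and
    ln 2 - \<open>euler_mascheroni\<close> becomes the constant part of ln (z / 2) +
    \<open>euler_mascheroni\<close>.\<close>
  define c where "c = of_real (ln 2 - euler_mascheroni) + \<i> * (pi / 2)"
  have L0: "((\<lambda>z. lap_integral 0 z + of_real (ln z)) \<longlongrightarrow> c) (at_right 0)"
    unfolding c_def
    by (rule Lim_transform_eventually[OF filterlim_compose[OF lap_integral0_small inv]])
       (auto simp: ln_div intro!: eventually_mono[OF pos])
  have L1: "((\<lambda>z. of_real z * lap_integral 1 z) \<longlongrightarrow> 1) (at_right 0)"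
    by (rule Lim_transform_eventually[OF filterlim_compose[OF lap_integral1_small inv]])
       (auto simp: field_simps intro!: eventually_mono[OF pos])
  have zln: "((\<lambda>z::real. z * ln z) \<longlongrightarrow> 0) (at_right 0)" by real_asymp
  have zL0: "((\<lambda>z. of_real z * lap_integral 0 z) \<longlongrightarrow> 0) (at_right 0)"
  proof -
    have "((\<lambda>z. of_real z * (lap_integral 0 z + of_real (ln z)) - of_real (z * ln z)) \<longlongrightarrow> of_real 0 * c - of_real 0) (at_right 0)"
      by (intro tendsto_intros L0 zln id)
    then show ?thesis by (simp add: algebra_simps)
  qed
  have ez: "((\<lambda>z. exp (\<i> * of_real z)) \<longlongrightarrow> exp (\<i> * of_real 0)) (at_right 0)"
    by (intro tendsto_intros)
  \<comment> \<open>The integral blows up like - ln z, so replacing exp (\<i> z) by 1 has to be paid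
    for: the cost is (exp (\<i> z) - 1) / z, which is bounded, times z *
    \<open>lap_integral 0 z\<close>, which tends to 0.\<close>
  have eq: "((\<lambda>z. (exp (\<i> * of_real z) - 1) / of_real z) \<longlongrightarrow> \<i>) (at_right 0)"
  proof -
    have "((\<lambda>z. exp (\<i> * of_real z)) has_vector_derivative \<i>) (at 0)"
      by (rule has_vector_derivative_real_field) (auto intro!: derivative_eq_intros)
    then have "((\<lambda>z. (exp (\<i> * of_real z) - 1) / of_real z) \<longlongrightarrow> \<i>) (at (0::real))"
      by (simp add: has_vector_derivative_iff_quotient scaleR_conv_of_real divide_inverse mult.commute)
    then show ?thesis by (simp add: filterlim_at_split)
  qed
  have F: "((\<lambda>z. lap_hankel0 z - (1 + 2 * \<i> / pi * of_real (ln (z / 2) + euler_mascheroni))) \<longlongrightarrow> 0) (at_right 0)"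
  proof -
    have "((\<lambda>z. - (2 * \<i> / pi) * ((exp (\<i> * of_real z) - 1) / of_real z * (of_real z * lap_integral 0 z) + (lap_integral 0 z + of_real (ln z)) - c)) \<longlongrightarrow> - (2 * \<i> / pi) * (\<i> * 0 + c - c)) (at_right 0)"
      by (intro tendsto_intros eq zL0 L0)
    then have "((\<lambda>z. lap_hankel0 z - (1 + 2 * \<i> / pi * of_real (ln (z / 2) + euler_mascheroni))) \<longlongrightarrow> - (2 * \<i> / pi) * (\<i> * 0 + c - c)) (at_right 0)"
    proof (rule Lim_transform_eventually, intro eventually_mono[OF pos])
      fix z :: real assume z: "z > 0"
      have a: "(exp (\<i> * of_real z) - 1) / of_real z * (of_real z * lap_integral 0 z) = exp (\<i> * of_real z) * lap_integral 0 z - lap_integral 0 z"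
        using z by (simp add: field_simps)
      have b: "- (2 * \<i> / pi) * (of_real (ln z) - c) = - (1 + 2 * \<i> / pi * of_real (ln (z / 2) + euler_mascheroni))"
        using z by (simp add: c_def ln_div field_simps)
      have "- (2 * \<i> / pi) * ((exp (\<i> * of_real z) - 1) / of_real z * (of_real z * lap_integral 0 z) + (lap_integral 0 z + of_real (ln z)) - c)
        = - (2 * \<i> / pi) * (exp (\<i> * of_real z) * lap_integral 0 z) + - (2 * \<i> / pi) * (of_real (ln z) - c)"
        unfolding a distrib_left[symmetric] by simp
      then show "- (2 * \<i> / pi) * ((exp (\<i> * of_real z) - 1) / of_real z * (of_real z * lap_integral 0 z) + (lap_integral 0 z + of_real (ln z)) - c)
        = lap_hankel0 z - (1 + 2 * \<i> / pi * of_real (ln (z / 2) + euler_mascheroni))"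
        unfolding b lap_hankel0_def by simp
    qed
    then show ?thesis by simp
  qed
  have G: "((\<lambda>z. of_real z * lap_hankel1 z) \<longlongrightarrow> - 2 * \<i> / pi) (at_right 0)"
  proof -
    have "((\<lambda>z. - (2 * \<i> / pi) * (exp (\<i> * of_real z) * (of_real z * lap_integral 1 z - \<i> * (of_real z * lap_integral 0 z)))) \<longlongrightarrow> - (2 * \<i> / pi) * (exp (\<i> * of_real 0) * (1 - \<i> * 0))) (at_right 0)"
      by (intro tendsto_intros ez zL0 L1)
    then show ?thesis by (simp add: lap_hankel1_def algebra_simps)
  qed
  have lim0: "((\<lambda>z. hankel1 0 z - lap_hankel0 z) \<longlongrightarrow> 0) (at_right 0)"
    using tendsto_diff[OF hankel1_small(1) F] by simp
  have lim1: "((\<lambda>z. of_real z * (hankel1 1 z - lap_hankel1 z)) \<longlongrightarrow> 0) (at_right 0)"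
    using tendsto_diff[OF hankel1_small(2) G] by (simp add: right_diff_distrib)
  have d0: "((\<lambda>z. hankel1 0 z - lap_hankel0 z) has_vector_derivative - (hankel1 1 z - lap_hankel1 z)) (at z)" if "z > 0" for z
    using has_vector_derivative_diff[OF hankel1_deriv(1) lap_hankel_deriv(1), OF that that] by simp
  have d1: "((\<lambda>z. hankel1 1 z - lap_hankel1 z) has_vector_derivative (hankel1 0 z - lap_hankel0 z) - (hankel1 1 z - lap_hankel1 z) / of_real z) (at z)" if "z > 0" for z
    by (rule has_vector_derivative_eq_rhs[OF has_vector_derivative_diff[OF hankel1_deriv(2) lap_hankel_deriv(2), OF that that]])
       (simp add: diff_divide_distrib)
  show "hankel1 0 z = lap_hankel0 z" "hankel1 1 z = lap_hankel1 z"
    using bessel_ode_unique[OF d0 d1 lim0 lim1 z] by auto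
qed

section \<open>Bounds for the Hankel functions\<close>

lemma Gamma_three_halves: "Gamma (3/2 :: real) = sqrt pi / 2"
proof -
  have "(1/2 :: real) \<notin> \<int>\<^sub>\<le>\<^sub>0"
    using nonpos_Ints_nonpos[of "1/2 :: real"] by linarith
  then show ?thesis using Gamma_plus1[of "1/2::real"] by (simp add: Gamma_one_half_real)
qed

lemma sqrt_pi_le: "sqrt pi / pi \<le> 1"
proof -
  have "sqrt pi * 1 \<le> sqrt pi * sqrt pi" using pi_gt3 by (intro mult_left_mono) auto
  then have "sqrt pi \<le> pi" by simp
  then show ?thesis by (subst pos_divide_le_eq) auto
qed

text \<open>Valid down to z = 0: the power z^(-1/2) also covers the logarithmic singularity and,
  being integrable, later serves as a majorant on lines arbitrarily close to a source.\<close>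

lemma hankel1_0_bound:
  assumes "z > 0"
  shows "norm (hankel1 0 z) \<le> 2 * z powr (-1/2)"
proof -
  have "norm (hankel1 0 z) = 2 / pi * norm (lap_integral 0 z)"
    using assms by (simp add: hankel1_laplace lap_hankel0_def norm_mult norm_divide)
  also have "\<dots> \<le> 2 / pi * (Gamma (1/2) / z powr (1/2))"
    using lap_integral_bound[OF assms, of 0] by (intro mult_left_mono) auto
  also have "\<dots> = (2 * sqrt pi / pi) * z powr (-1/2)"
    by (simp add: Gamma_one_half_real powr_minus_divide)
  also have "\<dots> \<le> 2 * z powr (-1/2)"
  proof (rule mult_right_mono)
    show "2 * sqrt pi / pi \<le> 2" using sqrt_pi_le by linarith
  qed auto
  finally show ?thesis .
qed

text \<open>The leading parts cancel because H1 = - H0' and H0 oscillates like exp (\<i> z): only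
  the integral with \<open>j\<close> = 1 is left, one power of z smaller. This is the Sommerfeld
  condition in one variable.\<close>

lemma hankel1_outgoing:
  assumes "z > 0"
  shows "norm (hankel1 1 z + \<i> * hankel1 0 z) \<le> 2 * z powr (-3/2)"
proof -
  have "hankel1 1 z + \<i> * hankel1 0 z = - (2 * \<i> / pi) * (exp (\<i> * z) * lap_integral 1 z)"
    unfolding hankel1_laplace[OF assms] lap_hankel0_def lap_hankel1_def by (simp add: algebra_simps)
  then have "norm (hankel1 1 z + \<i> * hankel1 0 z) = 2 / pi * norm (lap_integral 1 z)"
    by (simp add: norm_mult norm_divide)
  also have "\<dots> \<le> 2 / pi * (Gamma (3/2) / z powr (3/2))"
    using lap_integral_bound[OF assms, of 1] by (intro mult_left_mono) auto
  also have "\<dots> = (sqrt pi / pi) * z powr (-3/2)"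
    by (simp add: Gamma_three_halves powr_minus_divide)
  also have "\<dots> \<le> 2 * z powr (-3/2)"
  proof (rule mult_right_mono)
    show "sqrt pi / pi \<le> 2" using sqrt_pi_le by linarith
  qed auto
  finally show ?thesis .
qed

text \<open>Near 0 the limit - 2 \<i> / pi of z H1 bounds it, elsewhere the two preceding estimates
  do. The terms 1 and sqrt z become the near and far regimes of the half-plane kernel.\<close>

lemma hankel1_1_bound:
  obtains C where "C > 0" "\<And>z. z > 0 \<Longrightarrow> norm (of_real z * hankel1 1 z) \<le> C * (1 + sqrt z)"
proof -
  have "eventually (\<lambda>z. dist (of_real z * hankel1 1 z) (- 2 * \<i> / pi) < 1) (at_right 0)"
    using tendstoD[OF hankel1_small(2), of 1] by simp
  then obtain b where b: "b > 0" "\<And>z. 0 < z \<Longrightarrow> z < b \<Longrightarrow> dist (of_real z * hankel1 1 z) (- 2 * \<i> / pi) < 1"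
    unfolding eventually_at_right_field by auto
  \<comment> \<open>3 exceeds 1 + 2 / pi, the bound below \<open>b\<close>; the summand with 1 /
    sqrt b absorbs 2 / sqrt z beyond \<open>b\<close>.\<close>
  define C where "C = 3 + 2 * (1 / sqrt b)"
  show ?thesis
  proof
    show "C > 0" using b(1) by (simp add: C_def add_pos_nonneg)
    fix z :: real assume z: "z > 0"
    have C3: "C \<ge> 3" using b(1) by (simp add: C_def)
    show "norm (of_real z * hankel1 1 z) \<le> C * (1 + sqrt z)"
    proof (cases "z < b")
      case True
      have "norm (of_real z * hankel1 1 z) \<le> norm (of_real z * hankel1 1 z - (- 2 * \<i> / pi)) + norm (- 2 * \<i> / pi)"
        using norm_triangle_sub by (metis add.commute)
      also have "\<dots> \<le> 1 + 2"
        using b(2)[OF z True] pi_gt3 by (intro add_mono) (auto simp: dist_norm norm_divide norm_mult field_simps)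
      also have "\<dots> \<le> C * (1 + sqrt z)"
        using C3 z mult_mono[of 3 C 1 "1 + sqrt z"] by simp
      finally show ?thesis .
    next
      case False
      have "norm (hankel1 1 z) \<le> norm (hankel1 1 z + \<i> * hankel1 0 z) + norm (\<i> * hankel1 0 z)"
        using norm_triangle_sub[of "hankel1 1 z" "- \<i> * hankel1 0 z"] by (simp add: norm_mult add.commute)
      also have "\<dots> \<le> 2 * z powr (-3/2) + 2 * z powr (-1/2)"
        using hankel1_0_bound[OF z] hankel1_outgoing[OF z] by (simp add: norm_mult)
      finally have "norm (of_real z * hankel1 1 z) \<le> z * (2 * z powr (-3/2) + 2 * z powr (-1/2))"
        using z by (simp add: norm_mult)
      also have "\<dots> = 2 * z powr (-1/2) + 2 * z powr (1/2)"
      proof -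
        have "z * z powr (-3/2) = z powr (1 + (-3/2))" "z * z powr (-1/2) = z powr (1 + (-1/2))"
          unfolding powr_add using z by simp_all
        then show ?thesis by (simp add: distrib_left)
      qed
      also have "\<dots> = 2 * (1 / sqrt z) + 2 * sqrt z"
        using z by (simp add: powr_half_sqrt powr_minus_divide)
      also have "\<dots> \<le> 2 * (1 / sqrt b) + 2 * sqrt z"
        using False b(1) by (intro add_mono mult_left_mono divide_left_mono) auto
      also have "\<dots> \<le> C * 1 + C * sqrt z"
        using C3 z by (intro add_mono mult_right_mono) (auto simp: C_def)
      finally show ?thesis by (simp add: distrib_left)
    qed
  qed
qed

text \<open>Watson's lemma with one term: \<open>lap_density s\<close> is a0 * s^(-1/2) up to an
  error of at most s^(1/2), where a0 = 1 / sqrt (- 2 \<i>), and both powers have Gamma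
  integrals.\<close>

lemma hankel1_0_asymp:
  obtains A where "A \<noteq> 0" "\<And>z. z > 0 \<Longrightarrow>
    norm (hankel1 0 z - A * exp (\<i> * of_real z) * of_real (z powr (-1/2))) \<le> 2 * z powr (-3/2)"
proof
  define q where "q = csqrt (Complex 0 (-2))"
  define a0 where "a0 = inverse q"
  define A where "A = - (2 * \<i> / pi) * (a0 * of_real (sqrt pi))"
  have q: "norm q = sqrt 2" "q \<noteq> 0" "q\<^sup>2 = Complex 0 (-2)" "Re q = 1"
    unfolding q_def norm_csqrt power2_csqrt by (auto simp: cmod_def complex_eq_iff)
  show "A \<noteq> 0" using q by (simp add: A_def a0_def)
  fix z :: real assume z: "z > 0"
  \<comment> \<open>Pulling out sqrt s leaves a root that is regular at s = 0, where its value is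
    \<open>q\<close>.\<close>
  have hb_eq: "lap_sqrt s = of_real (sqrt s) * csqrt (Complex s (-2))" if "s > 0" for s
    unfolding lap_sqrt_def
  proof (rule csqrt_unique)
    show "(of_real (sqrt s) * csqrt (Complex s (- 2)))\<^sup>2 = Complex (s\<^sup>2) (- 2 * s)"
      unfolding power_mult_distrib power2_csqrt using that
      by (simp add: complex_eq_iff power2_eq_square flip: of_real_mult)
    have "Re (csqrt (Complex s (-2))) > 0" 
    proof -
      have "0 < cmod (Complex s (- 2)) + Re (Complex s (- 2))"
        using that by (intro add_nonneg_pos) auto
      then show ?thesis unfolding csqrt.sel
        by (simp only: real_sqrt_gt_0_iff) (rule divide_pos_pos, auto)
    qed
    then show "0 < Re (of_real (sqrt s) * csqrt (Complex s (- 2))) \<or>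
        Re (of_real (sqrt s) * csqrt (Complex s (- 2))) = 0 \<and>
        0 \<le> Im (of_real (sqrt s) * csqrt (Complex s (- 2)))"
      using that by (simp del: csqrt.sel csqrt.simps)
  qed
  \<comment> \<open>With p^2 = s - 2 \<i> and q^2 = - 2 \<i>, the difference q - p equals - s / (p +
    q), and |p + q| >= 1 because Re p >= 0 and Re q = 1.\<close>
  have diff: "norm (lap_density s - a0 * of_real (s powr (-1/2))) \<le> s powr (1/2)" if s: "s > 0" for s
  proof -
    define p where "p = csqrt (Complex s (-2))"
    have "sqrt 2 \<le> sqrt (norm (Complex s (-2)))"
      using abs_Im_le_cmod[of "Complex s (-2)"] by (intro real_sqrt_le_mono) simp
    then have p: "norm p \<ge> sqrt 2" "p\<^sup>2 = Complex s (-2)" "Re p \<ge> 0"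
      unfolding p_def norm_csqrt power2_csqrt by (simp_all only: Re_csqrt)
    have p0: "p \<noteq> 0" using p(1) by auto
    have "1 \<le> Re (p + q)" using p(3) q(4) by simp
    then have pq: "1 \<le> norm (p + q)" using complex_Re_le_cmod order_trans by blast
    then have pq0: "p + q \<noteq> 0" by auto
    have "(q - p) * (p + q) = q\<^sup>2 - p\<^sup>2" by (simp add: algebra_simps power2_eq_square)
    also have "\<dots> = - of_real s" unfolding p(2) q(3) by (simp add: complex_eq_iff)
    finally have "q - p = - of_real s / (p + q)" using pq0 by (simp add: field_simps)
    moreover have "inverse p - inverse q = (q - p) / (p * q)" using p0 q(2) by (simp add: field_simps)
    ultimately have "norm (inverse p - inverse q) = s / (norm (p + q) * (norm p * norm q))"
      using s by (simp add: norm_divide norm_mult)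
    also have "\<dots> \<le> s / (1 * (sqrt 2 * sqrt 2))"
      using s pq p0 pq0 p(1) q by (intro divide_left_mono mult_mono mult_pos_pos) auto
    also have "\<dots> \<le> s" using s by simp
    finally have n: "norm (inverse p - inverse q) \<le> s" .
    have "lap_density s = of_real (s powr (-1/2)) * inverse p"
      using s powr_minus[of s "1/2"] by (simp add: lap_density_def hb_eq p_def powr_half_sqrt del: csqrt.simps)
    then have "lap_density s - a0 * of_real (s powr (-1/2)) = of_real (s powr (-1/2)) * (inverse p - inverse q)"
      by (simp add: a0_def algebra_simps)
    then have "norm (lap_density s - a0 * of_real (s powr (-1/2))) = s powr (-1/2) * norm (inverse p - inverse q)"
      by (simp add: norm_mult)
    also have "\<dots> \<le> s powr (-1/2) * s" using n by (intro mult_left_mono) auto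
    also have "\<dots> = s powr (1/2)" using s powr_add[of s "-1/2" 1] by simp
    finally show ?thesis .
  qed
  define f where "f = (\<lambda>s. indicator {0<..} s * (s powr (1/2 - 1) * exp (- z * s)))"
  define f' where "f' = (\<lambda>s. indicator {0<..} s * (s powr (3/2 - 1) * exp (- z * s)))"
  have f: "integrable lborel f" "(LINT s|lborel. f s) = Gamma (1/2) / z powr (1/2)"
    unfolding f_def by (rule gamma_laplace_integral; use z in simp)+
  have f': "integrable lborel f'" "(LINT s|lborel. f' s) = Gamma (3/2) / z powr (3/2)"
    unfolding f'_def by (rule gamma_laplace_integral; use z in simp)+
  have "lap_integral 0 z - a0 * of_real (Gamma (1/2) / z powr (1/2)) = (LINT s|lborel. lap_integrand 0 z s - a0 * of_real (f s))"
    using f lap_integrand_integrable[OF z, of 0] by (simp add: lap_integral_def)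
  then have "norm (lap_integral 0 z - a0 * of_real (Gamma (1/2) / z powr (1/2))) = norm (LINT s|lborel. lap_integrand 0 z s - a0 * of_real (f s))"
    by (rule arg_cong)
  also have "\<dots> \<le> (LINT s|lborel. f' s)"
  proof (rule order_trans[OF integral_norm_bound integral_mono])
    show "integrable lborel (\<lambda>s. norm (lap_integrand 0 z s - a0 * of_real (f s)))"
      using f lap_integrand_integrable[OF z, of 0]
      by (intro integrable_norm Bochner_Integration.integrable_diff integrable_mult_right integrable_of_real) auto
    show "norm (lap_integrand 0 z s - a0 * of_real (f s)) \<le> f' s" for s
    proof (cases "s > 0")
      case True
      have "lap_integrand 0 z s - a0 * of_real (f s) = of_real (exp (- z * s)) * (lap_density s - a0 * of_real (s powr (-1/2)))"
        using True by (simp add: lap_integrand_def f_def algebra_simps)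
      then have "norm (lap_integrand 0 z s - a0 * of_real (f s)) = exp (- z * s) * norm (lap_density s - a0 * of_real (s powr (-1/2)))"
        by (simp add: norm_mult)
      also have "\<dots> \<le> exp (- z * s) * s powr (1/2)" using diff[OF True] by (intro mult_left_mono) auto
      finally show ?thesis using True by (simp add: f'_def mult.commute)
    qed (simp add: lap_integrand_def f_def f'_def)
  qed (rule f')
  also have "\<dots> = sqrt pi / 2 * z powr (-3/2)"
    using f'(2) by (simp add: Gamma_three_halves powr_minus_divide)
  finally have L: "norm (lap_integral 0 z - a0 * of_real (Gamma (1/2) / z powr (1/2))) \<le> sqrt pi / 2 * z powr (-3/2)" .
  have "hankel1 0 z - A * exp (\<i> * of_real z) * of_real (z powr (-1/2))
      = - (2 * \<i> / pi) * exp (\<i> * of_real z) * (lap_integral 0 z - a0 * of_real (Gamma (1/2) / z powr (1/2)))"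
    using z by (simp add: hankel1_laplace lap_hankel0_def A_def Gamma_one_half_real powr_minus_divide algebra_simps)
  then have "norm (hankel1 0 z - A * exp (\<i> * of_real z) * of_real (z powr (-1/2)))
     = 2 / pi * norm (lap_integral 0 z - a0 * of_real (Gamma (1/2) / z powr (1/2)))"
    by (simp only: norm_mult norm_minus_cancel norm_divide norm_exp_i_times) simp
  also have "\<dots> \<le> 2 / pi * (sqrt pi / 2 * z powr (-3/2))"
    using L by (intro mult_left_mono) auto
  also have "\<dots> = (sqrt pi / pi) * z powr (-3/2)" by simp
  also have "\<dots> \<le> 2 * z powr (-3/2)"
  proof (rule mult_right_mono)
    show "sqrt pi / pi \<le> 2" using sqrt_pi_le by linarith
  qed auto
  finally show "norm (hankel1 0 z - A * exp (\<i> * of_real z) * of_real (z powr (-1/2))) \<le> 2 * z powr (-3/2)" .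
qed

section \<open>Outgoing waves in the plane\<close>

definition rad :: "real \<Rightarrow> real \<Rightarrow> real" where
  "rad a b = sqrt (a\<^sup>2 + b\<^sup>2)"

definition wave :: "real \<Rightarrow> real \<Rightarrow> real \<Rightarrow> complex" where
  "wave k a b = hankel1 0 (k * rad a b)"

text \<open>The radial derivative of the wave divided by the radius, so that the gradient is (a, b)
  times this function. \<open>wave_dd\<close> applies the same operation once more.\<close>

definition wave_d :: "real \<Rightarrow> real \<Rightarrow> real \<Rightarrow> complex" where
  "wave_d k a b = - of_real (k / rad a b) * hankel1 1 (k * rad a b)"

definition wave_dd :: "real \<Rightarrow> real \<Rightarrow> real \<Rightarrow> complex" where
  "wave_dd k a b = (- of_real (k\<^sup>2) * hankel1 0 (k * rad a b)
     + of_real (2 * k / rad a b) * hankel1 1 (k * rad a b)) / of_real ((rad a b)\<^sup>2)"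

lemma rad_sym: "rad a b = rad b a"
  by (simp add: rad_def add.commute)

lemma wave_sym: "wave k a b = wave k b a" "wave_d k a b = wave_d k b a" "wave_dd k a b = wave_dd k b a"
  by (simp_all add: wave_def wave_d_def wave_dd_def rad_sym[of a b])

lemma rad_nonneg [simp]: "rad a b \<ge> 0"
  by (simp add: rad_def)

lemma rad_pos_iff: "rad a b > 0 \<longleftrightarrow> a \<noteq> 0 \<or> b \<noteq> 0"
  unfolding rad_def using sum_power2_gt_zero_iff[of a b] by simp

lemma rad_pos: "a \<noteq> 0 \<or> b \<noteq> 0 \<Longrightarrow> rad a b > 0"
  by (simp add: rad_pos_iff)

lemma rad_sq: "(rad a b)\<^sup>2 = a\<^sup>2 + b\<^sup>2"
  by (simp add: rad_def)

lemma abs_le_rad: "\<bar>a\<bar> \<le> rad a b" "\<bar>b\<bar> \<le> rad a b"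
  unfolding rad_def by (rule real_sqrt_sum_squares_ge1 abs_le_square_iff real_le_rsqrt; simp)+

lemma norm_pair_rad: "norm (a, b) = rad a b"
  by (simp add: norm_Pair rad_def)

lemma rad_triangle: "rad (a + c) (b + d) \<le> rad a b + rad c d"
  using norm_triangle_ineq[of "(a, b)" "(c, d)"] by (simp add: norm_pair_rad)

text \<open>Directional derivative of the wave along (n1, n2).\<close>

definition wave_ray :: "real \<Rightarrow> real \<Rightarrow> real \<Rightarrow> real \<Rightarrow> real \<Rightarrow> complex" where
  "wave_ray k n1 n2 a b = of_real (n1 * a + n2 * b) * wave_d k a b"

lemma rad_ray_deriv:
  assumes "rad (n1 * r - p1) (n2 * r - p2) > 0"
  shows "((\<lambda>r. rad (n1 * r - p1) (n2 * r - p2)) has_real_derivative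
     (n1 * (n1 * r - p1) + n2 * (n2 * r - p2)) / rad (n1 * r - p1) (n2 * r - p2)) (at r)"
proof -
  define X where "X = n1 * (n1 * r - p1) + n2 * (n2 * r - p2)"
  have "(n1 * r - p1)\<^sup>2 + (n2 * r - p2)\<^sup>2 > 0" using assms by (simp add: rad_def)
  note sq = DERIV_real_sqrt[OF this]
  have "((\<lambda>r. (n1 * r - p1)\<^sup>2 + (n2 * r - p2)\<^sup>2) has_real_derivative 2 * X) (at r)"
    by (auto intro!: derivative_eq_intros simp: X_def algebra_simps)
  from DERIV_chain2[OF sq this] have "((\<lambda>r. sqrt ((n1 * r - p1)\<^sup>2 + (n2 * r - p2)\<^sup>2)) has_real_derivative
      inverse (sqrt ((n1 * r - p1)\<^sup>2 + (n2 * r - p2)\<^sup>2)) / 2 * (2 * X)) (at r)" .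
  then show ?thesis unfolding rad_def X_def[symmetric]
    by (rule DERIV_cong) (simp, simp add: divide_inverse_commute)
qed

text \<open>The path r -> n r - p covers two uses: rays from the origin seen from a source at p and,
  with n = (1, 0), horizontal motion of the line of integration.\<close>

lemma hankel_ray_deriv:
  assumes k: "k > 0" and r: "rad (n1 * r - p1) (n2 * r - p2) > 0"
  defines "a \<equiv> n1 * r - p1" and "b \<equiv> n2 * r - p2"
  shows "((\<lambda>r. wave k (n1 * r - p1) (n2 * r - p2)) has_vector_derivative wave_ray k n1 n2 a b) (at r)"
    "((\<lambda>r. wave_d k (n1 * r - p1) (n2 * r - p2)) has_vector_derivative of_real (n1 * a + n2 * b) * wave_dd k a b) (at r)"
proof -
  define \<rho> where "\<rho> = rad a b"
  have \<rho>: "\<rho> > 0" using r by (simp add: \<rho>_def a_def b_def)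
  define s where "s = (n1 * a + n2 * b) / \<rho>"
  have dr: "((\<lambda>r. rad (n1 * r - p1) (n2 * r - p2)) has_real_derivative s) (at r)"
    unfolding s_def \<rho>_def a_def b_def by (rule rad_ray_deriv[OF r])
  have z': "k * rad (n1 * r - p1) (n2 * r - p2) > 0" using k r by simp
  have d: "((\<lambda>r. k * rad (n1 * r - p1) (n2 * r - p2)) has_vector_derivative k * s) (at r)"
    unfolding has_real_derivative_iff_has_vector_derivative[symmetric] by (rule DERIV_cmult[OF dr])
  have h0: "((\<lambda>r. hankel1 0 (k * rad (n1 * r - p1) (n2 * r - p2))) has_vector_derivative (k * s) *\<^sub>R (- hankel1 1 (k * \<rho>))) (at r)"
    using vector_diff_chain_at[OF d hankel1_deriv(1)[OF z']] by (simp add: o_def \<rho>_def a_def b_def)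
  have h1: "((\<lambda>r. hankel1 1 (k * rad (n1 * r - p1) (n2 * r - p2))) has_vector_derivative (k * s) *\<^sub>R
      (hankel1 0 (k * \<rho>) - hankel1 1 (k * \<rho>) / of_real (k * \<rho>))) (at r)"
    using vector_diff_chain_at[OF d hankel1_deriv(2)[OF z']] by (simp add: o_def \<rho>_def a_def b_def)
  show "((\<lambda>r. wave k (n1 * r - p1) (n2 * r - p2)) has_vector_derivative wave_ray k n1 n2 a b) (at r)"
    unfolding wave_def
    by (rule has_vector_derivative_eq_rhs[OF h0])
       (simp add: wave_ray_def wave_d_def s_def scaleR_conv_of_real flip: \<rho>_def)
  have "((\<lambda>r. - (k / rad (n1 * r - p1) (n2 * r - p2))) has_real_derivative k * s / \<rho>\<^sup>2) (at r)"
    using r by (auto intro!: derivative_eq_intros dr simp: \<rho>_def a_def b_def power2_eq_square)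
  then have "((\<lambda>r. complex_of_real (- (k / rad (n1 * r - p1) (n2 * r - p2)))) has_vector_derivative of_real (k * s / \<rho>\<^sup>2)) (at r)"
    by (rule has_vector_derivative_of_real)
  from has_vector_derivative_mult[OF this h1]
  have "((\<lambda>r. wave_d k (n1 * r - p1) (n2 * r - p2)) has_vector_derivative
     of_real (- (k / \<rho>)) * ((k * s) *\<^sub>R (hankel1 0 (k * \<rho>) - hankel1 1 (k * \<rho>) / of_real (k * \<rho>)))
     + of_real (k * s / \<rho>\<^sup>2) * hankel1 1 (k * \<rho>)) (at r)"
    by (simp add: wave_d_def \<rho>_def a_def b_def)
  then show "((\<lambda>r. wave_d k (n1 * r - p1) (n2 * r - p2)) has_vector_derivative of_real (n1 * a + n2 * b) * wave_dd k a b) (at r)"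
  proof (rule has_vector_derivative_eq_rhs)
    define c where "c = complex_of_real \<rho>"
    have c: "c \<noteq> 0" using \<rho> by (simp add: c_def)
    define S where "S = complex_of_real (n1 * a + n2 * b)"
    have sS: "complex_of_real s = S / c" by (simp add: s_def S_def c_def)
    have kk: "complex_of_real k \<noteq> 0" using k by simp
    show "of_real (- (k / \<rho>)) * ((k * s) *\<^sub>R (hankel1 0 (k * \<rho>) - hankel1 1 (k * \<rho>) / of_real (k * \<rho>)))
     + of_real (k * s / \<rho>\<^sup>2) * hankel1 1 (k * \<rho>) = of_real (n1 * a + n2 * b) * wave_dd k a b"
      unfolding wave_dd_def \<rho>_def[symmetric] S_def[symmetric] scaleR_conv_of_real of_real_mult of_real_divide of_real_minus of_real_power
        sS c_def[symmetric] of_real_numeral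
      using c kk by (simp add: field_simps power2_eq_square)
  qed
qed

lemma hankel_deriv1:
  assumes "k > 0" "s \<noteq> p \<or> b \<noteq> 0"
  shows "((\<lambda>s. wave k (s - p) b) has_vector_derivative of_real (s - p) * wave_d k (s - p) b) (at s)"
    "((\<lambda>s. wave_d k (s - p) b) has_vector_derivative of_real (s - p) * wave_dd k (s - p) b) (at s)"
  using hankel_ray_deriv[of k 1 s p 0 "- b"] rad_pos[of "s - p" b] assms by (auto simp: wave_ray_def)

text \<open>The left side is the Laplacian of the wave in terms of \<open>wave_d\<close> and
  \<open>wave_dd\<close>.\<close>

lemma wave_helmholtz:
  assumes "k > 0" "a \<noteq> 0 \<or> b \<noteq> 0"
  shows "2 * wave_d k a b + of_real (a\<^sup>2 + b\<^sup>2) * wave_dd k a b = - of_real (k\<^sup>2) * wave k a b"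
  using rad_pos[OF assms(2)] unfolding wave_d_def wave_dd_def wave_def rad_sq[symmetric]
  by (simp add: field_simps)

section \<open>The Wronskian flux of two waves and its decay\<close>

text \<open>Flux density between the sources at \<open>p\<close> and \<open>q\<close>, in the coordinates relative to them.\<close>

definition flux1 :: "real \<Rightarrow> real \<Rightarrow> real \<Rightarrow> real \<Rightarrow> real \<Rightarrow> complex" where
  "flux1 k a b c d = wave k a b * (of_real c * wave_d k c d) - wave k c d * (of_real a * wave_d k a b)"

text \<open>The derivative of \<open>flux1\<close> when both first coordinates move together; the
  products of two first derivatives have cancelled.\<close>

definition flux1' :: "real \<Rightarrow> real \<Rightarrow> real \<Rightarrow> real \<Rightarrow> real \<Rightarrow> complex" where
  "flux1' k a b c d = wave k a b * (wave_d k c d + of_real (c\<^sup>2) * wave_dd k c d) - wave k c d * (wave_d k a b + of_real (a\<^sup>2) * wave_dd k a b)"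

text \<open>Exchanging the coordinates gives the vertical component of the flux. Both waves satisfy
  the Helmholtz equation with the same k, so the k^2 terms cancel and the flux is divergence
  free.\<close>

lemma flux_divergence:
  assumes "k > 0" "a \<noteq> 0 \<or> b \<noteq> 0" "c \<noteq> 0 \<or> d \<noteq> 0"
  shows "flux1' k b a d c = - flux1' k a b c d"
proof -
  have 1: "of_real (a\<^sup>2) * wave_dd k a b = - of_real (k\<^sup>2) * wave k a b - 2 * wave_d k a b - of_real (b\<^sup>2) * wave_dd k a b"
    if "a \<noteq> 0 \<or> b \<noteq> 0" for a b
    using wave_helmholtz[OF assms(1) that] by (simp add: algebra_simps)
  show ?thesis
    unfolding flux1'_def wave_sym[of k b a] wave_sym[of k d c] 1[OF assms(2)] 1[OF assms(3)]
    by (simp add: algebra_simps)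
qed

text \<open>Seen from far away, two points at fixed distance from each other lie in nearly the same
  direction; this supplies the extra factor 1 / m in the flux bounds.\<close>

lemma direction_diff:
  assumes "a \<noteq> 0 \<or> b \<noteq> 0" "c \<noteq> 0 \<or> d \<noteq> 0"
  shows "\<bar>a / rad a b - c / rad c d\<bar> \<le> 2 * rad (a - c) (b - d) / rad a b"
proof -
  have r: "rad a b > 0" "rad c d > 0" using assms rad_pos by auto
  have "a / rad a b - c / rad c d = (a - c) / rad a b + c / rad c d * ((rad c d - rad a b) / rad a b)"
    using r by (simp add: field_simps)
  also have "\<bar>\<dots>\<bar> \<le> \<bar>(a - c) / rad a b\<bar> + \<bar>c / rad c d\<bar> * \<bar>(rad c d - rad a b) / rad a b\<bar>"
    using abs_triangle_ineq by (metis abs_mult)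
  also have "\<dots> \<le> rad (a - c) (b - d) / rad a b + 1 * (rad (a - c) (b - d) / rad a b)"
  proof (intro add_mono mult_mono)
    show "\<bar>(a - c) / rad a b\<bar> \<le> rad (a - c) (b - d) / rad a b"
      using r abs_le_rad(1)[of "a - c" "b - d"] by (simp add: divide_right_mono)
    show "\<bar>c / rad c d\<bar> \<le> 1" using r abs_le_rad(1)[of c d] by simp
    have "\<bar>rad c d - rad a b\<bar> \<le> rad (a - c) (b - d)"
      using norm_triangle_ineq3[of "(a, b)" "(c, d)"] by (simp add: norm_pair_rad abs_minus_commute)
    then show "\<bar>(rad c d - rad a b) / rad a b\<bar> \<le> rad (a - c) (b - d) / rad a b"
      using r by (simp add: divide_right_mono)
  qed (use r in auto)
  finally show ?thesis by simp
qed

text \<open>The radius r is replaced by any lower bound m of it, so that two sources at different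
  distances are estimated by one quantity.\<close>

lemma hankel_far_bounds:
  assumes k: "k > 0" and \<delta>: "\<delta> > 0"
  obtains A where "A > 0"
    "\<And>r m. \<delta> \<le> m \<Longrightarrow> m \<le> r \<Longrightarrow> norm (hankel1 0 (k * r)) \<le> A * m powr (-1/2)"
    "\<And>r m. \<delta> \<le> m \<Longrightarrow> m \<le> r \<Longrightarrow> norm (hankel1 1 (k * r) + \<i> * hankel1 0 (k * r)) \<le> A * m powr (-3/2)"
    "\<And>r m. \<delta> \<le> m \<Longrightarrow> m \<le> r \<Longrightarrow> norm (hankel1 1 (k * r)) \<le> A * m powr (-1/2)"
proof -
  define B where "B = 2 * k powr (-1/2) + 2 * k powr (-3/2)"
  define A where "A = B + B / \<delta>"
  have B: "B > 0" using k by (auto simp: B_def add_pos_pos)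
  have BA: "B \<le> A" using B \<delta> by (simp add: A_def)
  have 0: "norm (hankel1 0 (k * r)) \<le> B * m powr (-1/2)" if "\<delta> \<le> m" "m \<le> r" for m r
  proof -
    have "norm (hankel1 0 (k * r)) \<le> 2 * (k * r) powr (-1/2)"
      using k \<delta> that by (intro hankel1_0_bound) auto
    also have "\<dots> = 2 * k powr (-1/2) * r powr (-1/2)" using k \<delta> that by (simp add: powr_mult)
    also have "\<dots> \<le> B * m powr (-1/2)"
      using k \<delta> that by (intro mult_mono powr_mono2') (auto simp: B_def)
    finally show ?thesis .
  qed
  have 1: "norm (hankel1 1 (k * r) + \<i> * hankel1 0 (k * r)) \<le> B * m powr (-3/2)" if "\<delta> \<le> m" "m \<le> r" for m r
  proof -
    have "norm (hankel1 1 (k * r) + \<i> * hankel1 0 (k * r)) \<le> 2 * (k * r) powr (-3/2)"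
      using k \<delta> that by (intro hankel1_outgoing) auto
    also have "\<dots> = 2 * k powr (-3/2) * r powr (-3/2)" using k \<delta> that by (simp add: powr_mult)
    also have "\<dots> \<le> B * m powr (-3/2)"
      using k \<delta> that by (intro mult_mono powr_mono2') (auto simp: B_def)
    finally show ?thesis .
  qed
  show ?thesis
  proof
    show "A > 0" using B BA by simp
    fix m r :: real assume mr: "\<delta> \<le> m" "m \<le> r"
    show "norm (hankel1 0 (k * r)) \<le> A * m powr (-1/2)"
      using 0[OF mr] BA by (rule order_trans[OF _ mult_right_mono]) auto
    show "norm (hankel1 1 (k * r) + \<i> * hankel1 0 (k * r)) \<le> A * m powr (-3/2)"
      using 1[OF mr] BA by (rule order_trans[OF _ mult_right_mono]) auto
    have "norm (hankel1 1 (k * r)) \<le> norm (hankel1 1 (k * r) + \<i> * hankel1 0 (k * r)) + norm (hankel1 0 (k * r))"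
      using norm_triangle_sub[of "hankel1 1 (k * r)" "- \<i> * hankel1 0 (k * r)"] by (simp add: norm_mult add.commute)
    also have "\<dots> \<le> B * m powr (-3/2) + B * m powr (-1/2)" using 0[OF mr] 1[OF mr] by simp
    also have "m powr (-3/2) = m powr (-1/2) / m"
      using powr_add[of m "-1/2" "-1"] mr \<delta> by (simp add: powr_minus_divide)
    also have "B * (m powr (-1/2) / m) + B * m powr (-1/2) \<le> B * (m powr (-1/2) / \<delta>) + B * m powr (-1/2)"
      using B mr \<delta> by (intro add_right_mono mult_left_mono divide_left_mono) auto
    also have "\<dots> = A * m powr (-1/2)" by (simp add: A_def algebra_simps)
    finally show "norm (hankel1 1 (k * r)) \<le> A * m powr (-1/2)" .
  qed
qed

text \<open>Each wave is of order m^(-1/2), so the terms separately are only of order 1 / m, not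
  integrable along a line. But each normal derivative is \<i> k times a direction cosine times the
  wave, up to a smaller error, so only the difference of the cosines survives, itself of order 1 /
  m.\<close>

lemma flux_bounds:
  assumes k: "k > 0" and \<delta>: "\<delta> > 0"
  obtains C where "C > 0"
    "\<And>a b c d m. \<delta> \<le> m \<Longrightarrow> m \<le> rad a b \<Longrightarrow> m \<le> rad c d \<Longrightarrow>
      norm (flux1 k a b c d) \<le> C * (1 + rad (c - a) (d - b)) / m\<^sup>2"
    "\<And>a b c d m. \<delta> \<le> m \<Longrightarrow> m \<le> rad a b \<Longrightarrow> m \<le> rad c d \<Longrightarrow>
      norm (flux1' k a b c d) \<le> C * (1 + rad (c - a) (d - b)) / m\<^sup>2"
proof -
  from hankel_far_bounds[OF assms] obtain A where A: "A > 0"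
    and A0: "\<And>r m. \<delta> \<le> m \<Longrightarrow> m \<le> r \<Longrightarrow> norm (hankel1 0 (k * r)) \<le> A * m powr (-1/2)"
    and A1: "\<And>r m. \<delta> \<le> m \<Longrightarrow> m \<le> r \<Longrightarrow> norm (hankel1 1 (k * r) + \<i> * hankel1 0 (k * r)) \<le> A * m powr (-3/2)"
    and A2: "\<And>r m. \<delta> \<le> m \<Longrightarrow> m \<le> r \<Longrightarrow> norm (hankel1 1 (k * r)) \<le> A * m powr (-1/2)"
    by blast
  define C where "C = 2 * k * A\<^sup>2 + 4 * k\<^sup>2 * A\<^sup>2 + 6 * k * A\<^sup>2"
  show ?thesis
  proof
    show "C > 0" using k A by (simp add: C_def add_pos_pos)
    fix a b c d m assume m: "\<delta> \<le> m" "m \<le> rad a b" "m \<le> rad c d"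
    define L where "L = rad (c - a) (d - b)"
    have L: "L \<ge> 0" by (simp add: L_def)
    have m0: "m > 0" using m \<delta> by simp
    have ra: "rad a b > 0" and rc: "rad c d > 0" using m m0 by auto
    have nz: "a \<noteq> 0 \<or> b \<noteq> 0" "c \<noteq> 0 \<or> d \<noteq> 0" using ra rc by (simp_all add: rad_pos_iff)
    define p where "p = a / rad a b"
    define q where "q = c / rad c d"
    have p: "\<bar>p\<bar> \<le> 1" using abs_le_rad(1)[of a b] ra by (simp add: p_def)
    have q: "\<bar>q\<bar> \<le> 1" using abs_le_rad(1)[of c d] rc by (simp add: q_def)
    have pq: "\<bar>q - p\<bar> \<le> 2 * L / m"
    proof -
      have "\<bar>q - p\<bar> \<le> 2 * L / rad c d" unfolding p_def q_def L_def by (rule direction_diff[OF nz(2,1)])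
      also have "\<dots> \<le> 2 * L / m" using m m0 L by (intro divide_left_mono) auto
      finally show ?thesis .
    qed
    have pq2: "\<bar>q\<^sup>2 - p\<^sup>2\<bar> \<le> 4 * L / m"
    proof -
      have "\<bar>q\<^sup>2 - p\<^sup>2\<bar> = \<bar>q - p\<bar> * \<bar>q + p\<bar>"
        by (simp add: power2_eq_square algebra_simps flip: abs_mult)
      also have "\<dots> \<le> (2 * L / m) * 2" using p q pq by (intro mult_mono) auto
      finally show ?thesis by simp
    qed
    define w where "w = hankel1 0 (k * rad a b)"
    define g where "g = hankel1 0 (k * rad c d)"
    define ew where "ew = hankel1 1 (k * rad a b) + \<i> * w"
    define eg where "eg = hankel1 1 (k * rad c d) + \<i> * g"
    have h1: "hankel1 1 (k * rad a b) = ew - \<i> * w" "hankel1 1 (k * rad c d) = eg - \<i> * g"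
      by (simp_all add: ew_def eg_def)
    have w: "norm w \<le> A * m powr (-1/2)" and g: "norm g \<le> A * m powr (-1/2)"
      unfolding w_def g_def using A0 m by auto
    have ew: "norm ew \<le> A * m powr (-3/2)" and eg: "norm eg \<le> A * m powr (-3/2)"
      unfolding ew_def eg_def w_def g_def using A1 m by auto
    have hw: "norm (hankel1 1 (k * rad a b)) \<le> A * m powr (-1/2)"
      and hg: "norm (hankel1 1 (k * rad c d)) \<le> A * m powr (-1/2)"
      using A2 m by auto
    have pw1: "A * m powr (-1/2) * (A * m powr (-1/2)) = A\<^sup>2 / m"
    proof -
      have "m powr (-1/2) * m powr (-1/2) = m powr (-1)" by (simp flip: powr_add)
      then show ?thesis using m0 by (simp add: power2_eq_square powr_minus_divide algebra_simps)
    qed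
    have pw2: "A * m powr (-1/2) * (A * m powr (-3/2)) = A\<^sup>2 / m\<^sup>2"
    proof -
      have "m powr (-1/2) * m powr (-3/2) = m powr (-2)" by (simp flip: powr_add)
      then show ?thesis using m0 by (simp add: power2_eq_square powr_minus_divide algebra_simps powr_numeral)
    qed
    have wg: "norm (w * g) \<le> A\<^sup>2 / m"
      unfolding norm_mult pw1[symmetric] using w g A by (intro mult_mono) auto
    have weg: "norm (w * eg) \<le> A\<^sup>2 / m\<^sup>2" "norm (g * ew) \<le> A\<^sup>2 / m\<^sup>2"
      unfolding norm_mult pw2[symmetric] using w g A ew eg by (intro mult_mono; simp)+
    have whg: "norm (w * hankel1 1 (k * rad c d)) \<le> A\<^sup>2 / m" "norm (g * hankel1 1 (k * rad a b)) \<le> A\<^sup>2 / m"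
      unfolding norm_mult pw1[symmetric] using w g A hw hg by (intro mult_mono; simp)+
    have hD1: "of_real c * wave_d k c d = - of_real (k * q) * hankel1 1 (k * rad c d)"
      "of_real a * wave_d k a b = - of_real (k * p) * hankel1 1 (k * rad a b)"
      by (simp_all add: wave_d_def p_def q_def)
    \<comment> \<open>The first term carries the difference of the cosines, the other two the
      outgoing remainders; all are of order m^(-2).\<close>
    have "flux1 k a b c d = of_real k * (\<i> * of_real (q - p) * (w * g) - of_real q * (w * eg) + of_real p * (g * ew))"
      unfolding flux1_def hD1 wave_def w_def[symmetric] g_def[symmetric] h1 by (simp add: algebra_simps)
    then have "norm (flux1 k a b c d) = k * norm (\<i> * of_real (q - p) * (w * g) - of_real q * (w * eg) + of_real p * (g * ew))"
      using k by (simp only: norm_mult norm_of_real)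
    also have "\<dots> \<le> k * (\<bar>q - p\<bar> * norm (w * g) + \<bar>q\<bar> * norm (w * eg) + \<bar>p\<bar> * norm (g * ew))"
    proof (rule mult_left_mono)
      have "norm (\<i> * of_real (q - p) * (w * g) - of_real q * (w * eg) + of_real p * (g * ew))
        \<le> norm (\<i> * of_real (q - p) * (w * g)) + norm (of_real q * (w * eg)) + norm (of_real p * (g * ew))"
        by (rule norm_triangle_mono[OF norm_triangle_ineq4 order_refl])
      then show "norm (\<i> * of_real (q - p) * (w * g) - of_real q * (w * eg) + of_real p * (g * ew))
        \<le> \<bar>q - p\<bar> * norm (w * g) + \<bar>q\<bar> * norm (w * eg) + \<bar>p\<bar> * norm (g * ew)"
        by (simp only: norm_mult[of "_ * of_real _"] norm_mult[of "of_real _"] norm_mult[of \<i>] norm_of_real norm_ii mult_1_left)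
    qed (use k in simp)
    also have "\<dots> \<le> k * ((2 * L / m) * (A\<^sup>2 / m) + 1 * (A\<^sup>2 / m\<^sup>2) + 1 * (A\<^sup>2 / m\<^sup>2))"
      using k pq p q wg weg L m0 by (intro mult_left_mono add_mono mult_mono) auto
    also have "\<dots> = (2 * k * A\<^sup>2) * (L + 1) / m\<^sup>2"
      using m0 by (simp add: field_simps power2_eq_square)
    also have "\<dots> \<le> C * (1 + L) / m\<^sup>2"
    proof (intro divide_right_mono)
      show "2 * k * A\<^sup>2 * (L + 1) \<le> C * (1 + L)"
        unfolding add.commute[of L] using k L by (intro mult_right_mono) (auto simp: C_def)
    qed simp
    finally show "norm (flux1 k a b c d) \<le> C * (1 + rad (c - a) (d - b)) / m\<^sup>2"
      unfolding L_def .
    \<comment> \<open>In the second derivative the k^2 part keeps the squared cosine and cancels as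
      before, while the rest has an explicit factor 1 / radius.\<close>
    have DD: "wave_d k c d + of_real (c\<^sup>2) * wave_dd k c d = - of_real (k\<^sup>2 * q\<^sup>2) * g + of_real (k / rad c d * (2 * q\<^sup>2 - 1)) * hankel1 1 (k * rad c d)"
      "wave_d k a b + of_real (a\<^sup>2) * wave_dd k a b = - of_real (k\<^sup>2 * p\<^sup>2) * w + of_real (k / rad a b * (2 * p\<^sup>2 - 1)) * hankel1 1 (k * rad a b)"
      unfolding wave_d_def wave_dd_def p_def q_def w_def g_def using ra rc
      by (simp_all add: field_simps power2_eq_square)
    have eq: "flux1' k a b c d = - of_real (k\<^sup>2 * (q\<^sup>2 - p\<^sup>2)) * (w * g)
        + of_real (k / rad c d * (2 * q\<^sup>2 - 1)) * (w * hankel1 1 (k * rad c d))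
        - of_real (k / rad a b * (2 * p\<^sup>2 - 1)) * (g * hankel1 1 (k * rad a b))"
      unfolding flux1'_def DD unfolding wave_def w_def[symmetric] g_def[symmetric] by (simp add: algebra_simps)
    have cf: "\<bar>k / rad c d * (2 * q\<^sup>2 - 1)\<bar> \<le> k / m * 3" "\<bar>k / rad a b * (2 * p\<^sup>2 - 1)\<bar> \<le> k / m * 3"
    proof -
      have "q\<^sup>2 \<le> 1" "p\<^sup>2 \<le> 1" using p q by (simp_all add: abs_square_le_1)
      then have "\<bar>2 * q\<^sup>2 - 1\<bar> \<le> 3" "\<bar>2 * p\<^sup>2 - 1\<bar> \<le> 3" 
        using zero_le_power2[of q] zero_le_power2[of p] by linarith+
      moreover have "\<bar>k / rad c d\<bar> \<le> k / m" "\<bar>k / rad a b\<bar> \<le> k / m"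
        using k m m0 ra rc by (simp_all add: divide_left_mono)
      ultimately show "\<bar>k / rad c d * (2 * q\<^sup>2 - 1)\<bar> \<le> k / m * 3" "\<bar>k / rad a b * (2 * p\<^sup>2 - 1)\<bar> \<le> k / m * 3"
        unfolding abs_mult using k m0 by (intro mult_mono; simp)+
    qed
    have "norm (flux1' k a b c d) \<le> norm (- of_real (k\<^sup>2 * (q\<^sup>2 - p\<^sup>2)) * (w * g))
        + norm (of_real (k / rad c d * (2 * q\<^sup>2 - 1)) * (w * hankel1 1 (k * rad c d)))
        + norm (of_real (k / rad a b * (2 * p\<^sup>2 - 1)) * (g * hankel1 1 (k * rad a b)))"
      unfolding eq by (rule order_trans[OF norm_triangle_ineq4 add_right_mono[OF norm_triangle_ineq]])
    also have "\<dots> = (k\<^sup>2 * \<bar>q\<^sup>2 - p\<^sup>2\<bar>) * norm (w * g)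
        + \<bar>k / rad c d * (2 * q\<^sup>2 - 1)\<bar> * norm (w * hankel1 1 (k * rad c d))
        + \<bar>k / rad a b * (2 * p\<^sup>2 - 1)\<bar> * norm (g * hankel1 1 (k * rad a b))"
      by (simp only: norm_mult[of "of_real _"] norm_mult[of "- of_real _"] norm_minus_cancel norm_of_real abs_mult) simp
    also have "\<dots> \<le> (k\<^sup>2 * (4 * L / m)) * (A\<^sup>2 / m) + (k / m * 3) * (A\<^sup>2 / m) + (k / m * 3) * (A\<^sup>2 / m)"
      using k cf pq2 wg whg L m0 by (intro add_mono mult_mono order_refl) auto
    also have "\<dots> = (4 * k\<^sup>2 * A\<^sup>2 * L + 6 * k * A\<^sup>2) / m\<^sup>2"
      using m0 by (simp add: field_simps power2_eq_square)
    also have "\<dots> \<le> C * (1 + L) / m\<^sup>2"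
    proof (intro divide_right_mono)
      have "4 * k\<^sup>2 * A\<^sup>2 * L \<le> C * L" using k L by (intro mult_right_mono) (auto simp: C_def)
      moreover have "6 * k * A\<^sup>2 \<le> C" using k by (auto simp: C_def)
      ultimately show "4 * k\<^sup>2 * A\<^sup>2 * L + 6 * k * A\<^sup>2 \<le> C * (1 + L)" by (simp add: distrib_left)
    qed simp
    finally show "norm (flux1' k a b c d) \<le> C * (1 + rad (c - a) (d - b)) / m\<^sup>2"
      unfolding L_def .
  qed
qed

section \<open>The flux through a line\<close>

lemma quad_lower:
  fixes \<delta> a :: real
  assumes "\<delta> > 0"
  obtains c where "c > 0" "\<And>t. c * (1 + t\<^sup>2) \<le> \<delta>\<^sup>2 + (t - a)\<^sup>2"
proof
  \<comment> \<open>From t^2 <= 2 (t - a)^2 + 2 a^2; the constant 1 + 2 a^2 is paid for by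
    \<delta>^2.\<close>
  define K where "K = (1 + 2 * a\<^sup>2) / \<delta>\<^sup>2 + 2"
  have K: "K > 0" using assms by (auto simp: K_def intro!: add_nonneg_pos divide_nonneg_pos)
  show "1 / K > 0" using K by simp
  fix t :: real
  have "t\<^sup>2 \<le> 2 * (t - a)\<^sup>2 + 2 * a\<^sup>2"
    using zero_le_power2[of "t - 2 * a"] by (simp add: power2_eq_square algebra_simps)
  then have "1 + t\<^sup>2 \<le> (1 + 2 * a\<^sup>2) / \<delta>\<^sup>2 * \<delta>\<^sup>2 + 2 * (t - a)\<^sup>2" using assms by simp
  also have "\<dots> \<le> K * \<delta>\<^sup>2 + K * (t - a)\<^sup>2"
    by (intro add_mono mult_right_mono) (auto simp: K_def)
  finally show "1 / K * (1 + t\<^sup>2) \<le> \<delta>\<^sup>2 + (t - a)\<^sup>2" using K by (simp add: field_simps)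
qed

lemma integral_inverse_quad:
  "integrable lborel (\<lambda>t::real. 1 / (1 + t\<^sup>2))" "(LINT t|lborel. 1 / (1 + t\<^sup>2)) = pi"
proof -
  have e: "einterval (-\<infinity>) \<infinity> = UNIV" by auto
  show "integrable lborel (\<lambda>t::real. 1 / (1 + t\<^sup>2))"
    using integrable_inverse_1_plus_square by (simp add: set_integrable_def e inverse_eq_divide)
  show "(LINT t|lborel. 1 / (1 + t\<^sup>2)) = pi"
    using LBINT_inverse_1_plus_square
    by (simp add: interval_lebesgue_integral_def set_lebesgue_integral_def e inverse_eq_divide)
qed

lemma isCont_rad:
  "isCont f t \<Longrightarrow> isCont g t \<Longrightarrow> isCont (\<lambda>t. rad (f t) (g t)) t"
  unfolding rad_def by (intro continuous_intros)

lemma isCont_wave: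
  fixes f g :: "'a::t2_space \<Rightarrow> real"
  assumes k: "k > 0" and "isCont f t" "isCont g t" "f t \<noteq> 0 \<or> g t \<noteq> 0"
  shows "isCont (\<lambda>t. hankel1 0 (k * rad (f t) (g t))) t"
    "isCont (\<lambda>t. hankel1 1 (k * rad (f t) (g t))) t"
    "isCont (\<lambda>t. wave k (f t) (g t)) t" "isCont (\<lambda>t. wave_d k (f t) (g t)) t" "isCont (\<lambda>t. wave_dd k (f t) (g t)) t"
proof -
  have r: "rad (f t) (g t) > 0" using assms rad_pos by blast
  note cr = isCont_rad[OF assms(2,3)]
  have z: "k * rad (f t) (g t) > 0" using r k by simp
  have ckr: "isCont (\<lambda>t. k * rad (f t) (g t)) t" by (intro continuous_intros cr)
  show h0: "isCont (\<lambda>t. hankel1 0 (k * rad (f t) (g t))) t"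
    by (rule isCont_o2[OF ckr]) (use hankel1_deriv(1)[OF z] in \<open>auto dest: has_vector_derivative_continuous\<close>)
  show h1: "isCont (\<lambda>t. hankel1 1 (k * rad (f t) (g t))) t"
    by (rule isCont_o2[OF ckr]) (use hankel1_deriv(2)[OF z] in \<open>auto dest: has_vector_derivative_continuous\<close>)
  show "isCont (\<lambda>t. wave k (f t) (g t)) t" unfolding wave_def by (rule h0)
  show "isCont (\<lambda>t. wave_d k (f t) (g t)) t" unfolding wave_d_def
    by (intro continuous_intros h1 cr) (use r in auto)
  show "isCont (\<lambda>t. wave_dd k (f t) (g t)) t" unfolding wave_dd_def
    by (intro continuous_intros h1 h0 cr) (use r in auto)
qed

lemma borel_measurable_isCont:
  fixes f :: "real \<Rightarrow> 'a::topological_space"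
  assumes "\<And>t. isCont f t"
  shows "f \<in> borel_measurable borel"
  using assms by (intro borel_measurable_continuous_onI continuous_at_imp_continuous_on) auto

lemma isCont_flux:
  assumes k: "k > 0" and "isCont a t" "isCont b t" "isCont c t" "isCont d t"
    "a t \<noteq> 0 \<or> b t \<noteq> 0" "c t \<noteq> 0 \<or> d t \<noteq> 0"
  shows "isCont (\<lambda>t. flux1 k (a t) (b t) (c t) (d t)) t" "isCont (\<lambda>t. flux1' k (a t) (b t) (c t) (d t)) t"
proof -
  note h = isCont_wave(3-5)[OF k assms(2,3,6)] isCont_wave(3-5)[OF k assms(4,5,7)]
  show "isCont (\<lambda>t. flux1 k (a t) (b t) (c t) (d t)) t" "isCont (\<lambda>t. flux1' k (a t) (b t) (c t) (d t)) t"
    unfolding flux1_def flux1'_def by (intro continuous_intros h assms)+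
qed

lemma flux1_deriv:
  assumes k: "k > 0" and p: "s \<noteq> p \<or> b \<noteq> 0" and q: "s \<noteq> q \<or> d \<noteq> 0"
  shows "((\<lambda>s. flux1 k (s - p) b (s - q) d) has_vector_derivative flux1' k (s - p) b (s - q) d) (at s)"
proof -
  have I: "((\<lambda>s. complex_of_real (s - x)) has_vector_derivative of_real 1) (at s)" for x
    by (rule has_vector_derivative_of_real) (auto intro!: derivative_eq_intros)
  note P = hankel_deriv1[OF k p] and Q = hankel_deriv1[OF k q]
  show ?thesis unfolding flux1_def flux1'_def
    by (rule has_vector_derivative_eq_rhs,
        rule has_vector_derivative_diff[OF
          has_vector_derivative_mult[OF P(1) has_vector_derivative_mult[OF I Q(2)]]
          has_vector_derivative_mult[OF Q(1) has_vector_derivative_mult[OF I P(2)]]])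
       (simp add: algebra_simps power2_eq_square)
qed

definition flux_line :: "real \<Rightarrow> real \<Rightarrow> real \<Rightarrow> real \<Rightarrow> real \<Rightarrow> real \<Rightarrow> complex" where
  "flux_line k p1 p2 q1 q2 s = (LINT t|lborel. flux1 k (s - p1) (t - p2) (s - q1) (t - q2))"

text \<open>The first two bounds give a majorant in t uniform in the position of the line, for
  differentiation and limits under the integral. The third makes the flux density vanish as the line
  moves to infinity.\<close>

lemma flux_dominated:
  assumes k: "k > 0" and \<delta>: "\<delta> > 0"
  obtains K where "K > 0"
    "\<And>s t. \<delta> \<le> \<bar>s - p1\<bar> \<Longrightarrow> \<delta> \<le> \<bar>s - q1\<bar> \<Longrightarrow> norm (flux1 k (s - p1) (t - p2) (s - q1) (t - q2)) \<le> K * (1 / (1 + t\<^sup>2))"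
    "\<And>s t. \<delta> \<le> \<bar>s - p1\<bar> \<Longrightarrow> \<delta> \<le> \<bar>s - q1\<bar> \<Longrightarrow> norm (flux1' k (s - p1) (t - p2) (s - q1) (t - q2)) \<le> K * (1 / (1 + t\<^sup>2))"
    "\<And>s t. \<delta> \<le> \<bar>s - p1\<bar> \<Longrightarrow> \<delta> \<le> \<bar>s - q1\<bar> \<Longrightarrow> norm (flux1 k (s - p1) (t - p2) (s - q1) (t - q2)) \<le> K / (min \<bar>s - p1\<bar> \<bar>s - q1\<bar>)\<^sup>2"
proof -
  obtain c1 where c1: "c1 > 0" "\<And>t. c1 * (1 + t\<^sup>2) \<le> \<delta>\<^sup>2 + (t - p2)\<^sup>2" using quad_lower[OF \<delta>] by blast
  obtain c2 where c2: "c2 > 0" "\<And>t. c2 * (1 + t\<^sup>2) \<le> \<delta>\<^sup>2 + (t - q2)\<^sup>2" using quad_lower[OF \<delta>] by blast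
  define c where "c = min c1 c2"
  have c: "c > 0" using c1 c2 by (simp add: c_def)
  \<comment> \<open>Both choices of the lower radius made below, sqrt (c (1 + t^2)) and the smaller
    horizontal distance, are at least this large.\<close>
  define \<delta>' where "\<delta>' = min \<delta> (sqrt c)"
  have "\<delta>' > 0" using \<delta> c by (simp add: \<delta>'_def)
  from flux_bounds[OF k this] obtain C where C: "C > 0"
    and C1: "\<And>a b c d m. \<delta>' \<le> m \<Longrightarrow> m \<le> rad a b \<Longrightarrow> m \<le> rad c d \<Longrightarrow>
      norm (flux1 k a b c d) \<le> C * (1 + rad (c - a) (d - b)) / m\<^sup>2"
    and C2: "\<And>a b c d m. \<delta>' \<le> m \<Longrightarrow> m \<le> rad a b \<Longrightarrow> m \<le> rad c d \<Longrightarrow>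
      norm (flux1' k a b c d) \<le> C * (1 + rad (c - a) (d - b)) / m\<^sup>2"
    by blast
  define L where "L = C * (1 + rad (p1 - q1) (p2 - q2))"
  have L: "L > 0" using C by (simp add: L_def add_pos_nonneg)
  have Leq: "C * (1 + rad ((s - q1) - (s - p1)) ((t - q2) - (t - p2))) = L" for s t
    by (simp add: L_def)
  show ?thesis
  proof
    show "L + L / c > 0" using L c by (simp add: add_pos_pos)
    fix s t assume st: "\<delta> \<le> \<bar>s - p1\<bar>" "\<delta> \<le> \<bar>s - q1\<bar>"
    define m where "m = sqrt (c * (1 + t\<^sup>2))"
    have m2: "m\<^sup>2 = c * (1 + t\<^sup>2)" using c by (simp add: m_def)
    have sq: "\<delta>\<^sup>2 \<le> (s - p1)\<^sup>2" "\<delta>\<^sup>2 \<le> (s - q1)\<^sup>2"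
      using st \<delta> by (metis abs_le_square_iff abs_of_pos)+
    have "c * (1 + t\<^sup>2) \<le> c1 * (1 + t\<^sup>2)" by (intro mult_right_mono) (auto simp: c_def)
    then have mp: "m \<le> rad (s - p1) (t - p2)"
      unfolding m_def rad_def using c1(2)[of t] sq by (intro real_sqrt_le_mono) linarith
    have "c * (1 + t\<^sup>2) \<le> c2 * (1 + t\<^sup>2)" by (intro mult_right_mono) (auto simp: c_def)
    then have mq: "m \<le> rad (s - q1) (t - q2)"
      unfolding m_def rad_def using c2(2)[of t] sq by (intro real_sqrt_le_mono) linarith
    have "sqrt c \<le> m" unfolding m_def using c by (intro real_sqrt_le_mono) simp
    then have md: "\<delta>' \<le> m" by (simp add: \<delta>'_def)
    have eq: "L / m\<^sup>2 = L / c * (1 / (1 + t\<^sup>2))" unfolding m2 by simp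
    have le: "L / c * (1 / (1 + t\<^sup>2)) \<le> (L + L / c) * (1 / (1 + t\<^sup>2))"
      using L by (intro mult_right_mono) auto
    show "norm (flux1 k (s - p1) (t - p2) (s - q1) (t - q2)) \<le> (L + L / c) * (1 / (1 + t\<^sup>2))"
      using C1[OF md mp mq] le unfolding Leq eq by linarith
    show "norm (flux1' k (s - p1) (t - p2) (s - q1) (t - q2)) \<le> (L + L / c) * (1 / (1 + t\<^sup>2))"
      using C2[OF md mp mq] le unfolding Leq eq by linarith
    define n where "n = min \<bar>s - p1\<bar> \<bar>s - q1\<bar>"
    have n: "\<delta> \<le> n" using st by (simp add: n_def)
    have "norm (flux1 k (s - p1) (t - p2) (s - q1) (t - q2)) \<le> L / n\<^sup>2"
    proof (rule C1[of n "s - p1" "t - p2" "s - q1" "t - q2", unfolded Leq])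
      show "\<delta>' \<le> n" using n by (simp add: \<delta>'_def)
      show "n \<le> rad (s - p1) (t - p2)" "n \<le> rad (s - q1) (t - q2)"
        using abs_le_rad(1)[of "s - p1" "t - p2"] abs_le_rad(1)[of "s - q1" "t - q2"] by (simp_all add: n_def)
    qed
    also have "\<dots> \<le> (L + L / c) / n\<^sup>2" using L c by (intro divide_right_mono) auto
    finally show "norm (flux1 k (s - p1) (t - p2) (s - q1) (t - q2)) \<le> (L + L / c) / (min \<bar>s - p1\<bar> \<bar>s - q1\<bar>)\<^sup>2"
      by (simp add: n_def)
  qed
qed

lemma flux_integrable:
  assumes k: "k > 0" and "s \<noteq> p1" "s \<noteq> q1"
  shows "integrable lborel (\<lambda>t. flux1 k (s - p1) (t - p2) (s - q1) (t - q2))"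
    "integrable lborel (\<lambda>t. flux1' k (s - p1) (t - p2) (s - q1) (t - q2))"
proof -
  define \<delta> where "\<delta> = min \<bar>s - p1\<bar> \<bar>s - q1\<bar>"
  have \<delta>: "\<delta> > 0" "\<delta> \<le> \<bar>s - p1\<bar>" "\<delta> \<le> \<bar>s - q1\<bar>" using assms by (auto simp: \<delta>_def)
  obtain K where K: "K > 0"
    and F: "\<And>t. norm (flux1 k (s - p1) (t - p2) (s - q1) (t - q2)) \<le> K * (1 / (1 + t\<^sup>2))"
    and F': "\<And>t. norm (flux1' k (s - p1) (t - p2) (s - q1) (t - q2)) \<le> K * (1 / (1 + t\<^sup>2))"
    using flux_dominated[OF k \<delta>(1), of p1 q1 p2 q2] \<delta>(2,3) by metis
  have "(\<lambda>t. flux1 k (s - p1) (t - p2) (s - q1) (t - q2)) \<in> borel_measurable borel"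
    by (rule borel_measurable_isCont, rule isCont_flux[OF k]) (use assms in \<open>auto intro!: continuous_intros\<close>)
  then have m1: "(\<lambda>t. flux1 k (s - p1) (t - p2) (s - q1) (t - q2)) \<in> borel_measurable lborel"
    by simp
  have "(\<lambda>t. flux1' k (s - p1) (t - p2) (s - q1) (t - q2)) \<in> borel_measurable borel"
    by (rule borel_measurable_isCont, rule isCont_flux[OF k]) (use assms in \<open>auto intro!: continuous_intros\<close>)
  then have m2: "(\<lambda>t. flux1' k (s - p1) (t - p2) (s - q1) (t - q2)) \<in> borel_measurable lborel"
    by simp
  have i: "integrable lborel (\<lambda>t. K * (1 / (1 + t\<^sup>2)))"
    using integral_inverse_quad(1) by (rule integrable_mult_right)
  show "integrable lborel (\<lambda>t. flux1 k (s - p1) (t - p2) (s - q1) (t - q2))"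
    by (rule Bochner_Integration.integrable_bound[OF i m1])
       (use F K in simp)
  show "integrable lborel (\<lambda>t. flux1' k (s - p1) (t - p2) (s - q1) (t - q2))"
    by (rule Bochner_Integration.integrable_bound[OF i m2])
       (use F' K in simp)
qed

text \<open>Since the divergence vanishes, the integrand is minus the t-derivative of the vertical
  flux component, and that tends to 0 at both ends.\<close>

lemma flux'_integral_zero:
  assumes k: "k > 0" and s: "s \<noteq> p1" "s \<noteq> q1"
  shows "(LINT t|lborel. flux1' k (s - p1) (t - p2) (s - q1) (t - q2)) = 0"
proof -
  let ?f = "\<lambda>t. flux1' k (t - p2) (s - p1) (t - q2) (s - q1)"
  let ?F = "\<lambda>t. flux1 k (t - p2) (s - p1) (t - q2) (s - q1)"
  have eq: "flux1' k (s - p1) (t - p2) (s - q1) (t - q2) = - ?f t" for t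
    using flux_divergence[OF k, of "s - p1" "t - p2" "s - q1" "t - q2"] s by simp
  have e: "einterval (-\<infinity>) \<infinity> = UNIV" by auto
  obtain C where C: "C > 0" and C1: "\<And>a b c d m. 1 \<le> m \<Longrightarrow> m \<le> rad a b \<Longrightarrow> m \<le> rad c d \<Longrightarrow>
      norm (flux1 k a b c d) \<le> C * (1 + rad (c - a) (d - b)) / m\<^sup>2"
    using flux_bounds[OF k zero_less_one] by metis
  define L where "L = C * (1 + rad (p2 - q2) (p1 - q1))"
  define M where "M = \<bar>p2\<bar> + \<bar>q2\<bar>"
  have L: "L > 0" using C by (simp add: L_def add_pos_nonneg)
  have b: "norm (?F t) \<le> L / (\<bar>t\<bar> - M)\<^sup>2" if "\<bar>t\<bar> \<ge> M + 1" for t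
  proof -
    have "norm (?F t) \<le> C * (1 + rad ((t - q2) - (t - p2)) ((s - q1) - (s - p1))) / (\<bar>t\<bar> - M)\<^sup>2"
    proof (rule C1)
      show "1 \<le> \<bar>t\<bar> - M" using that by simp
      have "\<bar>t\<bar> - M \<le> \<bar>t - p2\<bar>" "\<bar>t\<bar> - M \<le> \<bar>t - q2\<bar>" by (auto simp: M_def)
      then show "\<bar>t\<bar> - M \<le> rad (t - p2) (s - p1)" "\<bar>t\<bar> - M \<le> rad (t - q2) (s - q1)"
        using abs_le_rad(1) order_trans by blast+
    qed
    then show ?thesis by (simp add: L_def)
  qed
  have top: "(?F \<longlongrightarrow> 0) at_top"
  proof (rule Lim_null_comparison)
    show "\<forall>\<^sub>F t in at_top. norm (?F t) \<le> L / (t - M)\<^sup>2"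
      using eventually_ge_at_top[of "M + 1"]
    proof eventually_elim
      case (elim t)
      have "M \<ge> 0" by (simp add: M_def)
      then show ?case using b[of t] elim by simp
    qed
    show "((\<lambda>t. L / (t - M)\<^sup>2) \<longlongrightarrow> 0) at_top" by real_asymp
  qed
  have bot: "(?F \<longlongrightarrow> 0) at_bot"
  proof (rule Lim_null_comparison)
    show "\<forall>\<^sub>F t in at_bot. norm (?F t) \<le> L / (- t - M)\<^sup>2"
      using eventually_le_at_bot[of "- (M + 1)"]
    proof eventually_elim
      case (elim t)
      have "M \<ge> 0" by (simp add: M_def)
      then show ?case using b[of t] elim by simp
    qed
    show "((\<lambda>t. L / (- t - M)\<^sup>2) \<longlongrightarrow> 0) at_bot" by real_asymp
  qed
  have "(LBINT t=-\<infinity>..\<infinity>. ?f t) = 0 - 0"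
  proof (rule interval_integral_FTC_integrable)
    show "(?F has_vector_derivative ?f t) (at t)" for t
      using s by (intro flux1_deriv k) auto
    show "isCont ?f t" for t
      using s by (intro isCont_flux[OF k] continuous_intros) auto
    show "set_integrable lborel (einterval (- \<infinity>) \<infinity>) ?f"
      using Bochner_Integration.integrable_minus[OF flux_integrable(2)[OF k s, of p2 q2]]
      unfolding eq by (simp add: set_integrable_def e)
    show "((?F \<circ> real_of_ereal) \<longlongrightarrow> 0) (at_right (- \<infinity>))"
      using bot by (simp only: ereal_tendsto_simps)
    show "((?F \<circ> real_of_ereal) \<longlongrightarrow> 0) (at_left \<infinity>)"
      using top by (simp only: ereal_tendsto_simps)
  qed simp
  then have "(LINT t|lborel. ?f t) = 0"
    by (simp add: interval_lebesgue_integral_def set_lebesgue_integral_def e)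
  then show ?thesis unfolding eq by simp
qed

lemma flux_line_deriv:
  assumes k: "k > 0" and s: "s \<noteq> p1" "s \<noteq> q1"
  shows "(flux_line k p1 p2 q1 q2 has_vector_derivative 0) (at s)"
proof -
  define \<delta> where "\<delta> = min \<bar>s - p1\<bar> \<bar>s - q1\<bar> / 2"
  have \<delta>: "\<delta> > 0" "2 * \<delta> \<le> \<bar>s - p1\<bar>" "2 * \<delta> \<le> \<bar>s - q1\<bar>" using assms by (auto simp: \<delta>_def)
  have near: "\<delta> \<le> \<bar>x - p1\<bar>" "\<delta> \<le> \<bar>x - q1\<bar>" if "s - \<delta> < x" "x < s + \<delta>" for x
    using \<delta> that by linarith+
  obtain K where K: "K > 0"
    "\<And>s t. \<delta> \<le> \<bar>s - p1\<bar> \<Longrightarrow> \<delta> \<le> \<bar>s - q1\<bar> \<Longrightarrow> norm (flux1' k (s - p1) (t - p2) (s - q1) (t - q2)) \<le> K * (1 / (1 + t\<^sup>2))"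
    using flux_dominated[OF k \<delta>(1), of p1 q1 p2 q2] by metis
  have "((\<lambda>s. LINT t|lborel. flux1 k (s - p1) (t - p2) (s - q1) (t - q2)) has_vector_derivative
     (LINT t|lborel. flux1' k (s - p1) (t - p2) (s - q1) (t - q2))) (at s)"
  proof (rule has_vector_derivative_integral(2)[of "s - \<delta>" s "s + \<delta>"])
    fix x assume x: "s - \<delta> < x" "x < s + \<delta>"
    have ne: "x \<noteq> p1" "x \<noteq> q1" using near[OF x] \<delta>(1) by auto
    show "integrable lborel (\<lambda>t. flux1 k (x - p1) (t - p2) (x - q1) (t - q2))"
      by (rule flux_integrable[OF k ne])
    show "((\<lambda>x. flux1 k (x - p1) (t - p2) (x - q1) (t - q2)) has_vector_derivative
       flux1' k (x - p1) (t - p2) (x - q1) (t - q2)) (at x)" for t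
      by (rule flux1_deriv[OF k]) (use ne in auto)
    show "norm (flux1' k (x - p1) (t - p2) (x - q1) (t - q2)) \<le> K * (1 / (1 + t\<^sup>2))" for t
      by (rule K(2)[OF near[OF x]])
  next
    show "integrable lborel (\<lambda>t. K * (1 / (1 + t\<^sup>2)))"
      using integral_inverse_quad(1) by (rule integrable_mult_right)
  qed (use \<delta> in auto)
  then show ?thesis
    unfolding flux'_integral_zero[OF assms] flux_line_def[abs_def] .
qed

lemma flux_line_const:
  assumes k: "k > 0" and "s0 \<le> s1" and "\<And>s. s0 \<le> s \<Longrightarrow> s \<le> s1 \<Longrightarrow> s \<noteq> p1 \<and> s \<noteq> q1"
  shows "flux_line k p1 p2 q1 q2 s0 = flux_line k p1 p2 q1 q2 s1"
proof -
  have "norm (flux_line k p1 p2 q1 q2 s1 - flux_line k p1 p2 q1 q2 s0) \<le> 0 * norm (s1 - s0)"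
  proof (rule differentiable_bound[of "{s0..s1}"])
    show "(flux_line k p1 p2 q1 q2 has_derivative (\<lambda>h. h *\<^sub>R 0)) (at s within {s0..s1})" if "s \<in> {s0..s1}" for s
      using flux_line_deriv[OF k, of s p1 q1 p2 q2] assms(3)[of s] that
      by (auto simp: has_vector_derivative_def intro: has_derivative_at_withinI)
  qed (use assms in \<open>auto simp: onorm_zero\<close>)
  then show ?thesis by simp
qed

text \<open>Both sources lie to the left, so the line can be moved to infinity without crossing one;
  there the flux density tends to 0 under a fixed majorant.\<close>

lemma flux_line_zero:
  assumes k: "k > 0" and s: "s > p1" "s > q1"
  shows "flux_line k p1 p2 q1 q2 s = 0"
proof -
  define M where "M = max p1 q1"
  obtain K where K: "K > 0"
    and K1: "\<And>s t. 1 \<le> \<bar>s - p1\<bar> \<Longrightarrow> 1 \<le> \<bar>s - q1\<bar> \<Longrightarrow> norm (flux1 k (s - p1) (t - p2) (s - q1) (t - q2)) \<le> K * (1 / (1 + t\<^sup>2))"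
    and K2: "\<And>s t. 1 \<le> \<bar>s - p1\<bar> \<Longrightarrow> 1 \<le> \<bar>s - q1\<bar> \<Longrightarrow> norm (flux1 k (s - p1) (t - p2) (s - q1) (t - q2)) \<le> K / (min \<bar>s - p1\<bar> \<bar>s - q1\<bar>)\<^sup>2"
    using flux_dominated[OF k zero_less_one, of p1 q1 p2 q2] by metis
  have far: "1 \<le> \<bar>y - p1\<bar>" "1 \<le> \<bar>y - q1\<bar>" "y - M \<le> min \<bar>y - p1\<bar> \<bar>y - q1\<bar>" if "y \<ge> M + 1" for y
    using that by (auto simp: M_def)
  have ev: "\<forall>\<^sub>F y in at_top. y \<ge> M + 1" by (rule eventually_ge_at_top)
  \<comment> \<open>The maximum keeps the line at least one unit beyond both sources for every y, so
    integrability and the majorant hold without restriction on y.\<close>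
  define F where "F = (\<lambda>y t. flux1 k (max y (M + 1) - p1) (t - p2) (max y (M + 1) - q1) (t - q2))"
  have w: "integrable lborel (\<lambda>t. K * (1 / (1 + t\<^sup>2)))"
    using integral_inverse_quad(1) by (rule integrable_mult_right)
  have fm: "F y \<in> borel_measurable lborel" for y
    unfolding F_def by (rule borel_measurable_integrable, rule flux_integrable[OF k]) (auto simp: M_def max_def)
  have bound: "\<forall>\<^sub>F y in at_top. AE t in lborel. norm (F y t) \<le> K * (1 / (1 + t\<^sup>2))"
    unfolding F_def by (intro always_eventually allI AE_I2 K1 far) auto
  have lim: "AE t in lborel. ((\<lambda>y. F y t) \<longlongrightarrow> 0) at_top"
  proof (rule AE_I2, rule Lim_null_comparison)
    fix t
    show "\<forall>\<^sub>F y in at_top. norm (F y t) \<le> K / (y - M)\<^sup>2"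
      using ev
    proof eventually_elim
      case (elim y)
      have "norm (flux1 k (y - p1) (t - p2) (y - q1) (t - q2)) \<le> K / (min \<bar>y - p1\<bar> \<bar>y - q1\<bar>)\<^sup>2"
        by (rule K2) (use far[OF elim] in auto)
      also have "\<dots> \<le> K / (y - M)\<^sup>2"
        using far[OF elim] elim K by (intro divide_left_mono power_mono mult_pos_pos) auto
      finally show ?case using elim by (simp add: max_absorb1 F_def)
    qed
    show "((\<lambda>y. K / (y - M)\<^sup>2) \<longlongrightarrow> 0) at_top" by real_asymp
  qed
  have "((\<lambda>y. flux_line k p1 p2 q1 q2 (max y (M + 1))) \<longlongrightarrow> 0) at_top"
    using integral_dominated_convergence_at_top[OF _ fm w lim bound] by (simp add: flux_line_def F_def)
  moreover have "\<forall>\<^sub>F y in at_top. flux_line k p1 p2 q1 q2 (max y (M + 1)) = flux_line k p1 p2 q1 q2 s"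
    using ev eventually_ge_at_top[of s]
  proof eventually_elim
    case (elim y)
    then show ?case using flux_line_const[OF k, of s y p1 q1 p2 q2] s by (simp add: max_absorb1)
  qed
  ultimately have "((\<lambda>y::real. flux_line k p1 p2 q1 q2 s) \<longlongrightarrow> 0) at_top"
    by (simp add: tendsto_cong)
  then show ?thesis by (simp add: tendsto_const_iff)
qed

section \<open>Potential of the trace of a point source\<close>

lemma integrable_even:
  fixes f :: "real \<Rightarrow> real"
  assumes f: "f \<in> borel_measurable borel" and i: "integrable lborel (\<lambda>t. indicator {0<..} t * f t)"
  shows "integrable lborel (\<lambda>t. f \<bar>t\<bar>)"
proof -
  have "integrable lborel (\<lambda>t. indicator {0<..} (0 + (-1) * t) * f (0 + (-1) * t))"
    by (rule lborel_integrable_real_affine[OF i]) simp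
  with i have s: "integrable lborel (\<lambda>t. indicator {0<..} t * f t + indicator {0<..} (0 + (-1) * t) * f (0 + (-1) * t))"
    by (rule Bochner_Integration.integrable_add)
  show ?thesis
  proof (rule integrable_cong_AE_imp[OF s])
    show "(\<lambda>t. f \<bar>t\<bar>) \<in> borel_measurable lborel" using f by simp
    have "AE t in lborel. t \<noteq> (0::real)" by (rule AE_lborel_singleton)
    then show "AE t in lborel. indicator {0<..} t * f t + indicator {0<..} (0 + (-1) * t) * f (0 + (-1) * t) = f \<bar>t\<bar>"
      by eventually_elim (auto simp: indicator_def abs_if)
  qed
qed

lemma integrable_decay:
  fixes q :: real
  assumes "q > 1"
  shows "integrable lborel (\<lambda>t. (1 + \<bar>t\<bar>) powr (- q))"
proof (rule integrable_even[where f = "\<lambda>t. (1 + t) powr (- q)"])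
  define F where "F = (\<lambda>t::real. - ((1 + t) powr (1 - q)) / (q - 1))"
  have "set_integrable lborel (einterval 0 \<infinity>) (\<lambda>t. (1 + t) powr (- q))"
  proof (rule interval_integral_FTC_nonneg(1))
    show "DERIV F t :> (1 + t) powr (- q)" if "0 < ereal t" for t
    proof -
      have "DERIV (\<lambda>t. (1 + t) powr (1 - q)) t :> (1 - q) * (1 + t) powr (1 - q - of_nat 1) * 1"
        by (rule DERIV_fun_powr) (use that in \<open>auto intro!: derivative_eq_intros\<close>)
      then have "DERIV (\<lambda>t. - ((1 + t) powr (1 - q)) / (q - 1)) t :> - ((1 - q) * (1 + t) powr (1 - q - of_nat 1) * 1) / (q - 1)"
        by (intro DERIV_cdivide DERIV_minus)
      moreover have "- ((1 - q) * Y * 1) / (q - 1) = Y" for Y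
        using assms by (simp add: field_simps)
      ultimately show ?thesis unfolding F_def by simp
    qed
    show "isCont (\<lambda>t. (1 + t) powr (- q)) t" if "0 < ereal t" for t
      using that by (intro continuous_intros) auto
    have "(F \<longlongrightarrow> - ((1 + 0) powr (1 - q)) / (q - 1)) (at_right 0)"
      unfolding F_def using assms by (intro tendsto_intros) auto
    then show "((F \<circ> real_of_ereal) \<longlongrightarrow> - ((1 + 0) powr (1 - q)) / (q - 1)) (at_right 0)"
      unfolding zero_ereal_def by (simp only: ereal_tendsto_simps)
    have "(F \<longlongrightarrow> 0) at_top" unfolding F_def using assms by real_asymp
    then show "((F \<circ> real_of_ereal) \<longlongrightarrow> 0) (at_left \<infinity>)"
      by (simp only: ereal_tendsto_simps)
  qed auto
  then show "integrable lborel (\<lambda>t. indicator {0<..} t * (1 + t) powr (- q))"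
    by (simp add: set_integrable_def zero_ereal_def)
qed measurable

lemma integrable_inverse_sqrt:
  "integrable lborel (\<lambda>t::real. indicator {..1} \<bar>t\<bar> * \<bar>t\<bar> powr (-1/2))"
proof (rule integrable_even[where f = "\<lambda>t. indicator {..1} t * t powr (-1/2)"])
  have "integrable lborel (\<lambda>t::real. indicator {0..1} t * t powr (1/2 - 1))"
    by (rule powr_integral_from_0) auto
  also have "(\<lambda>t::real. indicator {0..1} t * t powr (1/2 - 1)) = (\<lambda>t. indicator {0<..} t * (indicator {..1} t * t powr (-1/2)))"
    by (auto simp: indicator_def fun_eq_iff)
  finally show "integrable lborel \<dots>" .
qed measurable

lemma rad_one_bounds: "rad 1 t \<ge> 1" "rad 1 t \<ge> (1 + \<bar>t\<bar>) / 2" "rad 1 t \<le> 1 + \<bar>t\<bar>"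
proof -
  show "rad 1 t \<ge> 1" "rad 1 t \<ge> (1 + \<bar>t\<bar>) / 2"
    using abs_le_rad(1)[of 1 t] abs_le_rad(2)[of t 1] by auto
  show "rad 1 t \<le> 1 + \<bar>t\<bar>"
    using rad_triangle[of 1 0 0 t] by (simp add: rad_def)
qed

lemma rad_scale: "c \<ge> 0 \<Longrightarrow> rad (c * a) (c * b) = c * rad a b"
  by (simp add: rad_def power_mult_distrib real_sqrt_mult flip: distrib_left)

text \<open>The normal derivative of a wave at distance 1 / T acts like a point mass. With t = s / T
  the factor z H1(z) tends to - 2 \<i> / pi, and what remains is the Poisson kernel 1 / (1 + s^2) of
  mass pi; hence the total 2 \<i>.\<close>

lemma kernel_approx_identity:
  fixes T :: "nat \<Rightarrow> real" and W :: "nat \<Rightarrow> real \<Rightarrow> complex"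
  assumes k: "k > 0" and T: "\<And>n. T n \<ge> 1" "filterlim T at_top sequentially"
    and W: "\<And>n. W n \<in> borel_measurable borel" "\<And>n t. norm (W n t) \<le> M"
    and lim: "\<And>s. (\<lambda>n. W n (s / T n)) \<longlonglongrightarrow> L"
  shows "integrable lborel (\<lambda>t. of_real (1 / T n) * wave_d k (1 / T n) t * W n t)"
    and "(\<lambda>n. LINT t|lborel. of_real (1 / T n) * wave_d k (1 / T n) t * W n t) \<longlonglongrightarrow> 2 * \<i> * L"
proof -
  obtain C where C: "C > 0" "\<And>z. z > 0 \<Longrightarrow> norm (of_real z * hankel1 1 z) \<le> C * (1 + sqrt z)"
    using hankel1_1_bound by metis
  have T0: "T n > 0" for n using T(1)[of n] by simp
  have M: "M \<ge> 0" using W(2)[of 0 0] norm_ge_zero order_trans by blast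
  define f where "f = (\<lambda>n t. of_real (1 / T n) * wave_d k (1 / T n) t * W n t)"
  define g where "g = (\<lambda>n s. of_real (1 / T n) * f n (0 + 1 / T n * s))"
  \<comment> \<open>The term sqrt z in the bound of z H1 weakens the decay from order 2 to order
    3/2, still integrable. The factor 4 rounds up the 2^(3/2) that arises from (1 + |s|) /
    2.\<close>
  define w where "w = (\<lambda>s. C * (1 + sqrt k) * 4 * M * (1 + \<bar>s\<bar>) powr (-3/2))"
  have geq: "g n s = - (of_real (k / T n * rad 1 s) * hankel1 1 (k / T n * rad 1 s)) / of_real (1 + s\<^sup>2) * W n (s / T n)" for n s
  proof -
    have "rad (1 / T n) (0 + 1 / T n * s) = 1 / T n * rad 1 s"
      using rad_scale[of "1 / T n" 1 s] T0[of n] by simp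
    moreover have "rad 1 s > 0" using rad_one_bounds(1)[of s] by linarith
    moreover have s2: "1 + s\<^sup>2 = rad 1 s * rad 1 s" using rad_sq[of 1 s] by (simp add: power2_eq_square)
    moreover have "k * (1 / T n * rad 1 s) = k / T n * rad 1 s" by simp
    ultimately have "g n s = of_real (1 / T n) * (of_real (1 / T n) * (- of_real (k / (1 / T n * rad 1 s)) *
        hankel1 1 (k / T n * rad 1 s)) * W n (0 + 1 / T n * s))"
      unfolding g_def f_def wave_d_def by (simp only:)
    also have "\<dots> = of_real ((1 / T n) * (1 / T n) * (k / (1 / T n * rad 1 s))) * - (hankel1 1 (k / T n * rad 1 s) * W n (s / T n))"
      by simp
    also have "(1 / T n) * (1 / T n) * (k / (1 / T n * rad 1 s)) = k / T n * rad 1 s / (1 + s\<^sup>2)"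
      unfolding s2 using T0[of n] \<open>rad 1 s > 0\<close> by (simp add: field_simps)
    finally show ?thesis by simp
  qed
  have gb: "norm (g n s) \<le> w s" for n s
  proof -
    define r where "r = rad 1 s"
    have r: "r \<ge> 1" "r \<ge> (1 + \<bar>s\<bar>) / 2" "1 + s\<^sup>2 = r\<^sup>2"
      using rad_one_bounds[of s] rad_sq[of 1 s] by (auto simp: r_def)
    have kr: "k / T n * r > 0" using k T0[of n] r by simp
    have "k / T n * r \<le> k * r" using k T(1)[of n] r by (simp add: field_simps)
    then have "sqrt (k / T n * r) \<le> sqrt k * sqrt r" by (simp flip: real_sqrt_mult)
    also have "1 + sqrt k * sqrt r \<le> (1 + sqrt k) * sqrt r" using r k by (simp add: distrib_right)
    finally have s1: "1 + sqrt (k / T n * r) \<le> (1 + sqrt k) * sqrt r" by simp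
    have "norm (g n s) = norm (of_real (k / T n * r) * hankel1 1 (k / T n * r)) / r\<^sup>2 * norm (W n (s / T n))"
      unfolding geq r_def[symmetric] r(3) norm_mult norm_divide norm_minus_cancel norm_of_real by simp
    also have "\<dots> \<le> C * ((1 + sqrt k) * sqrt r) / r\<^sup>2 * M"
      using C(2)[OF kr] k r(1) s1 C(1) W(2) M
      by (intro mult_mono divide_right_mono order_trans[OF C(2)[OF kr] mult_left_mono]) auto
    also have "\<dots> = C * (1 + sqrt k) * M * (sqrt r / r\<^sup>2)" by simp
    also have "sqrt r / r\<^sup>2 = r powr (-3/2)"
      using r powr_diff[of r "1/2" 2] by (simp add: powr_half_sqrt powr_numeral)
    also have "C * (1 + sqrt k) * M * r powr (-3/2) \<le> C * (1 + sqrt k) * M * ((1 + \<bar>s\<bar>) / 2) powr (-3/2)"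
      using C k M r by (intro mult_left_mono powr_mono2') auto
    also have "((1 + \<bar>s\<bar>) / 2) powr (-3/2) = (1 + \<bar>s\<bar>) powr (-3/2) * 2 powr (3/2)"
      by (simp add: powr_divide powr_minus_divide)
    also have "C * (1 + sqrt k) * M * ((1 + \<bar>s\<bar>) powr (-3/2) * 2 powr (3/2)) \<le> C * (1 + sqrt k) * M * ((1 + \<bar>s\<bar>) powr (-3/2) * 2 powr 2)"
      using C k M by (intro mult_left_mono powr_mono) auto
    also have "\<dots> = w s" by (simp add: w_def powr_numeral)
    finally show ?thesis .
  qed
  have wi: "integrable lborel w"
    unfolding w_def using integrable_decay[of "3/2"] by (intro integrable_mult_right) auto
  have fm: "f n \<in> borel_measurable borel" for n
  proof -
    have "wave_d k (1 / T n) \<in> borel_measurable borel"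
      by (rule borel_measurable_isCont, rule isCont_wave[OF k]) (use T0[of n] in \<open>auto intro!: continuous_intros\<close>)
    then show ?thesis unfolding f_def using W(1)[of n] by measurable
  qed
  have gm: "g n \<in> borel_measurable lborel" for n
    unfolding g_def using fm[of n] by simp
  have glim: "(\<lambda>n. g n s) \<longlonglongrightarrow> 2 * \<i> / pi * L * of_real (1 / (1 + s\<^sup>2))" for s
  proof -
    have r: "rad 1 s > 0" using rad_one_bounds(1)[of s] by linarith
    have "filterlim (\<lambda>n. k * rad 1 s / T n) (at_right 0) sequentially"
    proof (rule tendsto_imp_filterlim_at_right)
      show "(\<lambda>n. k * rad 1 s / T n) \<longlonglongrightarrow> 0"
        by (rule real_tendsto_divide_at_top[OF tendsto_const T(2)])
      show "\<forall>\<^sub>F n in sequentially. 0 < k * rad 1 s / T n" using k r T0 by (intro always_eventually) auto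
    qed
    from filterlim_compose[OF hankel1_small(2) this]
    have h: "(\<lambda>n. of_real (k / T n * rad 1 s) * hankel1 1 (k / T n * rad 1 s)) \<longlonglongrightarrow> - 2 * \<i> / pi"
      by (simp add: mult_ac)
    have "1 + s\<^sup>2 \<noteq> 0" using zero_le_power2[of s] by linarith
    then have "complex_of_real (1 + s\<^sup>2) \<noteq> 0" by (simp only: of_real_eq_0_iff) simp
    then have "(\<lambda>n. g n s) \<longlonglongrightarrow> - (- 2 * \<i> / pi) / of_real (1 + s\<^sup>2) * L"
      unfolding geq by (intro tendsto_intros h lim)
    then show ?thesis by (simp add: field_simps)
  qed
  have gint: "integrable lborel (g n)" for n
    by (rule Bochner_Integration.integrable_bound[OF wi gm]) (use gb in \<open>auto intro!: AE_I2 order_trans[OF _ abs_ge_self]\<close>)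
  show fi: "integrable lborel (\<lambda>t. of_real (1 / T n) * wave_d k (1 / T n) t * W n t)" for n
  proof -
    have "integrable lborel (\<lambda>s. of_real (T n) * g n s)" using gint by (rule integrable_mult_right)
    then have "integrable lborel (\<lambda>s. f n (0 + 1 / T n * s))"
      using T0[of n] by (simp add: g_def)
    from lborel_integrable_real_affine[OF this, of "T n" 0] show ?thesis
      using T0[of n] by (simp add: f_def)
  qed
  have "(LINT s|lborel. g n s) = (LINT t|lborel. f n t)" for n
    using lborel_integral_real_affine[of "1 / T n" "f n" 0] T0[of n]
    by (simp add: g_def scaleR_conv_of_real)
  moreover have "(\<lambda>n. LINT s|lborel. g n s) \<longlonglongrightarrow> (LINT s|lborel. 2 * \<i> / pi * L * of_real (1 / (1 + s\<^sup>2)))"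
    by (rule integral_dominated_convergence[OF _ gm wi]) (use gb glim in auto)
  moreover have "(LINT s|lborel. 2 * \<i> / pi * L * of_real (1 / (1 + s\<^sup>2))) = 2 * \<i> * L"
    by (subst integral_mult_right_zero, subst integral_complex_of_real) (simp add: integral_inverse_quad)
  ultimately show "(\<lambda>n. LINT t|lborel. of_real (1 / T n) * wave_d k (1 / T n) t * W n t) \<longlonglongrightarrow> 2 * \<i> * L"
    by (simp add: f_def)
qed

section \<open>Green's identity with a reflected source\<close>

lemma half_plane_kernel_wave_d:
  "half_plane_kernel k x y = - (\<i> / 2) * (of_real x * wave_d k x y)"
  by (simp add: half_plane_kernel_def wave_d_def norm_pair_rad field_simps)

text \<open>Independent of \<open>a\<close>: the bound stays integrable in \<open>b\<close> even as
  the line of integration approaches the source.\<close>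

lemma wave_bound: "k > 0 \<Longrightarrow> b \<noteq> 0 \<Longrightarrow> norm (wave k a b) \<le> 2 * k powr (-1/2) * \<bar>b\<bar> powr (-1/2)"
proof -
  assume k: "k > 0" and b: "b \<noteq> 0"
  have r: "rad a b > 0" using b rad_pos by blast
  have "norm (wave k a b) \<le> 2 * (k * rad a b) powr (-1/2)"
    unfolding wave_def using k r by (intro hankel1_0_bound) simp
  also have "\<dots> = 2 * k powr (-1/2) * rad a b powr (-1/2)" using k r by (simp add: powr_mult)
  also have "\<dots> \<le> 2 * k powr (-1/2) * \<bar>b\<bar> powr (-1/2)"
    using b abs_le_rad(2)[of b a] by (intro mult_left_mono powr_mono2') auto
  finally show ?thesis .
qed

text \<open>Put a second source at the target (x1, x2) and, alternatively, at its mirror image. On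
  the boundary these two waves have equal values and opposite normal derivatives, so the difference
  of the two fluxes is a multiple of the kernel against the trace. The mirror flux is zero, both its
  sources lying left of the boundary; the other flux is the jump across the target.\<close>

lemma point_source_representation:
  assumes k: "k > 0" and p1: "p1 < 0" and x1: "x1 > 0"
  shows "integrable lborel (\<lambda>t. half_plane_kernel k x1 (x2 - t) * wave k (- p1) (t - p2))"
    and "(LINT t|lborel. half_plane_kernel k x1 (x2 - t) * wave k (- p1) (t - p2)) = wave k (x1 - p1) (x2 - p2)"
proof -
  let ?F = "\<lambda>q1 s t. flux1 k (s - p1) (t - p2) (s - q1) (t - x2)"
  have even: "wave_d k (- a) b = wave_d k a b" "wave k (- a) b = wave k a b" "wave_d k a (- b) = wave_d k a b" for a b
    by (simp_all add: wave_d_def wave_def rad_def)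
  have i0: "integrable lborel (?F x1 0)" "integrable lborel (?F (- x1) 0)"
    by (rule flux_integrable[OF k]; use x1 p1 in simp)+
  \<comment> \<open>The difference leaves - 2 x1 \<open>wave_d\<close> times the trace, and x1
    \<open>wave_d\<close> is 2 \<i> times the kernel.\<close>
  have kw: "?F x1 0 t - ?F (- x1) 0 t = - 4 * \<i> * (half_plane_kernel k x1 (x2 - t) * wave k (- p1) (t - p2))" for t
    using even(3)[of x1 "t - x2"] by (simp add: flux1_def half_plane_kernel_wave_d even algebra_simps)
  have i1: "integrable lborel (\<lambda>t. - 4 * \<i> * (half_plane_kernel k x1 (x2 - t) * wave k (- p1) (t - p2)))"
    unfolding kw[symmetric] using i0 by (rule Bochner_Integration.integrable_diff)
  from integrable_mult_right[OF this, of "\<i> / 4"]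
  show "integrable lborel (\<lambda>t. half_plane_kernel k x1 (x2 - t) * wave k (- p1) (t - p2))"
    by simp
  have "flux_line k p1 p2 x1 x2 0 - flux_line k p1 p2 (- x1) x2 0
      = - 4 * \<i> * (LINT t|lborel. half_plane_kernel k x1 (x2 - t) * wave k (- p1) (t - p2))"
    unfolding flux_line_def Bochner_Integration.integral_diff[OF i0, symmetric] kw by simp
  moreover have "flux_line k p1 p2 (- x1) x2 0 = 0"
    using flux_line_zero[OF k, of p1 0 "- x1"] p1 x1 by simp
  ultimately have u: "flux_line k p1 p2 x1 x2 0 = - 4 * \<i> * (LINT t|lborel. half_plane_kernel k x1 (x2 - t) * wave k (- p1) (t - p2))"
    by simp
  \<comment> \<open>Large enough that 1 / T n < x1 for every n, so the left of the two lines stays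
    between the boundary and the target.\<close>
  define N where "N = 1 + 1 / x1"
  define T where "T = (\<lambda>n. real n + N)"
  define w where "w = (\<lambda>s t. wave k (s - p1) (t - p2))"
  define v where "v = (\<lambda>s t. of_real (s - p1) * wave_d k (s - p1) (t - p2))"
  \<comment> \<open>\<open>A\<close> collects the normal derivatives of the wave from the target,
    opposite on the two sides, and concentrates to a point mass. \<open>B\<close> collects its
    values, equal on the two sides, against the jump of a continuous function, and vanishes in the
    limit.\<close>
  define A where "A = (\<lambda>n t. of_real (1 / T n) * wave_d k (1 / T n) t * (w (x1 - 1 / T n) (x2 + t) + w (x1 + 1 / T n) (x2 + t)))"
  define B where "B = (\<lambda>n t. wave k (1 / T n) t * (v (x1 - 1 / T n) (x2 + t) - v (x1 + 1 / T n) (x2 + t)))"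
  have N: "N \<ge> 1" "N > 1 / x1" using x1 by (auto simp: N_def)
  have T1: "T n \<ge> 1" for n using N by (simp add: T_def)
  have T0: "T n > 0" for n using T1[of n] by linarith
  have Td: "1 / T n < x1" for n
  proof -
    have "1 / x1 < T n" using N by (simp add: T_def)
    then show ?thesis using x1 T0[of n] by (simp add: field_simps)
  qed
  have Ttop: "filterlim T at_top sequentially" unfolding T_def by real_asymp
  have Tz: "(\<lambda>n. 1 / T n) \<longlonglongrightarrow> 0" by (rule real_tendsto_divide_at_top[OF tendsto_const Ttop])
  have T0': "1 / T n > 0" for n using T0[of n] by simp
  have spos: "x1 - 1 / T n - p1 > - p1" "x1 + 1 / T n - p1 > - p1" "x1 - 1 / T n - p1 > 0" "x1 + 1 / T n - p1 > 0" for n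
    using Td[of n] T0'[of n] x1 p1 by linarith+
  have spos2: "0 < x1 - 1 / T n" "x1 - 1 / T n < 2 * x1" "0 < x1 + 1 / T n" "x1 + 1 / T n < 2 * x1" for n
    using Td[of n] T0'[of n] x1 by linarith+
  have cw: "isCont (\<lambda>t. w (f t) (g t)) t" and cv: "isCont (\<lambda>t. v (f t) (g t)) t"
    if "isCont f t" "isCont g t" "f t - p1 > 0" for f g :: "real \<Rightarrow> real" and t
    unfolding w_def v_def using that by (intro continuous_intros isCont_wave[OF k]; simp)+
  have jump: "flux_line k p1 p2 x1 x2 0 = (LINT t|lborel. - A n t - B n t)" for n
  proof -
    have "flux_line k p1 p2 x1 x2 0 = flux_line k p1 p2 x1 x2 (x1 - 1 / T n)"
      using flux_line_const[OF k, of 0 "x1 - 1 / T n" p1 x1] Td[of n] T0'[of n] p1 by simp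
    moreover have "flux_line k p1 p2 x1 x2 (x1 + 1 / T n) = 0"
      using flux_line_zero[OF k, of p1 "x1 + 1 / T n" x1] T0'[of n] p1 x1 by simp
    ultimately have "flux_line k p1 p2 x1 x2 0 = flux_line k p1 p2 x1 x2 (x1 - 1 / T n) - flux_line k p1 p2 x1 x2 (x1 + 1 / T n)"
      by simp
    also have "\<dots> = (LINT t|lborel. ?F x1 (x1 - 1 / T n) t - ?F x1 (x1 + 1 / T n) t)"
      unfolding flux_line_def using Td[of n] T0'[of n] T0[of n] p1 x1 spos[of n]
      by (intro Bochner_Integration.integral_diff[symmetric] flux_integrable[OF k]) auto
    also have "\<dots> = (LINT t|lborel. ?F x1 (x1 - 1 / T n) (x2 + 1 * t) - ?F x1 (x1 + 1 / T n) (x2 + 1 * t))"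
      by (subst lborel_integral_real_affine[of 1 _ x2]) simp_all
    also have "(\<lambda>t. ?F x1 (x1 - 1 / T n) (x2 + 1 * t) - ?F x1 (x1 + 1 / T n) (x2 + 1 * t)) = (\<lambda>t. - A n t - B n t)"
      using even[of "1 / T n"] by (auto simp: A_def B_def flux1_def w_def v_def fun_eq_iff algebra_simps)
    finally show ?thesis .
  qed
  \<comment> \<open>The wave from p is bounded on both lines, since they stay at distance more than
    - p1 from its source.\<close>
  obtain H where H: "H > 0"
    and H0: "\<And>r m. - p1 \<le> m \<Longrightarrow> m \<le> r \<Longrightarrow> norm (hankel1 0 (k * r)) \<le> H * m powr (-1/2)"
    using hankel_far_bounds[OF k, of "- p1"] p1 by (metis neg_0_less_iff_less)
  have wb: "norm (w s t) \<le> H * (- p1) powr (-1/2)" if "s > 0" for s t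
    unfolding w_def wave_def
    by (rule H0) (use that p1 abs_le_rad(1)[of "s - p1" "t - p2"] in auto)
  have wcont: "(\<lambda>n. w (x1 + c / T n) (x2 + s / T n)) \<longlonglongrightarrow> w x1 x2" for c s
  proof -
    have "isCont (\<lambda>\<delta>. w (x1 + c * \<delta>) (x2 + s * \<delta>)) 0"
      using x1 p1 by (intro cw continuous_intros) auto
    from isCont_tendsto_compose[OF this Tz] show ?thesis by simp
  qed
  have AW: "integrable lborel (A n)" "(\<lambda>n. LINT t|lborel. A n t) \<longlonglongrightarrow> 2 * \<i> * (w x1 x2 + w x1 x2)" for n
    unfolding A_def
  proof (atomize (full), intro conjI)
    let ?W = "\<lambda>n t. w (x1 - 1 / T n) (x2 + t) + w (x1 + 1 / T n) (x2 + t)"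
    have Wm: "?W n \<in> borel_measurable borel" for n
      using spos[of n] by (intro borel_measurable_isCont continuous_intros cw) auto
    have Wb: "norm (?W n t) \<le> H * (- p1) powr (-1/2) + H * (- p1) powr (-1/2)" for n t
    proof (intro norm_triangle_mono wb)
      show "0 < x1 - 1 / T n" "0 < x1 + 1 / T n" using Td[of n] T0'[of n] x1 by linarith+
    qed
    have Wl: "(\<lambda>n. ?W n (s / T n)) \<longlonglongrightarrow> w x1 x2 + w x1 x2" for s
      using tendsto_add[OF wcont[of "-1" s] wcont[of 1 s]] by simp
    show "integrable lborel (\<lambda>t. of_real (1 / T n) * wave_d k (1 / T n) t * ?W n t)"
      by (rule kernel_approx_identity(1)[OF k T1 Ttop Wm Wb Wl])
    show "(\<lambda>n. LINT t|lborel. of_real (1 / T n) * wave_d k (1 / T n) t * ?W n t) \<longlonglongrightarrow> 2 * \<i> * (w x1 x2 + w x1 x2)"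
      by (rule kernel_approx_identity(2)[OF k T1 Ttop Wm Wb Wl])
  qed
  \<comment> \<open>Uniform decay of the other normal derivative: the squared distance from p is at
    least c (1 + t^2), and halving c allows (1 + |t|)^2 in its place.\<close>
  obtain c where c: "c > 0" "\<And>t. c * (1 + t\<^sup>2) \<le> (- p1)\<^sup>2 + (t - (p2 - x2))\<^sup>2"
    using quad_lower[of "- p1" "p2 - x2"] p1 by auto
  define c' where "c' = sqrt (c / 2)"
  have c': "c' > 0" using c by (simp add: c'_def)
  obtain H' where H': "H' > 0"
    and H1: "\<And>r m. c' \<le> m \<Longrightarrow> m \<le> r \<Longrightarrow> norm (hankel1 1 (k * r)) \<le> H' * m powr (-1/2)"
    using hankel_far_bounds[OF k c'] by metis
  define V where "V = k * (2 * x1 - p1) * H' * c' powr (-3/2)"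
  have V0: "V \<ge> 0" using k x1 p1 H' by (simp add: V_def)
  have vb: "norm (v s (x2 + t)) \<le> V * (1 + \<bar>t\<bar>) powr (-3/2)" if s: "0 < s" "s < 2 * x1" for s t
  proof -
    define m where "m = c' * (1 + \<bar>t\<bar>)"
    define r where "r = rad (s - p1) (x2 + t - p2)"
    have m0: "m > 0" using c' by (simp add: m_def add_pos_nonneg)
    have "m\<^sup>2 = c / 2 * (1 + \<bar>t\<bar>)\<^sup>2" using c by (simp add: m_def c'_def power_mult_distrib)
    also have "\<dots> \<le> c / 2 * (2 * (1 + t\<^sup>2))"
      using c zero_le_power2[of "1 - \<bar>t\<bar>"] by (intro mult_left_mono) (auto simp: power2_eq_square algebra_simps)
    also have "\<dots> \<le> (- p1)\<^sup>2 + (t - (p2 - x2))\<^sup>2" using c(2)[of t] by (simp add: algebra_simps)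
    also have "t - (p2 - x2) = x2 + t - p2" by simp
    also have "(- p1)\<^sup>2 + (x2 + t - p2)\<^sup>2 \<le> (s - p1)\<^sup>2 + (x2 + t - p2)\<^sup>2"
      using s p1 by (intro add_right_mono power_mono) auto
    finally have "m\<^sup>2 \<le> r\<^sup>2" by (simp add: r_def rad_sq)
    then have mr: "m \<le> r" unfolding r_def by (rule power2_le_imp_le) simp
    have mc: "c' \<le> m" using c' by (simp add: m_def)
    have "norm (v s (x2 + t)) = k * ((s - p1) / r) * norm (hankel1 1 (k * r))"
      unfolding v_def wave_d_def norm_mult norm_minus_cancel norm_of_real r_def using s p1 k by simp
    also have "\<dots> \<le> k * ((2 * x1 - p1) / m) * (H' * m powr (-1/2))"
      using k s p1 x1 mr m0 H1[OF mc mr] by (intro mult_mono frac_le) auto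
    also have "\<dots> = k * (2 * x1 - p1) * H' * (m powr (-1/2) / m)" by simp
    also have "m powr (-1/2) / m = m powr (-3/2)"
      using powr_diff[of m "-1/2" 1] m0 by simp
    also have "m powr (-3/2) = c' powr (-3/2) * (1 + \<bar>t\<bar>) powr (-3/2)"
      unfolding m_def using c' by (simp add: powr_mult)
    finally show ?thesis by (simp add: V_def)
  qed
  \<comment> \<open>The singularity |t|^(-1/2) of the wave is kept only for |t| <= 1 and the decay
    of the derivative only beyond; the sum dominates the product.\<close>
  define wB where "wB = (\<lambda>t. 4 * k powr (-1/2) * V * (indicator {..1} \<bar>t\<bar> * \<bar>t\<bar> powr (-1/2) + (1 + \<bar>t\<bar>) powr (-3/2)))"
  have wBi: "integrable lborel wB"
    unfolding wB_def using integrable_inverse_sqrt integrable_decay[of "3/2"]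
    by (intro integrable_mult_right Bochner_Integration.integrable_add) auto
  have nz: "AE t in lborel. t \<noteq> (0::real)" by (rule AE_lborel_singleton)
  have Bb: "norm (B n t) \<le> wB t" if t: "t \<noteq> 0" for n t
  proof -
    have "norm (B n t) \<le> (2 * k powr (-1/2) * \<bar>t\<bar> powr (-1/2)) * (V * (1 + \<bar>t\<bar>) powr (-3/2) + V * (1 + \<bar>t\<bar>) powr (-3/2))"
      unfolding B_def norm_mult
      using wave_bound[OF k t]
      by (intro mult_mono order_trans[OF norm_triangle_ineq4 add_mono] vb spos2) auto
    also have "\<dots> = 4 * k powr (-1/2) * V * (\<bar>t\<bar> powr (-1/2) * (1 + \<bar>t\<bar>) powr (-3/2))" by simp
    also have "\<dots> \<le> wB t"
      unfolding wB_def
    proof (rule mult_left_mono)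
      show "\<bar>t\<bar> powr (-1/2) * (1 + \<bar>t\<bar>) powr (-3/2) \<le> indicator {..1} \<bar>t\<bar> * \<bar>t\<bar> powr (-1/2) + (1 + \<bar>t\<bar>) powr (-3/2)"
      proof (cases "\<bar>t\<bar> \<le> 1")
        case True
        have "(1 + \<bar>t\<bar>) powr (-3/2) \<le> 1 powr (-3/2)" by (intro powr_mono2') auto
        then have "\<bar>t\<bar> powr (-1/2) * (1 + \<bar>t\<bar>) powr (-3/2) \<le> \<bar>t\<bar> powr (-1/2) * 1"
          by (intro mult_left_mono) auto
        then show ?thesis using True by (simp add: add_increasing2)
      next
        case False
        have "\<bar>t\<bar> powr (-1/2) \<le> 1 powr (-1/2)" using False by (intro powr_mono2') auto
        then have "\<bar>t\<bar> powr (-1/2) * (1 + \<bar>t\<bar>) powr (-3/2) \<le> 1 * (1 + \<bar>t\<bar>) powr (-3/2)"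
          by (intro mult_right_mono) auto
        then show ?thesis using False by simp
      qed
    qed (use V0 in simp)
    finally show ?thesis .
  qed
  have Bm: "B n \<in> borel_measurable lborel" for n
  proof -
    have "B n \<in> borel_measurable borel"
      unfolding B_def using T0'[of n] spos[of n]
      by (intro borel_measurable_isCont continuous_intros isCont_wave[OF k] cv) auto
    then show ?thesis by simp
  qed
  have Bi: "integrable lborel (B n)" for n
    by (rule Bochner_Integration.integrable_bound[OF wBi Bm])
       (use nz Bb in \<open>auto elim!: eventually_mono intro: order_trans[OF _ abs_ge_self]\<close>)
  have "(\<lambda>n. LINT t|lborel. B n t) \<longlonglongrightarrow> (LINT (t::real)|lborel. 0)"
  proof (rule integral_dominated_convergence[OF _ Bm wBi])
    show "AE t in lborel. (\<lambda>n. B n t) \<longlonglongrightarrow> 0"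
      using nz
    proof eventually_elim
      case (elim t)
      have "isCont (\<lambda>\<delta>. wave k \<delta> t * (v (x1 - \<delta>) (x2 + t) - v (x1 + \<delta>) (x2 + t))) 0"
        using elim x1 p1 by (intro continuous_intros isCont_wave[OF k] cv) auto
      from isCont_tendsto_compose[OF this Tz] show ?case by (simp add: B_def)
    qed
    show "AE t in lborel. norm (B n t) \<le> wB t" for n
      using nz by eventually_elim (rule Bb)
  qed simp
  then have Bl: "(\<lambda>n. LINT t|lborel. B n t) \<longlonglongrightarrow> 0" by simp
  have eq: "flux_line k p1 p2 x1 x2 0 = - (LINT t|lborel. A n t) - (LINT t|lborel. B n t)" for n
    unfolding jump[of n] using AW(1)[of n] Bi[of n] by simp
  have "(\<lambda>n. - (LINT t|lborel. A n t) - (LINT t|lborel. B n t)) \<longlonglongrightarrow> - (2 * \<i> * (w x1 x2 + w x1 x2)) - 0"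
    by (intro tendsto_intros AW(2) Bl)
  then have "flux_line k p1 p2 x1 x2 0 = - (2 * \<i> * (w x1 x2 + w x1 x2)) - 0"
    unfolding eq[symmetric] LIMSEQ_const_iff .
  then show "(LINT t|lborel. half_plane_kernel k x1 (x2 - t) * wave k (- p1) (t - p2)) = wave k (x1 - p1) (x2 - p2)"
    unfolding u w_def by (simp add: complex_eq_iff)
qed

section \<open>Potential of a decaying density\<close>

text \<open>Scaling t = x2 + x1 s. The exponent 2, the Poisson kernel, gives a constant total; 3/2
  gives a total growing like sqrt x1, which the decay of the density has to beat.\<close>

lemma kernel_power_integral:
  assumes e: "e > 1"
  obtains B where "B \<ge> 0"
    "\<And>x1 x2. x1 > 0 \<Longrightarrow> integrable lborel (\<lambda>t. x1 * rad x1 (x2 - t) powr (- e))"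
    "\<And>x1 x2. x1 > 0 \<Longrightarrow> (LINT t|lborel. x1 * rad x1 (x2 - t) powr (- e)) = B * x1 powr (2 - e)"
proof
  let ?g = "\<lambda>s. rad 1 s powr (- e)"
  have gi: "integrable lborel ?g"
  proof (rule Bochner_Integration.integrable_bound)
    show "integrable lborel (\<lambda>s. 2 powr e * (1 + \<bar>s\<bar>) powr (- e))"
      using integrable_decay[OF e] by (rule integrable_mult_right)
    show "?g \<in> borel_measurable lborel" unfolding rad_def by measurable
    show "AE s in lborel. norm (?g s) \<le> norm (2 powr e * (1 + \<bar>s\<bar>) powr (- e))"
    proof (rule AE_I2)
      fix s :: real
      have "?g s \<le> ((1 + \<bar>s\<bar>) / 2) powr (- e)"
        using rad_one_bounds(2)[of s] e by (intro powr_mono2') auto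
      also have "\<dots> = 2 powr e * (1 + \<bar>s\<bar>) powr (- e)"
        by (simp add: powr_divide powr_minus_divide)
      finally show "norm (?g s) \<le> norm (2 powr e * (1 + \<bar>s\<bar>) powr (- e))" by simp
    qed
  qed
  show "(LINT s|lborel. ?g s) \<ge> 0" by (rule Bochner_Integration.integral_nonneg) simp
  fix x1 x2 :: real assume x1: "x1 > 0"
  let ?f = "\<lambda>t. x1 * rad x1 (x2 - t) powr (- e)"
  have sc: "?f (x2 + x1 * s) = x1 powr (1 - e) * ?g s" for s
  proof -
    have "rad x1 (x2 - (x2 + x1 * s)) = x1 * rad 1 s"
      using rad_scale[of x1 1 s] x1 by (simp add: rad_def)
    moreover have "x1 * x1 powr (- e) = x1 powr (1 - e)"
      using x1 powr_add[of x1 1 "- e"] by simp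
    ultimately show ?thesis using x1 by (simp add: powr_mult mult.assoc)
  qed
  have "integrable lborel (\<lambda>s. ?f (x2 + x1 * s))"
    unfolding sc using gi by (rule integrable_mult_right)
  from lborel_integrable_real_affine[OF this, of "1 / x1" "- x2 / x1"]
  show "integrable lborel ?f" using x1 by (simp add: field_simps)
  have "(LINT t|lborel. ?f t) = x1 * (x1 powr (1 - e) * (LINT s|lborel. ?g s))"
    using lborel_integral_real_affine[of x1 ?f x2] x1 unfolding sc by simp
  moreover have "x1 * x1 powr (1 - e) = x1 powr (2 - e)"
    using x1 powr_add[of x1 1 "1 - e"] by simp
  ultimately show "(LINT t|lborel. ?f t) = (LINT s|lborel. ?g s) * x1 powr (2 - e)"
    by (simp flip: mult.assoc)
qed

text \<open>The two powers are the static kernel close to the boundary point and the radiating one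
  far from it, one for each term in the bound of z H1.\<close>

lemma kernel_bound:
  assumes k: "k > 0"
  obtains C where "C > 0"
    "\<And>x y. x > 0 \<Longrightarrow> norm (half_plane_kernel k x y) \<le> C * (x * rad x y powr (-2) + x * rad x y powr (-3/2))"
proof -
  obtain C where C: "C > 0" "\<And>z. z > 0 \<Longrightarrow> norm (of_real z * hankel1 1 z) \<le> C * (1 + sqrt z)"
    using hankel1_1_bound by metis
  show ?thesis
  proof
    show "C * (1 + sqrt k) > 0" using C k by (simp add: add_pos_pos)
    fix x y :: real assume x: "x > 0"
    define r where "r = rad x y"
    have r: "r > 0" using x by (simp add: r_def rad_pos)
    have "norm (half_plane_kernel k x y) = 1/2 * x * (norm (of_real (k * r) * hankel1 1 (k * r)) / r\<^sup>2)"
      using x r k by (simp add: half_plane_kernel_wave_d wave_d_def norm_mult norm_divide power2_eq_square flip: r_def)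
    also have "\<dots> \<le> 1 * x * (C * (1 + sqrt (k * r)) / r\<^sup>2)"
      using C(2)[of "k * r"] k r x by (intro mult_mono divide_right_mono) auto
    also have "\<dots> = C * (x * r powr (-2) + sqrt k * (x * r powr (-3/2)))"
    proof -
      have "1 / r\<^sup>2 = r powr (-2)" "sqrt r / r\<^sup>2 = r powr (-3/2)"
        using r powr_diff[of r "1/2" 2] by (simp_all add: powr_half_sqrt powr_numeral powr_minus_divide)
      moreover have "1 * x * (C * (1 + sqrt (k * r)) / r\<^sup>2) = C * (x * (1 / r\<^sup>2) + sqrt k * (x * (sqrt r / r\<^sup>2)))"
        using r by (simp add: real_sqrt_mult field_simps)
      ultimately show ?thesis by (simp only:)
    qed
    also have "\<dots> \<le> C * ((1 + sqrt k) * (x * r powr (-2)) + (1 + sqrt k) * (x * r powr (-3/2)))"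
      using C k x by (intro mult_left_mono add_mono) (auto simp: distrib_right)
    finally show "norm (half_plane_kernel k x y) \<le> C * (1 + sqrt k) * (x * rad x y powr (-2) + x * rad x y powr (-3/2))"
      by (simp add: r_def algebra_simps)
  qed
qed

lemma borel_lebesgue: "f \<in> borel_measurable borel \<Longrightarrow> f \<in> borel_measurable lebesgue"
  for f :: "real \<Rightarrow> 'a::topological_space"
  by (rule measurable_completion) simp

lemma kernel_measurable:
  assumes "k > 0" "x > 0"
  shows "(\<lambda>t. half_plane_kernel k x (y - t)) \<in> borel_measurable borel"
  unfolding half_plane_kernel_wave_d using assms
  by (intro borel_measurable_isCont continuous_intros isCont_wave) auto

lemma integrable_bounded_mult:
  fixes f g :: "real \<Rightarrow> complex"
  assumes "integrable lebesgue g" "f \<in> borel_measurable borel" "\<And>t. norm (f t) \<le> M"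
  shows "integrable lebesgue (\<lambda>t. f t * g t)"
proof (rule Bochner_Integration.integrable_bound)
  show "integrable lebesgue (\<lambda>t. M * norm (g t))"
    using assms(1) by (intro integrable_mult_right integrable_norm)
  show "(\<lambda>t. f t * g t) \<in> borel_measurable lebesgue"
    using borel_lebesgue[OF assms(2)] assms(1) by (intro borel_measurable_times) auto
  show "AE t in lebesgue. norm (f t * g t) \<le> norm (M * norm (g t))"
    using assms(3) by (auto intro!: AE_I2 mult_right_mono order_trans[OF _ abs_ge_self] simp: norm_mult)
qed

text \<open>The distance to the boundary line is at least x > 0, so for fixed target the kernel is
  bounded in t.\<close>

lemma kernel_integrable:
  assumes k: "k > 0" and x: "x > 0" and \<psi>: "integrable lebesgue \<psi>"
  shows "integrable lebesgue (\<lambda>t. half_plane_kernel k x (y - t) * \<psi> t)"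
proof -
  obtain C where C: "C > 0"
    "\<And>x y. x > 0 \<Longrightarrow> norm (half_plane_kernel k x y) \<le> C * (x * rad x y powr (-2) + x * rad x y powr (-3/2))"
    using kernel_bound[OF k] by metis
  have "norm (half_plane_kernel k x (y - t)) \<le> C * (x * x powr (-2) + x * x powr (-3/2))" for t
    using C(2)[OF x, of "y - t"] C(1) x abs_le_rad(1)[of x "y - t"]
    by (elim order_trans) (intro mult_left_mono add_mono powr_mono2', auto)
  then show ?thesis by (intro integrable_bounded_mult[OF \<psi>] kernel_measurable k x)
qed

lemma rad_shift: "rad x1 x2 - \<bar>t\<bar> \<le> rad x1 (x2 - t)" "rad x1 (x2 - t) \<le> rad x1 x2 + \<bar>t\<bar>"
proof -
  have z: "rad 0 s = \<bar>s\<bar>" for s by (simp add: rad_def)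
  show "rad x1 x2 - \<bar>t\<bar> \<le> rad x1 (x2 - t)" using rad_triangle[of x1 0 "x2 - t" t] z by simp
  show "rad x1 (x2 - t) \<le> rad x1 x2 + \<bar>t\<bar>" using rad_triangle[of x1 0 x2 "- t"] z by simp
qed

text \<open>The kernel is split at \<open>\<bar>t\<bar> = R / 2\<close>: close to the origin the kernel is small, and far
  away the density is.\<close>

lemma split_estimate:
  fixes \<psi> f :: "real \<Rightarrow> complex" and g :: "real \<Rightarrow> real"
  assumes \<psi>: "integrable lebesgue \<psi>" and R: "R \<ge> 2 * S" "R > 0" and q: "q \<ge> 0" and D: "D \<ge> 0"
    and dec: "AE t in lebesgue. \<bar>t\<bar> \<ge> S \<longrightarrow> norm (\<psi> t) \<le> D * \<bar>t\<bar> powr (- q)"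
    and h: "integrable lborel h" "\<And>t. h t \<ge> 0"
    and g: "integrable lebesgue (\<lambda>t. g t * norm (\<psi> t))" "\<And>t. g t \<ge> 0"
    and near: "\<And>t. \<bar>t\<bar> < R / 2 \<Longrightarrow> norm (f t) \<le> g t"
    and far: "\<And>t. \<bar>t\<bar> \<ge> R / 2 \<Longrightarrow> norm (f t) \<le> h t"
    and fi: "integrable lebesgue (\<lambda>t. f t * \<psi> t)"
  shows "norm (LINT t|lebesgue. f t * \<psi> t) \<le> (LINT t|lebesgue. g t * norm (\<psi> t)) + D * (R / 2) powr (- q) * (LINT t|lborel. h t)"
proof -
  have hl: "integrable lebesgue h" "(LINT t|lebesgue. h t) = (LINT t|lborel. h t)"
    using h integrable_completion[of h lborel] integral_completion[of h lborel] by auto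
  have "norm (LINT t|lebesgue. f t * \<psi> t) \<le> (LINT t|lebesgue. norm (f t * \<psi> t))"
    by (rule integral_norm_bound)
  also have "\<dots> \<le> (LINT t|lebesgue. g t * norm (\<psi> t) + D * (R / 2) powr (- q) * h t)"
  proof (rule integral_mono_AE)
    show "integrable lebesgue (\<lambda>t. norm (f t * \<psi> t))" using fi by (rule integrable_norm)
    show "integrable lebesgue (\<lambda>t. g t * norm (\<psi> t) + D * (R / 2) powr (- q) * h t)"
      using g hl by (intro Bochner_Integration.integrable_add integrable_mult_right) auto
    show "AE t in lebesgue. norm (f t * \<psi> t) \<le> g t * norm (\<psi> t) + D * (R / 2) powr (- q) * h t"
      using dec
    proof eventually_elim
      case (elim t)
      show ?case
      proof (cases "\<bar>t\<bar> < R / 2")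
        case True
        then have "norm (f t * \<psi> t) \<le> g t * norm (\<psi> t)"
          unfolding norm_mult using near by (intro mult_right_mono) auto
        then show ?thesis using D h(2)[of t] by (simp add: add_increasing2)
      next
        case False
        have "norm (\<psi> t) \<le> D * \<bar>t\<bar> powr (- q)" using elim False R by auto
        also have "\<dots> \<le> D * (R / 2) powr (- q)"
          using False R q D by (intro mult_left_mono powr_mono2') auto
        finally have "norm (f t * \<psi> t) \<le> h t * (D * (R / 2) powr (- q))"
          unfolding norm_mult using far[of t] False h(2)[of t] by (intro mult_mono) auto
        then show ?thesis using g(2)[of t] by (simp add: add_increasing mult.commute)
      qed
    qed
  qed
  also have "\<dots> = (LINT t|lebesgue. g t * norm (\<psi> t)) + D * (R / 2) powr (- q) * (LINT t|lborel. h t)"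
    using g hl by simp
  finally show ?thesis .
qed

text \<open>For |t| < R / 2 the distance is at least R / 2 and x1 <= R, so the kernel is of order
  R^(-1/2) against an integrable density. For |t| >= R / 2 the density contributes R^(-q) and the
  kernel a mass of order at most sqrt R; since q > 1, the product is at most of order
  R^(-1/2).\<close>

lemma potential_bound:
  assumes k: "k > 0" and \<psi>: "integrable lebesgue \<psi>" and q: "q > 1" and D: "D \<ge> 0"
    and dec: "AE t in lebesgue. \<bar>t\<bar> \<ge> S \<longrightarrow> norm (\<psi> t) \<le> D * \<bar>t\<bar> powr (- q)"
  obtains C where "C \<ge> 0"
    "\<And>x1 x2. x1 > 0 \<Longrightarrow> rad x1 x2 \<ge> 1 \<Longrightarrow> rad x1 x2 \<ge> 2 * S \<Longrightarrow>
      norm (LINT t|lebesgue. half_plane_kernel k x1 (x2 - t) * \<psi> t) \<le> C * rad x1 x2 powr (-1/2)"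
proof -
  obtain C where C: "C > 0"
    "\<And>x y. x > 0 \<Longrightarrow> norm (half_plane_kernel k x y) \<le> C * (x * rad x y powr (-2) + x * rad x y powr (-3/2))"
    using kernel_bound[OF k] by metis
  obtain B1 where B1: "B1 \<ge> 0"
    "\<And>x1 x2. x1 > 0 \<Longrightarrow> integrable lborel (\<lambda>t. x1 * rad x1 (x2 - t) powr (- 2))"
    "\<And>x1 x2. x1 > 0 \<Longrightarrow> (LINT t|lborel. x1 * rad x1 (x2 - t) powr (- 2)) = B1 * x1 powr (2 - 2)"
    using kernel_power_integral[of 2] by auto
  obtain B2 where B2: "B2 \<ge> 0"
    "\<And>x1 x2. x1 > 0 \<Longrightarrow> integrable lborel (\<lambda>t. x1 * rad x1 (x2 - t) powr (- (3/2)))"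
    "\<And>x1 x2. x1 > 0 \<Longrightarrow> (LINT t|lborel. x1 * rad x1 (x2 - t) powr (- (3/2))) = B2 * x1 powr (2 - 3/2)"
    using kernel_power_integral[of "3/2"] by auto
  define P where "P = (LINT t|lebesgue. norm (\<psi> t))"
  have P: "P \<ge> 0" by (simp add: P_def)
  show ?thesis
  proof
    show "8 * C * P + D * 2 powr q * C * (B1 + B2) \<ge> 0" using C P D B1 B2 by simp
    fix x1 x2 :: real assume x1: "x1 > 0" and R1: "rad x1 x2 \<ge> 1" and RS: "rad x1 x2 \<ge> 2 * S"
    define R where "R = rad x1 x2"
    have R: "R \<ge> 1" "R \<ge> 2 * S" "x1 \<le> R" using R1 RS abs_le_rad(1)[of x1 x2] x1 by (auto simp: R_def)
    define h where "h = (\<lambda>t. C * (x1 * rad x1 (x2 - t) powr (-2) + x1 * rad x1 (x2 - t) powr (- (3/2))))"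
    have hi: "integrable lborel h"
      unfolding h_def by (rule integrable_mult_right[OF Bochner_Integration.integrable_add[OF B1(2)[OF x1] B2(2)[OF x1]]])
    have hv: "(LINT t|lborel. h t) = C * (B1 + B2 * sqrt x1)"
      unfolding h_def using B1(2,3)[OF x1] B2(2,3)[OF x1] x1 by (simp add: powr_half_sqrt)
    \<comment> \<open>8 = 4 + 2^2, where 2^2 rounds up the factor 2^(3/2) from (R /
      2)^(-3/2).\<close>
    have near: "norm (half_plane_kernel k x1 (x2 - t)) \<le> 8 * C * R powr (-1/2)" if t: "\<bar>t\<bar> < R / 2" for t
    proof -
      have r: "R / 2 \<le> rad x1 (x2 - t)" using rad_shift(1)[of x1 x2 t] t by (simp add: R_def)
      have e: "R * (R / 2) powr (- a) = 2 powr a * R powr (1 - a)" for a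
        using R powr_diff[of R 1 a] by (simp add: powr_divide powr_minus_divide)
      have "norm (half_plane_kernel k x1 (x2 - t)) \<le> C * (x1 * rad x1 (x2 - t) powr (-2) + x1 * rad x1 (x2 - t) powr (-3/2))"
        using C(2)[OF x1] by simp
      also have "\<dots> \<le> C * (R * (R / 2) powr (-2) + R * (R / 2) powr (-(3/2)))"
        using C R x1 r by (intro mult_left_mono add_mono mult_mono) (auto intro!: powr_mono2')
      also have "\<dots> = C * (4 * R powr (-1) + 2 powr (3/2) * R powr (-1/2))"
        unfolding e by (simp add: powr_numeral)
      also have "\<dots> \<le> C * (4 * R powr (-1/2) + 2 powr 2 * R powr (-1/2))"
        using C R by (intro mult_left_mono add_mono mult_right_mono powr_mono) auto
      finally show ?thesis by (simp add: powr_numeral)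
    qed
    have "norm (LINT t|lebesgue. half_plane_kernel k x1 (x2 - t) * \<psi> t)
        \<le> (LINT t|lebesgue. 8 * C * R powr (-1/2) * norm (\<psi> t)) + D * (R / 2) powr (- q) * (LINT t|lborel. h t)"
    proof (rule split_estimate[OF \<psi> R(2) _ _ D dec hi])
      show "h t \<ge> 0" for t unfolding h_def using C x1 by (intro mult_nonneg_nonneg add_nonneg_nonneg) auto
      show "norm (half_plane_kernel k x1 (x2 - t)) \<le> h t" for t
        unfolding h_def using C(2)[OF x1] by simp
    qed (use R q C near k x1 \<psi> in \<open>auto intro!: kernel_integrable\<close>)
    also have "\<dots> = 8 * C * R powr (-1/2) * P + D * (2 powr q * R powr (- q)) * (C * (B1 + B2 * sqrt x1))"
      unfolding hv P_def using R by (simp add: powr_divide powr_minus_divide)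
    also have "\<dots> \<le> 8 * C * R powr (-1/2) * P + D * (2 powr q * R powr (- q)) * (C * ((B1 + B2) * sqrt R))"
    proof (intro add_left_mono mult_left_mono)
      have "B1 * 1 \<le> B1 * sqrt R" "B2 * sqrt x1 \<le> B2 * sqrt R"
        using B1 B2 R by (intro mult_left_mono; simp)+
      then show "B1 + B2 * sqrt x1 \<le> (B1 + B2) * sqrt R" by (simp add: distrib_right)
    qed (use C D in auto)
    also have "\<dots> = 8 * C * R powr (-1/2) * P + D * 2 powr q * C * (B1 + B2) * R powr (1/2 - q)"
      using R powr_diff[of R "1/2" q] by (simp add: powr_half_sqrt powr_minus_divide)
    also have "\<dots> \<le> 8 * C * R powr (-1/2) * P + D * 2 powr q * C * (B1 + B2) * R powr (-1/2)"
      using C D B1 B2 R q by (intro add_left_mono mult_left_mono powr_mono) auto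
    finally show "norm (LINT t|lebesgue. half_plane_kernel k x1 (x2 - t) * \<psi> t)
      \<le> (8 * C * P + D * 2 powr q * C * (B1 + B2)) * rad x1 x2 powr (-1/2)"
      by (simp add: R_def algebra_simps)
  qed
qed

section \<open>The radiation condition\<close>

text \<open>The projection of x - p on the direction of x is |x| up to a term of size at most |p|,
  and the length of x - p is at most |x| + |p|; so the cosine misses 1 by at most 2 |p| over that
  length.\<close>

lemma cos_defect:
  assumes R: "rad x1 x2 > 0" and r: "rad (x1 - p1) (x2 - p2) > 0"
  defines "c \<equiv> (x1 / rad x1 x2 * (x1 - p1) + x2 / rad x1 x2 * (x2 - p2)) / rad (x1 - p1) (x2 - p2)"
  shows "\<bar>c\<bar> \<le> 1" "\<bar>1 - c\<bar> \<le> 2 * rad p1 p2 / rad (x1 - p1) (x2 - p2)" "\<bar>1 - c\<bar> \<le> 2"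
proof -
  define n where "n = (x1 / rad x1 x2, x2 / rad x1 x2)"
  define \<rho> where "\<rho> = rad (x1 - p1) (x2 - p2)"
  have n1: "norm n = 1"
    using rad_scale[of "1 / rad x1 x2" x1 x2] R by (simp add: n_def norm_pair_rad)
  have CS: "\<bar>x1 / rad x1 x2 * a + x2 / rad x1 x2 * b\<bar> \<le> rad a b" for a b
    using Cauchy_Schwarz_ineq2[of n "(a, b)"] n1 by (simp add: n_def norm_pair_rad inner_prod_def)
  have c: "c * \<rho> = x1 / rad x1 x2 * (x1 - p1) + x2 / rad x1 x2 * (x2 - p2)"
    using r by (simp add: c_def \<rho>_def)
  have "\<bar>c\<bar> * \<rho> \<le> 1 * \<rho>"
    using CS[of "x1 - p1" "x2 - p2"] r by (simp add: \<rho>_def c_def)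
  then show c1: "\<bar>c\<bar> \<le> 1" using r by (simp add: \<rho>_def)
  then show "\<bar>1 - c\<bar> \<le> 2" by linarith
  have "x1 / rad x1 x2 * x1 + x2 / rad x1 x2 * x2 = rad x1 x2"
    using rad_sq[of x1 x2] R by (simp add: field_simps power2_eq_square)
  then have "c * \<rho> = rad x1 x2 - (x1 / rad x1 x2 * p1 + x2 / rad x1 x2 * p2)"
    unfolding c by (simp add: right_diff_distrib)
  moreover have "\<rho> \<le> rad x1 x2 + rad p1 p2"
    unfolding \<rho>_def using rad_triangle[of x1 "- p1" x2 "- p2"] by (simp add: rad_def)
  ultimately have "\<rho> - c * \<rho> \<le> 2 * rad p1 p2" using CS[of p1 p2] by linarith
  then have "(1 - c) * \<rho> \<le> 2 * rad p1 p2" by (simp add: algebra_simps)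
  then have "1 - c \<le> 2 * rad p1 p2 / \<rho>" using r by (simp add: \<rho>_def field_simps)
  then show "\<bar>1 - c\<bar> \<le> 2 * rad p1 p2 / rad (x1 - p1) (x2 - p2)" using c1 by (simp add: \<rho>_def)
qed

text \<open>Derivative of the half-plane kernel along (n1, n2); the first term comes from
  differentiating the prefactor \<open>a\<close>.\<close>

definition kernel_ray :: "real \<Rightarrow> real \<Rightarrow> real \<Rightarrow> real \<Rightarrow> real \<Rightarrow> complex" where
  "kernel_ray k n1 n2 a b = - (\<i> / 2) * (of_real n1 * wave_d k a b + of_real (a * (n1 * a + n2 * b)) * wave_dd k a b)"

lemma kernel_ray_deriv:
  assumes k: "k > 0" and r: "n1 * r > 0"
  shows "((\<lambda>r. half_plane_kernel k (n1 * r) (n2 * r - t)) has_vector_derivative kernel_ray k n1 n2 (n1 * r) (n2 * r - t)) (at r)"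
proof -
  have "rad (n1 * r - 0) (n2 * r - t) > 0" using r by (intro rad_pos) auto
  note D = hankel_ray_deriv(2)[OF k this, simplified]
  have I: "((\<lambda>r. complex_of_real (n1 * r)) has_vector_derivative of_real n1) (at r)"
    by (rule has_vector_derivative_of_real) (auto intro!: derivative_eq_intros)
  show ?thesis unfolding half_plane_kernel_wave_d
    by (rule has_vector_derivative_eq_rhs[OF has_vector_derivative_mult_right[OF has_vector_derivative_mult[OF I D]]])
       (simp add: kernel_ray_def algebra_simps)
qed

text \<open>The quotient is the cosine of the angle between the ray and the direction to the source.\<close>

lemma wave_ray_outgoing:
  assumes k: "k > 0" and \<delta>: "\<delta> > 0"
  obtains A where "A > 0"
    "\<And>n1 n2 a b. rad a b \<ge> \<delta> \<Longrightarrow> \<bar>(n1 * a + n2 * b) / rad a b\<bar> \<le> 1 \<Longrightarrow>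
      norm (wave_ray k n1 n2 a b - \<i> * of_real k * wave k a b)
       \<le> A * (rad a b powr (-1/2) * \<bar>1 - (n1 * a + n2 * b) / rad a b\<bar> + rad a b powr (-3/2))"
    "\<And>n1 n2 a b. a > 0 \<Longrightarrow> rad a b \<ge> \<delta> \<Longrightarrow> \<bar>(n1 * a + n2 * b) / rad a b\<bar> \<le> 1 \<Longrightarrow>
      norm (kernel_ray k n1 n2 a b - \<i> * of_real k * half_plane_kernel k a b)
       \<le> A * (rad a b powr (-3/2) * (\<bar>n1\<bar> + a * \<bar>1 - (n1 * a + n2 * b) / rad a b\<bar>) + a * rad a b powr (-5/2))"
proof -
  from hankel_far_bounds[OF assms] obtain A where A: "A > 0"
    and A0: "\<And>r m. \<delta> \<le> m \<Longrightarrow> m \<le> r \<Longrightarrow> norm (hankel1 0 (k * r)) \<le> A * m powr (-1/2)"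
    and A1: "\<And>r m. \<delta> \<le> m \<Longrightarrow> m \<le> r \<Longrightarrow> norm (hankel1 1 (k * r) + \<i> * hankel1 0 (k * r)) \<le> A * m powr (-3/2)"
    and A2: "\<And>r m. \<delta> \<le> m \<Longrightarrow> m \<le> r \<Longrightarrow> norm (hankel1 1 (k * r)) \<le> A * m powr (-1/2)"
    by blast
  define K where "K = (k + k\<^sup>2 + 2 * k) * A"
  have K: "k * A \<le> K" "k\<^sup>2 * A \<le> K" "2 * k * A + k\<^sup>2 * A \<le> K" "K > 0"
    using k A by (auto simp: K_def distrib_right add_pos_pos)
  show ?thesis
  proof
    show "K > 0" by (rule K)
    fix n1 n2 a b :: real
    assume r\<delta>: "rad a b \<ge> \<delta>" and c1: "\<bar>(n1 * a + n2 * b) / rad a b\<bar> \<le> 1"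
    define r where "r = rad a b"
    define c where "c = (n1 * a + n2 * b) / r"
    have r: "r > 0" "r \<ge> \<delta>" using r\<delta> \<delta> by (auto simp: r_def)
    have c: "\<bar>c\<bar> \<le> 1" using c1 by (simp add: c_def r_def)
    have cr: "n1 * a + n2 * b = c * r" using r by (simp add: c_def)
    define h0 where "h0 = hankel1 0 (k * r)"
    define h1 where "h1 = hankel1 1 (k * r)"
    define e where "e = h1 + \<i> * h0"
    have h1e: "h1 = e - \<i> * h0" by (simp add: e_def)
    have b0: "norm h0 \<le> A * r powr (-1/2)" and b1: "norm h1 \<le> A * r powr (-1/2)" and be: "norm e \<le> A * r powr (-3/2)"
      unfolding h0_def h1_def e_def using A0 A1 A2 r by auto
    have D: "wave_d k a b = - of_real (k / r) * h1" by (simp add: wave_d_def h1_def r_def)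
    have G: "wave k a b = h0" by (simp add: wave_def h0_def r_def)
    have DD: "wave_dd k a b = (- of_real (k\<^sup>2) * h0 + of_real (2 * k / r) * h1) / of_real (r\<^sup>2)"
      by (simp add: wave_dd_def h0_def h1_def r_def)
    \<comment> \<open>An exact splitting into the angular defect 1 - c and the outgoing remainder
      \<open>e\<close>.\<close>
    have "wave_ray k n1 n2 a b - \<i> * of_real k * wave k a b = of_real k * (- \<i> * of_real (1 - c) * h0 - of_real c * e)"
      unfolding wave_ray_def cr D G h1e using r by (simp add: field_simps)
    then have "norm (wave_ray k n1 n2 a b - \<i> * of_real k * wave k a b) = k * norm (- \<i> * of_real (1 - c) * h0 - of_real c * e)"
      using k by (simp only: norm_mult norm_of_real)
    also have "\<dots> \<le> k * (\<bar>1 - c\<bar> * (A * r powr (-1/2)) + 1 * (A * r powr (-3/2)))"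
    proof (rule mult_left_mono)
      have "norm (- \<i> * of_real (1 - c) * h0 - of_real c * e) \<le> norm (- \<i> * of_real (1 - c) * h0) + norm (of_real c * e)"
        by (rule norm_triangle_ineq4)
      also have "\<dots> = \<bar>1 - c\<bar> * norm h0 + \<bar>c\<bar> * norm e"
        by (simp only: norm_mult norm_of_real norm_minus_cancel norm_ii mult_1_left)
      also have "\<dots> \<le> \<bar>1 - c\<bar> * (A * r powr (-1/2)) + 1 * (A * r powr (-3/2))"
        using b0 be c A by (intro add_mono mult_mono) auto
      finally show "norm (- \<i> * of_real (1 - c) * h0 - of_real c * e) \<le> \<bar>1 - c\<bar> * (A * r powr (-1/2)) + 1 * (A * r powr (-3/2))" .
    qed (use k in simp)
    also have "\<dots> = k * A * (r powr (-1/2) * \<bar>1 - c\<bar> + r powr (-3/2))" by (simp add: algebra_simps)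
    also have "\<dots> \<le> K * (r powr (-1/2) * \<bar>1 - c\<bar> + r powr (-3/2))"
      using K by (intro mult_right_mono) auto
    finally show "norm (wave_ray k n1 n2 a b - \<i> * of_real k * wave k a b)
       \<le> K * (rad a b powr (-1/2) * \<bar>1 - (n1 * a + n2 * b) / rad a b\<bar> + rad a b powr (-3/2))"
      by (simp add: c_def r_def)
    assume a: "a > 0"
    have p32: "r powr (-1/2) / r = r powr (-3/2)" "r powr (-3/2) / r = r powr (-5/2)"
      using powr_diff[of r "-1/2" 1] powr_diff[of r "-3/2" 1] r by simp_all
    \<comment> \<open>Besides the defect and the remainder there are two terms in \<open>h1\<close>:
      one from the prefactor of the kernel, bounded through |n1|, and one of lower order from the
      derivative of H1 / r.\<close>
    have "kernel_ray k n1 n2 a b - \<i> * of_real k * half_plane_kernel k a b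
      = - (\<i> / 2) * (- of_real (n1 * k) * (h1 / of_real r) + of_real (a * k\<^sup>2 * (1 - c)) * (h0 / of_real r)
          + of_real (2 * a * k * c) * (h1 / of_real r / of_real r) + \<i> * of_real (a * k\<^sup>2) * (e / of_real r))"
      unfolding kernel_ray_def half_plane_kernel_wave_d cr D DD e_def using r
      by (simp add: field_simps power2_eq_square)
    then have "norm (kernel_ray k n1 n2 a b - \<i> * of_real k * half_plane_kernel k a b)
      = 1/2 * norm (- of_real (n1 * k) * (h1 / of_real r) + of_real (a * k\<^sup>2 * (1 - c)) * (h0 / of_real r)
          + of_real (2 * a * k * c) * (h1 / of_real r / of_real r) + \<i> * of_real (a * k\<^sup>2) * (e / of_real r))"
      by (simp only: norm_mult norm_minus_cancel norm_divide norm_ii norm_numeral)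
    also have "\<dots> \<le> 1 * (norm (- of_real (n1 * k) * (h1 / of_real r)) + norm (of_real (a * k\<^sup>2 * (1 - c)) * (h0 / of_real r))
          + norm (of_real (2 * a * k * c) * (h1 / of_real r / of_real r)) + norm (\<i> * of_real (a * k\<^sup>2) * (e / of_real r)))"
      by (intro mult_mono norm_triangle_mono norm_triangle_ineq order_refl) auto
    also have "\<dots> = \<bar>n1\<bar> * k * (norm h1 / r) + a * k\<^sup>2 * \<bar>1 - c\<bar> * (norm h0 / r)
          + 2 * a * k * \<bar>c\<bar> * (norm h1 / r / r) + a * k\<^sup>2 * (norm e / r)"
      using k a r by (simp only: norm_mult norm_minus_cancel norm_divide norm_ii norm_of_real abs_mult) simp
    also have "\<dots> \<le> \<bar>n1\<bar> * k * (A * r powr (-3/2)) + a * k\<^sup>2 * \<bar>1 - c\<bar> * (A * r powr (-3/2))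
          + 2 * a * k * 1 * (A * r powr (-5/2)) + a * k\<^sup>2 * (A * r powr (-5/2))"
    proof -
      have 1: "norm h1 / r \<le> A * r powr (-3/2)" "norm h0 / r \<le> A * r powr (-3/2)"
        unfolding p32(1)[symmetric] times_divide_eq_right using b0 b1 r by (intro divide_right_mono; simp)+
      have 3: "norm e / r \<le> A * r powr (-5/2)"
        unfolding p32(2)[symmetric] times_divide_eq_right using be r by (intro divide_right_mono; simp)
      have 2: "norm h1 / r / r \<le> A * r powr (-5/2)"
        unfolding p32(2)[symmetric] times_divide_eq_right using 1 r by (intro divide_right_mono) auto
      show ?thesis using 1 2 3 k a c A r by (intro add_mono mult_mono) auto
    qed
    also have "\<dots> = (k * A) * (\<bar>n1\<bar> * r powr (-3/2)) + (k\<^sup>2 * A) * (a * \<bar>1 - c\<bar> * r powr (-3/2)) + (2 * k * A + k\<^sup>2 * A) * (a * r powr (-5/2))"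
      by (simp add: algebra_simps)
    also have "\<dots> \<le> K * (\<bar>n1\<bar> * r powr (-3/2)) + K * (a * \<bar>1 - c\<bar> * r powr (-3/2)) + K * (a * r powr (-5/2))"
      using K a by (intro add_mono mult_right_mono) auto
    finally show "norm (kernel_ray k n1 n2 a b - \<i> * of_real k * half_plane_kernel k a b)
       \<le> K * (rad a b powr (-3/2) * (\<bar>n1\<bar> + a * \<bar>1 - (n1 * a + n2 * b) / rad a b\<bar>) + a * rad a b powr (-5/2))"
      by (simp add: c_def r_def algebra_simps)
  qed
qed

text \<open>The defect in the radiation condition tends to 0 pointwise in t against a fixed
  integrable density, so the near part is o(R^(-1/2)) by dominated convergence, without a rate. The
  far part is R^(-q) times a kernel mass of order sqrt R. The margin \<epsilon> from the boundary
  controls the remaining factor 1 / distance.\<close>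

lemma potential_radiation:
  assumes k: "k > 0" and \<psi>: "integrable lebesgue \<psi>" and q: "q > 1" and D: "D \<ge> 0"
    and dec: "AE t in lebesgue. \<bar>t\<bar> \<ge> S \<longrightarrow> norm (\<psi> t) \<le> D * \<bar>t\<bar> powr (- q)"
    and \<epsilon>: "\<epsilon> > 0"
  obtains \<eta> where "(\<eta> \<longlongrightarrow> 0) at_top"
    "\<And>x1 x2. x1 > \<epsilon> \<Longrightarrow> rad x1 x2 \<ge> 1 \<Longrightarrow> rad x1 x2 \<ge> 2 * S \<Longrightarrow>
      \<exists>d. ((\<lambda>r. LINT t|lebesgue. half_plane_kernel k (x1 / rad x1 x2 * r) (x2 / rad x1 x2 * r - t) * \<psi> t)
            has_vector_derivative d) (at (rad x1 x2)) \<and>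
        norm (d - \<i> * of_real k * (LINT t|lebesgue. half_plane_kernel k x1 (x2 - t) * \<psi> t))
          \<le> rad x1 x2 powr (-1/2) * \<eta> (rad x1 x2)"
proof -
  \<comment> \<open>Half of \<epsilon>, because differentiation uses the stretch r > R / 2 of the
    ray, where the first coordinate may be half as large.\<close>
  define \<delta> where "\<delta> = \<epsilon> / 2"
  have \<delta>: "\<delta> > 0" "\<delta> < \<epsilon>" using \<epsilon> by (auto simp: \<delta>_def)
  obtain A where A: "A > 0"
    and ray: "\<And>n1 n2 a b. a > 0 \<Longrightarrow> rad a b \<ge> \<delta> \<Longrightarrow> \<bar>(n1 * a + n2 * b) / rad a b\<bar> \<le> 1 \<Longrightarrow>
      norm (kernel_ray k n1 n2 a b - \<i> * of_real k * half_plane_kernel k a b)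
       \<le> A * (rad a b powr (-3/2) * (\<bar>n1\<bar> + a * \<bar>1 - (n1 * a + n2 * b) / rad a b\<bar>) + a * rad a b powr (-5/2))"
    using wave_ray_outgoing[OF k \<delta>(1)] by metis
  obtain C where C: "C > 0"
    "\<And>x y. x > 0 \<Longrightarrow> norm (half_plane_kernel k x y) \<le> C * (x * rad x y powr (-2) + x * rad x y powr (-3/2))"
    using kernel_bound[OF k] by metis
  obtain B where B: "B \<ge> 0"
    "\<And>x1 x2. x1 > 0 \<Longrightarrow> integrable lborel (\<lambda>t. x1 * rad x1 (x2 - t) powr (- (3/2)))"
    "\<And>x1 x2. x1 > 0 \<Longrightarrow> (LINT t|lborel. x1 * rad x1 (x2 - t) powr (- (3/2))) = B * x1 powr (2 - 3/2)"
    using kernel_power_integral[of "3/2"] by auto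
  \<comment> \<open>For |t| < R / 2 the distance is at least R / 2. So 3 / R collects 1 / R from the
    first coordinate of the direction and 2 / R from 1 / distance, and 4 |t| / R bounds the angular
    defect, capped by its trivial bound 2.\<close>
  define \<theta> where "\<theta> = (\<lambda>R t. (3 / R + min 2 (4 * \<bar>t\<bar> / R)) * norm (\<psi> t))"
  define \<Theta> where "\<Theta> = (\<lambda>R. LINT t|lebesgue. \<theta> R t)"
  define F where "F = D * 2 powr q * (A * (3 + 1 / \<delta>)) * B"
  define \<eta> where "\<eta> = (\<lambda>R. 4 * A * \<Theta> R + F * R powr (1 - q))"
  have \<psi>m: "\<psi> \<in> borel_measurable lebesgue" using \<psi> by auto
  have \<theta>m: "\<theta> R \<in> borel_measurable lebesgue" for R
  proof -
    have "(\<lambda>t::real. 3 / R + min 2 (4 * \<bar>t\<bar> / R)) \<in> borel_measurable borel" by measurable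
    from borel_lebesgue[OF this] show ?thesis unfolding \<theta>_def using \<psi>m by measurable
  qed
  have \<theta>b: "norm (\<theta> R t) \<le> 5 * norm (\<psi> t)" if "R \<ge> 1" for R t
  proof -
    have "3 / R \<le> 3 / 1" using that by (intro divide_left_mono) auto
    then have "3 / R + min 2 (4 * \<bar>t\<bar> / R) \<le> 5" by simp
    moreover have "3 / R + min 2 (4 * \<bar>t\<bar> / R) \<ge> 0" using that by (intro add_nonneg_nonneg) auto
    ultimately show ?thesis by (simp add: \<theta>_def abs_mult mult_right_mono)
  qed
  have \<psi>5: "integrable lebesgue (\<lambda>t. 5 * norm (\<psi> t))" using \<psi> by (intro integrable_mult_right integrable_norm)
  have "(\<Theta> \<longlongrightarrow> (LINT (t::real)|lebesgue. 0)) at_top"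
    unfolding \<Theta>_def
  proof (rule integral_dominated_convergence_at_top[OF _ \<theta>m \<psi>5])
    show "AE t in lebesgue. ((\<lambda>R. \<theta> R t) \<longlongrightarrow> 0) at_top"
    proof (rule AE_I2)
      fix t :: real
      have "((\<lambda>R::real. 3 / R) \<longlongrightarrow> 0) at_top" by real_asymp
      moreover have "((\<lambda>R::real. 4 * \<bar>t\<bar> / R) \<longlongrightarrow> 0) at_top" by real_asymp
      ultimately have "((\<lambda>R. (3 / R + min 2 (4 * \<bar>t\<bar> / R)) * norm (\<psi> t)) \<longlongrightarrow> (0 + min 2 0) * norm (\<psi> t)) at_top"
        by (intro tendsto_intros)
      then show "((\<lambda>R. \<theta> R t) \<longlongrightarrow> 0) at_top" by (simp add: \<theta>_def)
    qed
    show "\<forall>\<^sub>F R in at_top. AE t in lebesgue. norm (\<theta> R t) \<le> 5 * norm (\<psi> t)"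
      using eventually_ge_at_top[of 1] by eventually_elim (use \<theta>b in auto)
  qed simp
  then have \<Theta>0: "(\<Theta> \<longlongrightarrow> 0) at_top" by simp
  have "((\<lambda>R. R powr (1 - q)) \<longlongrightarrow> 0) at_top" using q by real_asymp
  with \<Theta>0 have "((\<lambda>R. 4 * A * \<Theta> R + F * R powr (1 - q)) \<longlongrightarrow> 4 * A * 0 + F * 0) at_top"
    by (intro tendsto_intros)
  then have \<eta>0: "(\<eta> \<longlongrightarrow> 0) at_top" by (simp add: \<eta>_def)
  show ?thesis
  proof (rule that[OF \<eta>0])
    fix x1 x2 :: real assume x1: "x1 > \<epsilon>" and R1: "rad x1 x2 \<ge> 1" and RS: "rad x1 x2 \<ge> 2 * S"
    define R where "R = rad x1 x2"
    define n1 where "n1 = x1 / R"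
    define n2 where "n2 = x2 / R"
    have x0: "x1 > 0" using x1 \<epsilon> by simp
    have R: "R \<ge> 1" "R \<ge> 2 * S" "x1 \<le> R" "R > 0" using R1 RS abs_le_rad(1)[of x1 x2] x0 by (auto simp: R_def)
    have n1: "n1 > 0" "n1 \<le> 1" using x0 R by (auto simp: n1_def)
    have n1R: "n1 * R = x1" "n2 * R = x2" using R by (auto simp: n1_def n2_def)
    have nn: "rad n1 n2 = 1"
      using rad_scale[of "1 / R" x1 x2] R by (simp add: n1_def n2_def R_def)
    have cd: "\<bar>(n1 * (n1 * r) + n2 * (n2 * r - t)) / rad (n1 * r) (n2 * r - t)\<bar> \<le> 1"
      "\<bar>1 - (n1 * (n1 * r) + n2 * (n2 * r - t)) / rad (n1 * r) (n2 * r - t)\<bar> \<le> 2 * \<bar>t\<bar> / rad (n1 * r) (n2 * r - t)"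
      "\<bar>1 - (n1 * (n1 * r) + n2 * (n2 * r - t)) / rad (n1 * r) (n2 * r - t)\<bar> \<le> 2" if r: "r > 0" for r t
    proof -
      have rr: "rad (n1 * r) (n2 * r) = r" using rad_scale[of r n1 n2] r nn by (simp add: mult.commute)
      have rz: "rad 0 t = \<bar>t\<bar>" by (simp add: rad_def)
      have pos: "rad (n1 * r) (n2 * r) > 0" "rad (n1 * r - 0) (n2 * r - t) > 0"
        using r n1 rr by (auto intro!: rad_pos)
      from cos_defect[OF pos] show "\<bar>(n1 * (n1 * r) + n2 * (n2 * r - t)) / rad (n1 * r) (n2 * r - t)\<bar> \<le> 1"
        "\<bar>1 - (n1 * (n1 * r) + n2 * (n2 * r - t)) / rad (n1 * r) (n2 * r - t)\<bar> \<le> 2 * \<bar>t\<bar> / rad (n1 * r) (n2 * r - t)"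
        "\<bar>1 - (n1 * (n1 * r) + n2 * (n2 * r - t)) / rad (n1 * r) (n2 * r - t)\<bar> \<le> 2"
        unfolding rr rz using r by simp_all
    qed
    \<comment> \<open>A crude bound on R / 2 < r < 2 R; it depends on R and serves only as the
      majorant for differentiating under the integral.\<close>
    define M where "M = A * (\<delta> powr (-3/2) * (1 + 2 * R * 2) + 2 * R * \<delta> powr (-5/2)) + k * (C * (2 * R * \<delta> powr (-2) + 2 * R * \<delta> powr (-3/2)))"
    have bnd: "norm (kernel_ray k n1 n2 (n1 * r) (n2 * r - t)) \<le> M" if r: "R / 2 < r" "r < 2 * R" for r t
    proof -
      define a where "a = n1 * r"
      define b where "b = n2 * r - t"
      have r0: "r > 0" using r R by simp
      have a0: "a > 0" using n1 r0 by (simp add: a_def)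
      have "x1 / 2 = n1 * (R / 2)" using n1R by simp
      also have "\<dots> \<le> a" unfolding a_def using n1 r by (intro mult_left_mono) auto
      finally have a\<delta>: "\<delta> \<le> a" using x1 by (simp add: \<delta>_def)
      have \<rho>: "\<delta> \<le> rad a b" using a\<delta> abs_le_rad(1)[of a b] by simp
      have aR: "a \<le> 2 * R" unfolding a_def using n1 r r0 mult_mono[of n1 1 r "2 * R"] by simp
      note c = cd[OF r0, of t, folded a_def b_def]
      have pm: "rad a b powr (- e) \<le> \<delta> powr (- e)" if "e \<ge> 0" for e
        using \<rho> \<delta> that by (intro powr_mono2') auto
      have "norm (kernel_ray k n1 n2 a b) \<le> norm (kernel_ray k n1 n2 a b - \<i> * of_real k * half_plane_kernel k a b)
          + norm (\<i> * of_real k * half_plane_kernel k a b)"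
        using norm_triangle_sub[of "kernel_ray k n1 n2 a b" "\<i> * of_real k * half_plane_kernel k a b"] by simp
      also have "\<dots> \<le> A * (rad a b powr (-3/2) * (\<bar>n1\<bar> + a * \<bar>1 - (n1 * a + n2 * b) / rad a b\<bar>) + a * rad a b powr (-5/2))
          + k * (C * (a * rad a b powr (-2) + a * rad a b powr (-3/2)))"
        using ray[OF a0 \<rho> c(1)] C(2)[OF a0, of b] k by (intro add_mono) (auto simp: norm_mult)
      also have "\<dots> \<le> M"
        unfolding M_def using A C k a0 aR R n1 c(3) pm[of "3/2"] pm[of "5/2"] pm[of 2]
        by (intro add_mono mult_left_mono mult_mono add_nonneg_nonneg mult_nonneg_nonneg) auto
      finally show ?thesis by (simp add: a_def b_def)
    qed
    let ?K = "\<lambda>t. half_plane_kernel k x1 (x2 - t)"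
    let ?Kr = "\<lambda>t. kernel_ray k n1 n2 x1 (x2 - t)"
    have der: "integrable lebesgue (\<lambda>t. kernel_ray k n1 n2 (n1 * R) (n2 * R - t) * \<psi> t)"
      "((\<lambda>r. LINT t|lebesgue. half_plane_kernel k (n1 * r) (n2 * r - t) * \<psi> t)
            has_vector_derivative (LINT t|lebesgue. kernel_ray k n1 n2 (n1 * R) (n2 * R - t) * \<psi> t)) (at R)"
    proof -
      have w: "integrable lebesgue (\<lambda>t. M * norm (\<psi> t))" using \<psi> by (intro integrable_mult_right integrable_norm)
      have lo: "R / 2 < R" "R < 2 * R" using R by auto
      have i: "integrable lebesgue (\<lambda>t. half_plane_kernel k (n1 * r) (n2 * r - t) * \<psi> t)" if "R / 2 < r" for r
        using that R n1 by (intro kernel_integrable[OF k _ \<psi>]) simp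
      have d: "((\<lambda>r. half_plane_kernel k (n1 * r) (n2 * r - t) * \<psi> t) has_vector_derivative
          kernel_ray k n1 n2 (n1 * r) (n2 * r - t) * \<psi> t) (at r)" if "R / 2 < r" for r t
        using that R n1 by (intro has_vector_derivative_mult_left kernel_ray_deriv[OF k]) simp
      have b: "norm (kernel_ray k n1 n2 (n1 * r) (n2 * r - t) * \<psi> t) \<le> M * norm (\<psi> t)" if "R / 2 < r" "r < 2 * R" for r t
        unfolding norm_mult using bnd[OF that] by (intro mult_right_mono) auto
      show "integrable lebesgue (\<lambda>t. kernel_ray k n1 n2 (n1 * R) (n2 * R - t) * \<psi> t)"
        by (rule has_vector_derivative_integral(1)[OF lo i d b w])
      show "((\<lambda>r. LINT t|lebesgue. half_plane_kernel k (n1 * r) (n2 * r - t) * \<psi> t)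
            has_vector_derivative (LINT t|lebesgue. kernel_ray k n1 n2 (n1 * R) (n2 * R - t) * \<psi> t)) (at R)"
        by (rule has_vector_derivative_integral(2)[OF lo i d b w])
    qed
    note der' = der[unfolded n1R]
    have Ki: "integrable lebesgue (\<lambda>t. ?K t * \<psi> t)" by (rule kernel_integrable[OF k x0 \<psi>])
    let ?f = "\<lambda>t. ?Kr t - \<i> * of_real k * ?K t"
    have eq: "?f t * \<psi> t = ?Kr t * \<psi> t - \<i> * of_real k * (?K t * \<psi> t)" for t
      by (simp add: algebra_simps)
    have fi: "integrable lebesgue (\<lambda>t. ?f t * \<psi> t)"
      unfolding eq using der'(1) Ki by (intro Bochner_Integration.integrable_diff integrable_mult_right)
    have fv: "(LINT t|lebesgue. ?f t * \<psi> t) = (LINT t|lebesgue. ?Kr t * \<psi> t) - \<i> * of_real k * (LINT t|lebesgue. ?K t * \<psi> t)"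
      unfolding eq using der'(1) Ki by simp
    have fb: "norm (?f t) \<le> A * (x1 * rad x1 (x2 - t) powr (-3/2)) * (1 / R + \<bar>1 - (n1 * x1 + n2 * (x2 - t)) / rad x1 (x2 - t)\<bar> + 1 / rad x1 (x2 - t))"
      and c2: "\<bar>1 - (n1 * x1 + n2 * (x2 - t)) / rad x1 (x2 - t)\<bar> \<le> 2 * \<bar>t\<bar> / rad x1 (x2 - t)"
      and c3: "\<bar>1 - (n1 * x1 + n2 * (x2 - t)) / rad x1 (x2 - t)\<bar> \<le> 2"
      and r\<delta>: "rad x1 (x2 - t) \<ge> \<delta>" for t
    proof -
      define \<rho> where "\<rho> = rad x1 (x2 - t)"
      define c where "c = (n1 * x1 + n2 * (x2 - t)) / \<rho>"
      show r\<delta>: "rad x1 (x2 - t) \<ge> \<delta>" using abs_le_rad(1)[of x1 "x2 - t"] x1 \<delta> by simp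
      note c' = cd[OF R(4), of t, unfolded n1R]
      show "\<bar>1 - (n1 * x1 + n2 * (x2 - t)) / rad x1 (x2 - t)\<bar> \<le> 2 * \<bar>t\<bar> / rad x1 (x2 - t)"
        "\<bar>1 - (n1 * x1 + n2 * (x2 - t)) / rad x1 (x2 - t)\<bar> \<le> 2" using c' by auto
      have \<rho>0: "\<rho> > 0" using r\<delta> \<delta> by (simp add: \<rho>_def)
      have "norm (?f t) \<le> A * (\<rho> powr (-3/2) * (\<bar>n1\<bar> + x1 * \<bar>1 - c\<bar>) + x1 * \<rho> powr (-5/2))"
        using ray[OF x0 r\<delta> c'(1)] by (simp add: \<rho>_def c_def)
      also have "\<rho> powr (-5/2) = \<rho> powr (-3/2) / \<rho>"
        using powr_diff[of \<rho> "-3/2" 1] \<rho>0 by simp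
      also have "\<bar>n1\<bar> = x1 / R" using x0 R by (simp add: n1_def)
      also have "A * (\<rho> powr (-3/2) * (x1 / R + x1 * \<bar>1 - c\<bar>) + x1 * (\<rho> powr (-3/2) / \<rho>))
        = A * (x1 * \<rho> powr (-3/2)) * (1 / R + \<bar>1 - c\<bar> + 1 / \<rho>)"
        by (simp add: algebra_simps)
      finally show "norm (?f t) \<le> A * (x1 * rad x1 (x2 - t) powr (-3/2)) * (1 / R + \<bar>1 - (n1 * x1 + n2 * (x2 - t)) / rad x1 (x2 - t)\<bar> + 1 / rad x1 (x2 - t))"
        by (simp add: \<rho>_def c_def)
    qed
    \<comment> \<open>\<open>g\<close> keeps the angular defect and is used for small t, where it
      tends to 0 after removal of R^(-1/2); \<open>h\<close> uses only that 1 / R plus the defect is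
      at most 3 and that 1 / distance is at most 1 / \<delta>.\<close>
    define g where "g = (\<lambda>t. 4 * A * R powr (-1/2) * (3 / R + min 2 (4 * \<bar>t\<bar> / R)))"
    define h where "h = (\<lambda>t. A * (3 + 1 / \<delta>) * (x1 * rad x1 (x2 - t) powr (- (3/2))))"
    have near: "norm (?f t) \<le> g t" if t: "\<bar>t\<bar> < R / 2" for t
    proof -
      define \<rho> where "\<rho> = rad x1 (x2 - t)"
      have r: "R / 2 \<le> \<rho>" using rad_shift(1)[of x1 x2 t] t by (simp add: R_def \<rho>_def)
      have 1: "x1 * \<rho> powr (-3/2) \<le> 4 * R powr (-1/2)"
      proof -
        have "x1 * \<rho> powr (-3/2) \<le> R * (R / 2) powr (-3/2)"
          using R r x0 by (intro mult_mono powr_mono2') auto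
        also have "\<dots> = 2 powr (3/2) * R powr (-1/2)"
          using R powr_diff[of R 1 "3/2"] by (simp add: powr_divide powr_minus_divide)
        also have "\<dots> \<le> 2 powr 2 * R powr (-1/2)"
          using R by (intro mult_right_mono powr_mono) auto
        finally show ?thesis by (simp add: powr_numeral)
      qed
      have "2 * \<bar>t\<bar> / \<rho> \<le> 2 * \<bar>t\<bar> / (R / 2)" "1 / \<rho> \<le> 1 / (R / 2)"
        using r R by (intro divide_left_mono; simp)+
      then have 2: "1 / R + \<bar>1 - (n1 * x1 + n2 * (x2 - t)) / rad x1 (x2 - t)\<bar> + 1 / \<rho> \<le> 3 / R + min 2 (4 * \<bar>t\<bar> / R)"
        using c2[of t] c3[of t] unfolding \<rho>_def[symmetric] by simp
      have "norm (?f t) \<le> A * (4 * R powr (-1/2)) * (3 / R + min 2 (4 * \<bar>t\<bar> / R))"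
      proof (rule order_trans[OF fb[of t, folded \<rho>_def] mult_mono])
        show "A * (x1 * \<rho> powr (-3/2)) \<le> A * (4 * R powr (-1/2))" using 1 A by (intro mult_left_mono) auto
        show "1 / R + \<bar>1 - (n1 * x1 + n2 * (x2 - t)) / \<rho>\<bar> + 1 / \<rho> \<le> 3 / R + min 2 (4 * \<bar>t\<bar> / R)"
          using 2 by (simp add: \<rho>_def)
      qed (use A R r in \<open>auto intro!: add_nonneg_nonneg\<close>)
      then show ?thesis by (simp add: g_def mult_ac)
    qed
    have far: "norm (?f t) \<le> h t" for t
    proof -
      have "1 / rad x1 (x2 - t) \<le> 1 / \<delta>" using r\<delta>[of t] \<delta> by (intro divide_left_mono) auto
      moreover have "1 / R \<le> 1" using R by simp
      ultimately have "1 / R + \<bar>1 - (n1 * x1 + n2 * (x2 - t)) / rad x1 (x2 - t)\<bar> + 1 / rad x1 (x2 - t) \<le> 3 + 1 / \<delta>"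
        using c3[of t] by linarith
      then have "norm (?f t) \<le> A * (x1 * rad x1 (x2 - t) powr (-3/2)) * (3 + 1 / \<delta>)"
        using fb[of t] A x0 by (elim order_trans) (intro mult_left_mono, auto)
      then show ?thesis by (simp add: h_def mult_ac)
    qed
    have hi: "integrable lborel h"
      unfolding h_def by (rule integrable_mult_right[OF B(2)[OF x0]])
    have hv: "(LINT t|lborel. h t) = A * (3 + 1 / \<delta>) * (B * sqrt x1)"
      unfolding h_def using B(3)[OF x0] x0 by (simp add: powr_half_sqrt)
    have gt: "g t * norm (\<psi> t) = 4 * A * R powr (-1/2) * \<theta> R t" for t
      by (simp add: g_def \<theta>_def)
    have \<theta>i: "integrable lebesgue (\<theta> R)"
      by (rule Bochner_Integration.integrable_bound[OF \<psi>5 \<theta>m]) (use \<theta>b[OF R(1)] in simp)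
    have "norm (LINT t|lebesgue. ?f t * \<psi> t) \<le> (LINT t|lebesgue. g t * norm (\<psi> t)) + D * (R / 2) powr (- q) * (LINT t|lborel. h t)"
    proof (rule split_estimate[OF \<psi> R(2,4) _ D dec hi _ _ _ near far fi])
      show "q \<ge> 0" using q by simp
      show "h t \<ge> 0" for t unfolding h_def using A \<delta> x0 by (intro mult_nonneg_nonneg add_nonneg_nonneg) auto
      show "integrable lebesgue (\<lambda>t. g t * norm (\<psi> t))" unfolding gt using \<theta>i by (rule integrable_mult_right)
      show "g t \<ge> 0" for t unfolding g_def using A R by (intro mult_nonneg_nonneg add_nonneg_nonneg) auto
    qed
    also have "\<dots> = 4 * A * R powr (-1/2) * \<Theta> R + D * (2 powr q * R powr (- q)) * (A * (3 + 1 / \<delta>) * (B * sqrt x1))"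
      unfolding gt hv \<Theta>_def using R by (simp add: powr_divide powr_minus_divide)
    also have "\<dots> \<le> 4 * A * R powr (-1/2) * \<Theta> R + D * (2 powr q * R powr (- q)) * (A * (3 + 1 / \<delta>) * (B * sqrt R))"
      using D A \<delta> B R by (intro add_left_mono mult_left_mono) auto
    also have "\<dots> = 4 * A * R powr (-1/2) * \<Theta> R + F * (R powr (- q) * sqrt R)"
      by (simp add: F_def)
    \<comment> \<open>After R^(-1/2) is split off, the surplus R^(1 - q) tends to 0 because q >
      1.\<close>
    also have "R powr (- q) * sqrt R = R powr (-1/2) * R powr (1 - q)"
      using R by (simp add: powr_half_sqrt[symmetric] flip: powr_add)
    also have "4 * A * R powr (-1/2) * \<Theta> R + F * (R powr (-1/2) * R powr (1 - q)) = R powr (-1/2) * \<eta> R"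
      by (simp add: \<eta>_def algebra_simps)
    finally have "norm ((LINT t|lebesgue. ?Kr t * \<psi> t) - \<i> * of_real k * (LINT t|lebesgue. ?K t * \<psi> t)) \<le> R powr (-1/2) * \<eta> R"
      unfolding fv .
    with der'(2) show "\<exists>d. ((\<lambda>r. LINT t|lebesgue. half_plane_kernel k (x1 / rad x1 x2 * r) (x2 / rad x1 x2 * r - t) * \<psi> t)
            has_vector_derivative d) (at (rad x1 x2)) \<and>
        norm (d - \<i> * of_real k * (LINT t|lebesgue. half_plane_kernel k x1 (x2 - t) * \<psi> t))
          \<le> rad x1 x2 powr (-1/2) * \<eta> (rad x1 x2)"
      unfolding n1_def n2_def R_def by blast
  qed
qed

text \<open>Once |x| >= 2 |p| the distance to the source is at least |x| / 2, so negative powers of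
  it are bounded by those of |x|. The angular defect is then of order 1 / |x|, which gains a full
  power.\<close>

lemma point_source_radiation:
  assumes k: "k > 0"
  obtains C where "C \<ge> 0"
    "\<And>x1 x2. rad x1 x2 \<ge> 1 \<Longrightarrow> rad x1 x2 \<ge> 2 * rad p1 p2 \<Longrightarrow> norm (wave k (x1 - p1) (x2 - p2)) \<le> C * rad x1 x2 powr (-1/2)"
    "\<And>x1 x2. rad x1 x2 \<ge> 1 \<Longrightarrow> rad x1 x2 \<ge> 2 * rad p1 p2 \<Longrightarrow>
      \<exists>d. ((\<lambda>r. wave k (x1 / rad x1 x2 * r - p1) (x2 / rad x1 x2 * r - p2)) has_vector_derivative d) (at (rad x1 x2)) \<and>
        norm (d - \<i> * of_real k * wave k (x1 - p1) (x2 - p2)) \<le> C * rad x1 x2 powr (-3/2)"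
proof -
  have \<delta>: "(1/2::real) > 0" by simp
  obtain A where A: "A > 0"
    and ray: "\<And>n1 n2 a b. rad a b \<ge> 1/2 \<Longrightarrow> \<bar>(n1 * a + n2 * b) / rad a b\<bar> \<le> 1 \<Longrightarrow>
      norm (wave_ray k n1 n2 a b - \<i> * of_real k * wave k a b)
       \<le> A * (rad a b powr (-1/2) * \<bar>1 - (n1 * a + n2 * b) / rad a b\<bar> + rad a b powr (-3/2))"
    using wave_ray_outgoing[OF k \<delta>] by metis
  obtain A' where A': "A' > 0" and H0: "\<And>r m. 1/2 \<le> m \<Longrightarrow> m \<le> r \<Longrightarrow> norm (hankel1 0 (k * r)) \<le> A' * m powr (-1/2)"
    using hankel_far_bounds[OF k \<delta>] by metis
  define P where "P = rad p1 p2"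
  define C where "C = 4 * A' + 4 * A * (2 * P + 1)"
  have P: "P \<ge> 0" by (simp add: P_def)
  have pw: "(R / 2) powr (- e) \<le> 4 * R powr (- e)" if "R > 0" "0 \<le> e" "e \<le> 2" for R e :: real
  proof -
    have "(R / 2) powr (- e) = 2 powr e * R powr (- e)" using that by (simp add: powr_divide powr_minus_divide)
    also have "\<dots> \<le> 2 powr 2 * R powr (- e)" using that by (intro mult_right_mono powr_mono) auto
    finally show ?thesis by (simp add: powr_numeral)
  qed
  show ?thesis
  proof
    show "C \<ge> 0" using A A' P by (simp add: C_def)
    fix x1 x2 assume R1: "rad x1 x2 \<ge> 1" and RP: "rad x1 x2 \<ge> 2 * rad p1 p2"
    define R where "R = rad x1 x2"
    define \<rho> where "\<rho> = rad (x1 - p1) (x2 - p2)"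
    have R: "R \<ge> 1" "R \<ge> 2 * P" using R1 RP by (auto simp: R_def P_def)
    have "R \<le> \<rho> + P" using rad_triangle[of "x1 - p1" p1 "x2 - p2" p2] by (simp add: R_def P_def \<rho>_def)
    then have \<rho>: "\<rho> \<ge> R / 2" using R by linarith
    have "norm (wave k (x1 - p1) (x2 - p2)) \<le> A' * (R / 2) powr (-1/2)"
      unfolding wave_def using R \<rho> by (intro H0) (auto simp: \<rho>_def)
    also have "\<dots> \<le> A' * (4 * R powr (-1/2))" using pw[of R "1/2"] A' R by (intro mult_left_mono) auto
    also have "\<dots> \<le> C * R powr (-1/2)" unfolding mult.assoc[symmetric] using A P by (intro mult_right_mono) (auto simp: C_def)
    finally show "norm (wave k (x1 - p1) (x2 - p2)) \<le> C * rad x1 x2 powr (-1/2)" by (simp add: R_def)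
    define n1 where "n1 = x1 / R"
    define n2 where "n2 = x2 / R"
    have n1R: "n1 * R = x1" "n2 * R = x2" using R by (auto simp: n1_def n2_def)
    have pos: "rad x1 x2 > 0" "rad (x1 - p1) (x2 - p2) > 0" using R \<rho> by (auto simp: R_def \<rho>_def)
    note cd = cos_defect[OF pos, folded R_def \<rho>_def P_def, folded n1_def n2_def]
    have "((\<lambda>r. wave k (n1 * r - p1) (n2 * r - p2)) has_vector_derivative wave_ray k n1 n2 (x1 - p1) (x2 - p2)) (at R)"
      using hankel_ray_deriv(1)[OF k, of n1 R p1 n2 p2] pos unfolding n1R by simp
    moreover have "norm (wave_ray k n1 n2 (x1 - p1) (x2 - p2) - \<i> * of_real k * wave k (x1 - p1) (x2 - p2)) \<le> C * R powr (-3/2)"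
    proof -
      have "norm (wave_ray k n1 n2 (x1 - p1) (x2 - p2) - \<i> * of_real k * wave k (x1 - p1) (x2 - p2))
        \<le> A * (\<rho> powr (-1/2) * \<bar>1 - (n1 * (x1 - p1) + n2 * (x2 - p2)) / \<rho>\<bar> + \<rho> powr (-3/2))"
        using ray[of "x1 - p1" "x2 - p2" n1 n2] cd(1) \<rho> R by (simp add: \<rho>_def)
      also have "\<dots> \<le> A * (\<rho> powr (-1/2) * (2 * P / \<rho>) + \<rho> powr (-3/2))"
        using cd(2) A by (intro mult_left_mono add_right_mono) auto
      also have "\<dots> = A * (2 * P + 1) * \<rho> powr (-3/2)"
        using powr_diff[of \<rho> "-1/2" 1] \<rho> R by (simp add: algebra_simps add_divide_distrib)
      also have "\<dots> \<le> A * (2 * P + 1) * (4 * R powr (-3/2))"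
      proof (rule mult_left_mono)
        have "\<rho> powr (-3/2) \<le> (R / 2) powr (-3/2)" using \<rho> R by (intro powr_mono2') auto
        then show "\<rho> powr (-3/2) \<le> 4 * R powr (-3/2)" using pw[of R "3/2"] R by simp
      qed (use A P in simp)
      also have "\<dots> = 4 * A * (2 * P + 1) * R powr (-3/2)" by simp
      also have "\<dots> \<le> C * R powr (-3/2)" using A' by (intro mult_right_mono) (auto simp: C_def)
      finally show ?thesis .
    qed
    ultimately show "\<exists>d. ((\<lambda>r. wave k (x1 / rad x1 x2 * r - p1) (x2 / rad x1 x2 * r - p2)) has_vector_derivative d) (at (rad x1 x2)) \<and>
        norm (d - \<i> * of_real k * wave k (x1 - p1) (x2 - p2)) \<le> C * rad x1 x2 powr (-3/2)"
      unfolding n1_def n2_def R_def by blast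
  qed
qed

section \<open>Boundary traces\<close>

lemma norm_exp_i_diff_le: "norm (exp (\<i> * of_real x) - exp (\<i> * of_real y)) \<le> \<bar>x - y\<bar>"
proof -
  have "norm (exp (\<i> * of_real x) - exp (\<i> * of_real y)) \<le> 1 * norm (x - y)"
  proof (rule differentiable_bound[of UNIV])
    fix z :: real
    have "((\<lambda>z. exp (\<i> * of_real z)) has_vector_derivative \<i> * exp (\<i> * of_real z)) (at z)"
      by (rule has_vector_derivative_real_field) (auto intro!: derivative_eq_intros)
    then show "((\<lambda>z. exp (\<i> * complex_of_real z)) has_derivative (\<lambda>h. h *\<^sub>R (\<i> * exp (\<i> * of_real z)))) (at z within UNIV)"
      by (simp add: has_vector_derivative_def)
    show "onorm (\<lambda>h. h *\<^sub>R (\<i> * exp (\<i> * complex_of_real z))) \<le> 1"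
      by (simp add: onorm_scaleR_left onorm_id norm_mult)
  qed auto
  then show ?thesis by simp
qed

text \<open>On a line at distance 1 from the source, the radius exceeds t - b by 1 / (radius + t -
  b), of order 1 / t. Phase and amplitude thus change by relative order 1 / t only, and in the
  leading term the height b appears solely through exp (- \<i> k b).\<close>

lemma trace_asymp:
  assumes k: "k > 0"
  obtains A :: complex where "A \<noteq> 0"
    "\<And>b. \<exists>C. \<forall>t \<ge> 2 * \<bar>b\<bar> + 1. norm (wave k 1 (t - b) - A * exp (- (\<i> * of_real (k * b))) *
        (exp (\<i> * of_real (k * t)) * of_real (t powr (-1/2)))) \<le> C * t powr (-3/2)"
proof -
  obtain A0 where A0: "A0 \<noteq> 0" and H: "\<And>z. z > 0 \<Longrightarrow>
    norm (hankel1 0 z - A0 * exp (\<i> * of_real z) * of_real (z powr (-1/2))) \<le> 2 * z powr (-3/2)"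
    using hankel1_0_asymp by metis
  define A where "A = A0 * of_real (k powr (-1/2))"
  show ?thesis
  proof
    show "A \<noteq> 0" using A0 k by (simp add: A_def)
    fix b :: real
    \<comment> \<open>The remainder of the Hankel expansion, the phase error and the amplitude
      error, in this order.\<close>
    define C where "C = 8 * k powr (-3/2) + norm A * (4 * k + 2 * (\<bar>b\<bar> + 2))"
    have "norm (wave k 1 (t - b) - A * exp (- (\<i> * of_real (k * b))) *
        (exp (\<i> * of_real (k * t)) * of_real (t powr (-1/2)))) \<le> C * t powr (-3/2)" if t: "t \<ge> 2 * \<bar>b\<bar> + 1" for t
    proof -
      define \<rho> where "\<rho> = rad 1 (t - b)"
      have t0: "t \<ge> 1" "t - b \<ge> t / 2" "t - b > 0" using t by auto
      have \<rho>: "\<rho> \<ge> t - b" "\<rho> > 0" using abs_le_rad(2)[of "t - b" 1] t0 by (auto simp: \<rho>_def)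
      have \<rho>2: "\<rho> \<ge> t / 2" using \<rho> t0 by linarith
      have pw: "\<rho> powr (- e) \<le> 2 powr e * t powr (- e)" if "e \<ge> 0" for e
      proof -
        have "\<rho> powr (- e) \<le> (t / 2) powr (- e)" using \<rho>2 t0 that by (intro powr_mono2') auto
        then show ?thesis using t0 by (simp add: powr_divide powr_minus_divide)
      qed
      have "(\<rho> - (t - b)) * (\<rho> + (t - b)) = \<rho>\<^sup>2 - (t - b)\<^sup>2" by (simp add: power2_eq_square algebra_simps)
      also have "\<dots> = 1" by (simp add: \<rho>_def rad_sq)
      finally have "\<rho> - (t - b) = 1 / (\<rho> + (t - b))" using \<rho> t0 by (simp add: field_simps)
      also have "\<dots> \<le> 1 / (t / 2)" using \<rho> t0 by (intro divide_left_mono) auto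
      finally have d1: "\<bar>\<rho> - (t - b)\<bar> \<le> 2 / t" using \<rho> by simp
      also have "\<dots> \<le> 2 / 1" using t0 by (intro divide_left_mono) auto
      finally have d2: "\<bar>t - \<rho>\<bar> \<le> \<bar>b\<bar> + 2" by linarith
      have e1: "norm (exp (\<i> * of_real (k * \<rho>)) - exp (\<i> * of_real (k * (t - b)))) \<le> 2 * k / t"
      proof -
        have "norm (exp (\<i> * of_real (k * \<rho>)) - exp (\<i> * of_real (k * (t - b)))) \<le> \<bar>k * \<rho> - k * (t - b)\<bar>"
          by (rule norm_exp_i_diff_le)
        also have "\<dots> = k * \<bar>\<rho> - (t - b)\<bar>" using k by (simp add: abs_mult flip: right_diff_distrib)
        also have "\<dots> \<le> k * (2 / t)" using d1 k by (intro mult_left_mono) auto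
        finally show ?thesis by (simp add: mult.commute)
      qed
      have r12: "\<rho> powr (-1/2) \<le> 2 * t powr (-1/2)"
      proof -
        have "2 powr (1/2) \<le> (2::real) powr 1" by (intro powr_mono) auto
        then have "2 powr (1/2) * t powr (-(1/2)) \<le> 2 * t powr (-(1/2))" by (intro mult_right_mono) auto
        then show ?thesis using pw[of "1/2"] by simp
      qed
      have t32: "t powr (-1/2) / t = t powr (-3/2)" using powr_diff[of t "-1/2" 1] t0 by simp
      have e2: "\<bar>\<rho> powr (-1/2) - t powr (-1/2)\<bar> \<le> 2 * (\<bar>b\<bar> + 2) * t powr (-3/2)"
      proof -
        define a where "a = sqrt \<rho>"
        define c where "c = sqrt t"
        have ac: "a > 0" "c > 0" "a * a = \<rho>" "c * c = t" using \<rho> t0 by (auto simp: a_def c_def)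
        have ia: "\<rho> powr (-1/2) = 1 / a" "t powr (-1/2) = 1 / c"
          using \<rho> t0 by (simp_all add: a_def c_def powr_half_sqrt powr_minus_divide)
        have "(c - a) * (c + a) = t - \<rho>" using ac by (simp add: algebra_simps)
        then have "\<bar>c - a\<bar> * (c + a) = \<bar>t - \<rho>\<bar>" using ac by (metis abs_mult abs_of_pos add_pos_pos)
        moreover have "\<bar>c - a\<bar> * c \<le> \<bar>c - a\<bar> * (c + a)" using ac by (intro mult_left_mono) auto
        ultimately have "\<bar>c - a\<bar> \<le> \<bar>t - \<rho>\<bar> / c" using ac by (simp add: field_simps)
        also have "\<dots> \<le> (\<bar>b\<bar> + 2) / c" using d2 ac by (intro divide_right_mono) auto
        finally have ca: "\<bar>c - a\<bar> \<le> (\<bar>b\<bar> + 2) / c" .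
        have "1 / a - 1 / c = (c - a) * (1 / a) * (1 / c)" using ac by (simp add: field_simps)
        then have "\<bar>1 / a - 1 / c\<bar> = \<bar>c - a\<bar> * (1 / a) * (1 / c)" using ac by (simp add: abs_mult)
        also have "\<dots> \<le> (\<bar>b\<bar> + 2) / c * (2 * (1 / c)) * (1 / c)"
          using ca r12 ac unfolding ia by (intro mult_mono) auto
        also have "\<dots> = 2 * (\<bar>b\<bar> + 2) * ((1 / c) / t)" using ac by (simp add: mult_ac flip: ac(4))
        finally show ?thesis unfolding ia[symmetric] t32 .
      qed
      have kp: "(k * \<rho>) powr (-1/2) = k powr (-1/2) * \<rho> powr (-1/2)" "(k * \<rho>) powr (-3/2) = k powr (-3/2) * \<rho> powr (-3/2)"
        using k \<rho> by (simp_all add: powr_mult)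
      have "norm (wave k 1 (t - b) - A0 * exp (\<i> * of_real (k * \<rho>)) * of_real ((k * \<rho>) powr (-1/2))) \<le> 2 * (k * \<rho>) powr (-3/2)"
        unfolding wave_def \<rho>_def[symmetric] using k \<rho> by (intro H) simp
      also have "\<dots> \<le> 2 * (k powr (-3/2) * (4 * t powr (-3/2)))"
      proof -
        have "2 powr (3/2) \<le> (2::real) powr 2" by (intro powr_mono) auto
        then have "2 powr (3/2) * t powr (-(3/2)) \<le> 4 * t powr (-(3/2))" by (intro mult_right_mono) (auto simp: powr_numeral)
        then show ?thesis unfolding kp using pw[of "3/2"] by (intro mult_left_mono) auto
      qed
      finally have n1: "norm (wave k 1 (t - b) - A * (exp (\<i> * of_real (k * \<rho>)) * of_real (\<rho> powr (-1/2)))) \<le> 8 * k powr (-3/2) * t powr (-3/2)"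
        unfolding kp A_def by (simp add: mult_ac)
      have ee: "exp (- (\<i> * of_real (k * b))) * exp (\<i> * of_real (k * t)) = exp (\<i> * of_real (k * (t - b)))"
        by (simp add: algebra_simps flip: exp_add)
      have "norm (exp (\<i> * of_real (k * \<rho>)) * of_real (\<rho> powr (-1/2)) - exp (\<i> * of_real (k * (t - b))) * of_real (t powr (-1/2)))
        = norm ((exp (\<i> * of_real (k * \<rho>)) - exp (\<i> * of_real (k * (t - b)))) * of_real (\<rho> powr (-1/2))
          + exp (\<i> * of_real (k * (t - b))) * of_real (\<rho> powr (-1/2) - t powr (-1/2)))"
        by (rule arg_cong[where f = norm]) (simp add: algebra_simps)
      also have "\<dots> \<le> norm (exp (\<i> * of_real (k * \<rho>)) - exp (\<i> * of_real (k * (t - b)))) * \<rho> powr (-1/2) + \<bar>\<rho> powr (-1/2) - t powr (-1/2)\<bar>"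
        by (rule order_trans[OF norm_triangle_ineq]) (simp only: norm_mult norm_of_real norm_exp_i_times mult_1_left, simp)
      also have "\<dots> \<le> 2 * k / t * (2 * t powr (-1/2)) + 2 * (\<bar>b\<bar> + 2) * t powr (-3/2)"
        using e1 e2 r12 k t0 by (intro add_mono mult_mono) auto
      also have "\<dots> = (4 * k + 2 * (\<bar>b\<bar> + 2)) * t powr (-3/2)"
        unfolding t32[symmetric] by (simp add: algebra_simps)
      finally have n2: "norm (exp (\<i> * of_real (k * \<rho>)) * of_real (\<rho> powr (-1/2)) - exp (\<i> * of_real (k * (t - b))) * of_real (t powr (-1/2)))
        \<le> (4 * k + 2 * (\<bar>b\<bar> + 2)) * t powr (-3/2)" .
      have "wave k 1 (t - b) - A * exp (- (\<i> * of_real (k * b))) * (exp (\<i> * of_real (k * t)) * of_real (t powr (-1/2)))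
        = (wave k 1 (t - b) - A * (exp (\<i> * of_real (k * \<rho>)) * of_real (\<rho> powr (-1/2))))
          + A * (exp (\<i> * of_real (k * \<rho>)) * of_real (\<rho> powr (-1/2)) - exp (\<i> * of_real (k * (t - b))) * of_real (t powr (-1/2)))"
        unfolding ee[symmetric] by (simp add: algebra_simps)
      also have "norm \<dots> \<le> 8 * k powr (-3/2) * t powr (-3/2) + norm A * ((4 * k + 2 * (\<bar>b\<bar> + 2)) * t powr (-3/2))"
        using n1 n2 by (intro norm_triangle_mono) (auto simp: norm_mult intro!: mult_left_mono)
      finally show ?thesis by (simp add: C_def algebra_simps)
    qed
    then show "\<exists>C. \<forall>t \<ge> 2 * \<bar>b\<bar> + 1. norm (wave k 1 (t - b) - A * exp (- (\<i> * of_real (k * b))) *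
        (exp (\<i> * of_real (k * t)) * of_real (t powr (-1/2)))) \<le> C * t powr (-3/2)" by blast
  qed
qed

text \<open>On [-S, S] the square-integrable part is integrable through |f| <= 1 + |f|^2 and the
  continuous part is bounded; outside, only the sum is estimated, by its decay.\<close>

lemma integrable_decomposition:
  fixes \<psi> f g :: "real \<Rightarrow> complex"
  assumes f: "square_integrable f" and g: "continuous_on UNIV g" and eq: "\<And>t. \<psi> t = f t + g t"
    and q: "q > 1" and S: "S \<ge> 1" and dec: "\<And>t. \<bar>t\<bar> \<ge> S \<Longrightarrow> norm (\<psi> t) \<le> D * \<bar>t\<bar> powr (- q)"
  shows "integrable lebesgue \<psi>"
proof -
  have gm: "g \<in> borel_measurable lebesgue"
    using g by (intro borel_lebesgue borel_measurable_continuous_onI)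
  have fm: "f \<in> borel_measurable lebesgue" and f2: "integrable lebesgue (\<lambda>t. (norm (f t))\<^sup>2)"
    using f by (auto simp: square_integrable_def)
  have \<psi>m: "\<psi> \<in> borel_measurable lebesgue"
    unfolding eq[abs_def] using fm gm by (rule borel_measurable_add)
  have "compact (g ` {-S..S})"
    by (rule compact_continuous_image) (use g in \<open>auto intro: continuous_on_subset\<close>)
  then obtain M where M: "\<And>t. \<bar>t\<bar> \<le> S \<Longrightarrow> norm (g t) \<le> M"
    using compact_imp_bounded bounded_iff by (metis (no_types, lifting) atLeastAtMost_iff abs_le_iff imageI minus_le_iff)
  have D: "D \<ge> 0"
    using order_trans[OF norm_ge_zero dec[of S]] S by (simp add: zero_le_mult_iff)
  have M0: "M \<ge> 0" using order_trans[OF norm_ge_zero M[of 0]] S by simp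
  define w where "w = (\<lambda>t. (norm (f t))\<^sup>2 + ((1 + M) * indicator {-S..S} t + D * 2 powr q * (1 + \<bar>t\<bar>) powr (- q)))"
  have "integrable lborel (indicator {-S..S} :: real \<Rightarrow> real)"
    by (rule integrable_real_indicator) (auto simp: emeasure_lborel_Icc_eq)
  then have "integrable lborel (\<lambda>t. (1 + M) * indicator {-S..S} t + D * 2 powr q * (1 + \<bar>t\<bar>) powr (- q))"
    using integrable_decay[OF q] by (intro Bochner_Integration.integrable_add integrable_mult_right)
  then have "integrable lebesgue (\<lambda>t. (1 + M) * indicator {-S..S} t + D * 2 powr q * (1 + \<bar>t\<bar>) powr (- q))"
    by (subst integrable_completion) auto
  with f2 have wi: "integrable lebesgue w"
    unfolding w_def by (rule Bochner_Integration.integrable_add)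
  show ?thesis
  proof (rule Bochner_Integration.integrable_bound[OF wi \<psi>m], rule AE_I2)
    fix t
    have "norm (\<psi> t) \<le> w t"
    proof (cases "\<bar>t\<bar> \<le> S")
      case True
      have "norm (f t) \<le> 1 + (norm (f t))\<^sup>2"
        using zero_le_power2[of "norm (f t) - 1/2"] by (simp add: power2_eq_square algebra_simps)
      moreover have "norm (\<psi> t) \<le> norm (f t) + norm (g t)" unfolding eq by (rule norm_triangle_ineq)
      ultimately have "norm (\<psi> t) \<le> (norm (f t))\<^sup>2 + (1 + M)" using M[OF True] by linarith
      also have "\<dots> \<le> w t" using True D by (auto simp: w_def indicator_def)
      finally show ?thesis .
    next
      case False
      have "norm (\<psi> t) \<le> D * \<bar>t\<bar> powr (- q)" using dec[of t] False by simp
      also have "\<dots> \<le> D * ((1 + \<bar>t\<bar>) / 2) powr (- q)"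
        using False S q D by (intro mult_left_mono powr_mono2') auto
      also have "\<dots> = D * 2 powr q * (1 + \<bar>t\<bar>) powr (- q)" by (simp add: powr_divide powr_minus_divide)
      also have "\<dots> \<le> w t" using M0 by (auto simp: w_def indicator_def)
      finally show ?thesis .
    qed
    then show "norm (\<psi> t) \<le> norm (w t)" by simp
  qed
qed

section \<open>Matching the sources to the density and assembling both estimates\<close>

theorem corollary3p4:
  fixes k p :: real
    and \<phi> \<phi>\<^sub>1 \<phi>\<^sub>2 :: "real \<Rightarrow> complex"
    and c\<^sub>p c\<^sub>m :: complex
    and u :: "real \<times> real \<Rightarrow> complex"
  assumes "k > 0"
    and "\<And>t. \<phi> t = \<phi>\<^sub>1 t + \<phi>\<^sub>2 t"
    and "square_integrable \<phi>\<^sub>1" and "compactly_supported \<phi>\<^sub>1"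
    and "continuous_on UNIV \<phi>\<^sub>2"
    and "p > 1"
    and "(\<lambda>t. \<phi> t - c\<^sub>p * exp (\<i> * of_real (k * \<bar>t\<bar>)) * of_real (\<bar>t\<bar> powr (-1/2)))
           \<in> O[at_top](\<lambda>t. of_real (\<bar>t\<bar> powr (-p)))"
    and "(\<lambda>t. \<phi> t - c\<^sub>m * exp (\<i> * of_real (k * \<bar>t\<bar>)) * of_real (\<bar>t\<bar> powr (-1/2)))
           \<in> O[at_bot](\<lambda>t. of_real (\<bar>t\<bar> powr (-p)))"
    and u_def: "u = half_plane_potential k \<phi>"
  shows "(\<exists>C>0. \<exists>R>0. \<forall>x. fst x > 0 \<and> norm x > R \<longrightarrow>
            norm (u x) \<le> C * (1 + norm x) powr (-1/2))
       \<and> (\<forall>\<epsilon>>0. ((\<lambda>R. ereal (R powr (1/2)) *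
                       (SUP x\<in>{x. fst x > \<epsilon> \<and> norm x = R}.
                          ereal (norm (radial_deriv u x - \<i> * of_real k * u x))))
                   \<longlongrightarrow> 0) at_top)"
proof -
  note k = assms(1)
  define E where "E = (\<lambda>t. exp (\<i> * of_real (k * t)) * complex_of_real (t powr (-1/2)))"
  obtain A where A: "A \<noteq> 0"
    and trace: "\<And>b. \<exists>C. \<forall>t \<ge> 2 * \<bar>b\<bar> + 1. norm (wave k 1 (t - b) - A * exp (- (\<i> * of_real (k * b))) * E t) \<le> C * t powr (-3/2)"
    unfolding E_def using trace_asymp[OF k] by metis
  \<comment> \<open>A quarter of the wavelength: k b = pi / 2, so the phase factors at the two ends
    are - \<i> and \<i>.\<close>
  define b where "b = pi / (2 * k)"
  have kb: "k * b = pi / 2" using k by (simp add: b_def)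
  have eb: "exp (- (\<i> * of_real (k * b))) = - \<i>" "exp (- (\<i> * of_real (k * (- b)))) = \<i>"
  proof -
    have "exp (\<i> * of_real (k * b)) = \<i>"
      unfolding kb by (simp only: cis_conv_exp[symmetric] cis_pi_half)
    then show "exp (- (\<i> * of_real (k * b))) = - \<i>" "exp (- (\<i> * of_real (k * (- b)))) = \<i>"
      by (simp_all add: exp_minus)
  qed
  \<comment> \<open>Solution of the two by two system matching the leading terms at the two ends; it
    exists because A is nonzero and the phase factors differ.\<close>
  define \<alpha> where "\<alpha> = (c\<^sub>p + c\<^sub>m) / (2 * A)"
  define \<beta> where "\<beta> = (c\<^sub>m - c\<^sub>p) / (2 * \<i> * A)"
  have ab: "\<alpha> * A + \<beta> * (A * - \<i>) = c\<^sub>p" "\<alpha> * A + \<beta> * (A * \<i>) = c\<^sub>m"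
    using A by (simp_all add: \<alpha>_def \<beta>_def field_simps)
  define \<psi> where "\<psi> = (\<lambda>t. \<phi> t - (\<alpha> * wave k 1 t + \<beta> * wave k 1 (t - b)))"
  \<comment> \<open>The traces are expanded only up to an error of order 3/2, which caps the decay
    of the remaining density.\<close>
  define q where "q = min p (3/2)"
  have q: "q > 1" "q \<le> p" "q \<le> 3/2" using assms(6) by (auto simp: q_def)
  obtain C0 where C0: "\<And>t. t \<ge> 1 \<Longrightarrow> norm (wave k 1 t - A * E t) \<le> C0 * t powr (-3/2)"
    using trace[of 0] by auto
  obtain C1 where C1: "\<And>t. t \<ge> 2 * \<bar>b\<bar> + 1 \<Longrightarrow> norm (wave k 1 (t - b) - A * - \<i> * E t) \<le> C1 * t powr (-3/2)"
    using trace[of b] unfolding eb by auto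
  obtain C2 where C2: "\<And>t. t \<ge> 2 * \<bar>b\<bar> + 1 \<Longrightarrow> norm (wave k 1 (t - (- b)) - A * \<i> * E t) \<le> C2 * t powr (-3/2)"
    using trace[of "- b"] unfolding eb abs_minus_cancel by auto
  obtain C3 where C3: "C3 > 0" "\<forall>\<^sub>F t in at_top. norm (\<phi> t - c\<^sub>p * exp (\<i> * of_real (k * \<bar>t\<bar>)) * of_real (\<bar>t\<bar> powr (-1/2)))
      \<le> C3 * norm (complex_of_real (\<bar>t\<bar> powr (-p)))"
    using landau_o.bigE[OF assms(7)] by blast
  then obtain S3 where S3: "\<And>t. t \<ge> S3 \<Longrightarrow> norm (\<phi> t - c\<^sub>p * exp (\<i> * of_real (k * \<bar>t\<bar>)) * of_real (\<bar>t\<bar> powr (-1/2)))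
      \<le> C3 * norm (complex_of_real (\<bar>t\<bar> powr (-p)))"
    unfolding eventually_at_top_linorder by blast
  obtain C4 where C4: "C4 > 0" "\<forall>\<^sub>F t in at_bot. norm (\<phi> t - c\<^sub>m * exp (\<i> * of_real (k * \<bar>t\<bar>)) * of_real (\<bar>t\<bar> powr (-1/2)))
      \<le> C4 * norm (complex_of_real (\<bar>t\<bar> powr (-p)))"
    using landau_o.bigE[OF assms(8)] by blast
  then obtain S4 where S4: "\<And>t. t \<le> S4 \<Longrightarrow> norm (\<phi> t - c\<^sub>m * exp (\<i> * of_real (k * \<bar>t\<bar>)) * of_real (\<bar>t\<bar> powr (-1/2)))
      \<le> C4 * norm (complex_of_real (\<bar>t\<bar> powr (-p)))"
    unfolding eventually_at_bot_linorder by blast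
  \<comment> \<open>Beyond S all five asymptotic estimates hold, including those for a source
    shifted by b in either direction.\<close>
  define S where "S = 1 + 2 * \<bar>b\<bar> + \<bar>S3\<bar> + \<bar>S4\<bar>"
  have S: "S \<ge> 1" "S \<ge> 2 * \<bar>b\<bar> + 1" "S \<ge> S3" "- S \<le> S4" by (auto simp: S_def)
  define D where "D = (C3 + C4) + norm \<alpha> * \<bar>C0\<bar> + norm \<beta> * (\<bar>C1\<bar> + \<bar>C2\<bar>)"
  have D: "D \<ge> 0" using C3 C4 by (simp add: D_def)
  have even: "wave k 1 (- t) = wave k 1 t" for t by (simp add: wave_def rad_def)
  have dec: "norm (\<psi> t) \<le> D * \<bar>t\<bar> powr (- q)" if t: "\<bar>t\<bar> \<ge> S" for t
  proof -
    define s where "s = \<bar>t\<bar>"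
    have s: "s \<ge> S" "s \<ge> 1" using t S by (auto simp: s_def)
    have pq: "s powr (- p) \<le> s powr (- q)" "s powr (-3/2) \<le> s powr (- q)"
      using q s by (intro powr_mono; simp)+
    \<comment> \<open>Both ends are treated together: only the constant \<open>c\<close> and the
      phase factor \<open>c'\<close> of the raised source depend on the sign of t. For t < 0,
      evenness turns a source at height b into one at height - b.\<close>
    obtain c c' C' where c: "norm (\<phi> t - c * E s) \<le> (C3 + C4) * s powr (- p)"
      and c': "norm (wave k 1 (t - b) - A * c' * E s) \<le> (\<bar>C1\<bar> + \<bar>C2\<bar>) * s powr (-3/2)"
      and cc: "\<alpha> * A + \<beta> * (A * c') = c"
    proof (cases "t > 0")
      case True
      show ?thesis
      proof (rule that[of c\<^sub>p "- \<i>"])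
        have "norm (\<phi> t - c\<^sub>p * E s) \<le> C3 * s powr (- p)"
          using S3[of t] True t S by (simp add: E_def s_def mult.assoc)
        also have "\<dots> \<le> (C3 + C4) * s powr (- p)" using C4 by (intro mult_right_mono) auto
        finally show "norm (\<phi> t - c\<^sub>p * E s) \<le> (C3 + C4) * s powr (- p)" .
        have "norm (wave k 1 (t - b) - A * - \<i> * E s) \<le> C1 * s powr (-3/2)"
          using C1[of t] True t S by (simp add: s_def)
        also have "\<dots> \<le> (\<bar>C1\<bar> + \<bar>C2\<bar>) * s powr (-3/2)" by (intro mult_right_mono) auto
        finally show "norm (wave k 1 (t - b) - A * - \<i> * E s) \<le> (\<bar>C1\<bar> + \<bar>C2\<bar>) * s powr (-3/2)" .
      qed (rule ab)
    next
      case False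
      show ?thesis
      proof (rule that[of c\<^sub>m "\<i>"])
        have "norm (\<phi> t - c\<^sub>m * E s) \<le> C4 * s powr (- p)"
          using S4[of t] False t S by (simp add: E_def s_def mult.assoc)
        also have "\<dots> \<le> (C3 + C4) * s powr (- p)" using C3 by (intro mult_right_mono) auto
        finally show "norm (\<phi> t - c\<^sub>m * E s) \<le> (C3 + C4) * s powr (- p)" .
        have "wave k 1 (t - b) = wave k 1 (s - (- b))" using even[of "t - b"] False by (simp add: s_def)
        then have "norm (wave k 1 (t - b) - A * \<i> * E s) \<le> C2 * s powr (-3/2)"
          using C2[of s] s S by simp
        also have "\<dots> \<le> (\<bar>C1\<bar> + \<bar>C2\<bar>) * s powr (-3/2)" by (intro mult_right_mono) auto
        finally show "norm (wave k 1 (t - b) - A * \<i> * E s) \<le> (\<bar>C1\<bar> + \<bar>C2\<bar>) * s powr (-3/2)" .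
      qed (rule ab)
    qed
    have c0: "norm (wave k 1 t - A * E s) \<le> \<bar>C0\<bar> * s powr (-3/2)"
    proof -
      have "wave k 1 t = wave k 1 s" using even[of t] by (simp add: s_def abs_if)
      then have "norm (wave k 1 t - A * E s) \<le> C0 * s powr (-3/2)" using C0[of s] s by simp
      also have "\<dots> \<le> \<bar>C0\<bar> * s powr (-3/2)" by (intro mult_right_mono) auto
      finally show ?thesis .
    qed
    have "\<psi> t = (\<phi> t - c * E s) - (\<alpha> * (wave k 1 t - A * E s) + \<beta> * (wave k 1 (t - b) - A * c' * E s))"
      unfolding \<psi>_def cc[symmetric] by (simp add: algebra_simps)
    also have "norm \<dots> \<le> (C3 + C4) * s powr (- p) + (norm \<alpha> * (\<bar>C0\<bar> * s powr (-3/2)) + norm \<beta> * ((\<bar>C1\<bar> + \<bar>C2\<bar>) * s powr (-3/2)))"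
    proof (rule order_trans[OF norm_triangle_ineq4 add_mono[OF c norm_triangle_mono]])
      show "norm (\<alpha> * (wave k 1 t - A * E s)) \<le> norm \<alpha> * (\<bar>C0\<bar> * s powr (-3/2))"
        unfolding norm_mult by (rule mult_left_mono[OF c0 norm_ge_zero])
      show "norm (\<beta> * (wave k 1 (t - b) - A * c' * E s)) \<le> norm \<beta> * ((\<bar>C1\<bar> + \<bar>C2\<bar>) * s powr (-3/2))"
        unfolding norm_mult by (rule mult_left_mono[OF c' norm_ge_zero])
    qed
    also have "\<dots> \<le> (C3 + C4) * s powr (- q) + (norm \<alpha> * (\<bar>C0\<bar> * s powr (- q)) + norm \<beta> * ((\<bar>C1\<bar> + \<bar>C2\<bar>) * s powr (- q)))"
      using C3 C4 pq by (intro add_mono mult_left_mono) auto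
    finally show ?thesis by (simp add: D_def s_def algebra_simps)
  qed
  have hGm: "(\<lambda>t. wave k 1 (t - c)) \<in> borel_measurable borel" "continuous_on UNIV (\<lambda>t. wave k 1 (t - c))" for c
  proof -
    have "isCont (\<lambda>t. wave k 1 (t - c)) t" for t by (intro isCont_wave[OF k] continuous_intros) auto
    then show "(\<lambda>t. wave k 1 (t - c)) \<in> borel_measurable borel" "continuous_on UNIV (\<lambda>t. wave k 1 (t - c))"
      by (auto intro: borel_measurable_isCont continuous_at_imp_continuous_on)
  qed
  have \<psi>i: "integrable lebesgue \<psi>"
  proof (rule integrable_decomposition[OF assms(3)])
    show "continuous_on UNIV (\<lambda>t. \<phi>\<^sub>2 t - (\<alpha> * wave k 1 (t - 0) + \<beta> * wave k 1 (t - b)))"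
      by (intro continuous_intros assms(5) hGm)
    show "\<psi> t = \<phi>\<^sub>1 t + (\<phi>\<^sub>2 t - (\<alpha> * wave k 1 (t - 0) + \<beta> * wave k 1 (t - b)))" for t
      by (simp add: \<psi>_def assms(2))
  qed (use q S dec in auto)
  have decAE: "AE t in lebesgue. \<bar>t\<bar> \<ge> S \<longrightarrow> norm (\<psi> t) \<le> D * \<bar>t\<bar> powr (- q)"
    using dec by auto
  define P where "P = (\<lambda>x1 x2. LINT t|lebesgue. half_plane_kernel k x1 (x2 - t) * \<psi> t)"
  have Pd: "(LINT t|lebesgue. half_plane_kernel k x1 (x2 - t) * \<psi> t) = P x1 x2" for x1 x2
    by (simp add: P_def)
  \<comment> \<open>The potentials of the two traces are the waves themselves, so only the part from
    \<psi> has to be estimated as an integral.\<close>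
  have u: "u (x1, x2) = \<alpha> * wave k (x1 - (- 1)) (x2 - 0) + \<beta> * wave k (x1 - (- 1)) (x2 - b) + P x1 x2" if x1: "x1 > 0" for x1 x2
  proof -
    have src: "integrable lebesgue (\<lambda>t. half_plane_kernel k x1 (x2 - t) * wave k 1 (t - c))"
      "(LINT t|lebesgue. half_plane_kernel k x1 (x2 - t) * wave k 1 (t - c)) = wave k (x1 - (- 1)) (x2 - c)" for c
    proof -
      have m: "(\<lambda>t. half_plane_kernel k x1 (x2 - t) * wave k 1 (t - c)) \<in> borel_measurable lborel"
        using kernel_measurable[OF k x1, of x2] hGm(1)[of c] by measurable
      show "integrable lebesgue (\<lambda>t. half_plane_kernel k x1 (x2 - t) * wave k 1 (t - c))"
        using point_source_representation(1)[OF k, of "-1" x1 x2 c] x1 integrable_completion[OF m] by simp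
      show "(LINT t|lebesgue. half_plane_kernel k x1 (x2 - t) * wave k 1 (t - c)) = wave k (x1 - (- 1)) (x2 - c)"
        using point_source_representation(2)[OF k, of "-1" x1 x2 c] x1 integral_completion[OF m] by simp
    qed
    have "half_plane_kernel k x1 (x2 - t) * \<phi> t =
        \<alpha> * (half_plane_kernel k x1 (x2 - t) * wave k 1 (t - 0)) + \<beta> * (half_plane_kernel k x1 (x2 - t) * wave k 1 (t - b))
        + half_plane_kernel k x1 (x2 - t) * \<psi> t" for t
      by (simp add: \<psi>_def algebra_simps)
    then have "u (x1, x2) = (LINT t|lebesgue. \<alpha> * (half_plane_kernel k x1 (x2 - t) * wave k 1 (t - 0)) + \<beta> * (half_plane_kernel k x1 (x2 - t) * wave k 1 (t - b))
        + half_plane_kernel k x1 (x2 - t) * \<psi> t)"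
      by (simp add: u_def half_plane_potential_def)
    also have "\<dots> = \<alpha> * (LINT t|lebesgue. half_plane_kernel k x1 (x2 - t) * wave k 1 (t - 0))
        + \<beta> * (LINT t|lebesgue. half_plane_kernel k x1 (x2 - t) * wave k 1 (t - b)) + P x1 x2"
      unfolding P_def
      using integrable_mult_right[OF src(1)[of 0], of \<alpha>] integrable_mult_right[OF src(1)[of b], of \<beta>] kernel_integrable[OF k x1 \<psi>i]
      by (subst Bochner_Integration.integral_add Bochner_Integration.integral_add; (simp del: diff_0_right)?)
    finally show ?thesis unfolding src .
  qed
  obtain B0 where B0: "B0 \<ge> 0"
    "\<And>x1 x2. rad x1 x2 \<ge> 1 \<Longrightarrow> rad x1 x2 \<ge> 2 * rad (-1) 0 \<Longrightarrow> norm (wave k (x1 - (-1)) (x2 - 0)) \<le> B0 * rad x1 x2 powr (-1/2)"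
    "\<And>x1 x2. rad x1 x2 \<ge> 1 \<Longrightarrow> rad x1 x2 \<ge> 2 * rad (-1) 0 \<Longrightarrow>
      \<exists>d. ((\<lambda>r. wave k (x1 / rad x1 x2 * r - (-1)) (x2 / rad x1 x2 * r - 0)) has_vector_derivative d) (at (rad x1 x2)) \<and>
        norm (d - \<i> * of_real k * wave k (x1 - (-1)) (x2 - 0)) \<le> B0 * rad x1 x2 powr (-3/2)"
    by (rule point_source_radiation[OF k, of "-1" 0]) (rule that)
  obtain B1 where B1: "B1 \<ge> 0"
    "\<And>x1 x2. rad x1 x2 \<ge> 1 \<Longrightarrow> rad x1 x2 \<ge> 2 * rad (-1) b \<Longrightarrow> norm (wave k (x1 - (-1)) (x2 - b)) \<le> B1 * rad x1 x2 powr (-1/2)"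
    "\<And>x1 x2. rad x1 x2 \<ge> 1 \<Longrightarrow> rad x1 x2 \<ge> 2 * rad (-1) b \<Longrightarrow>
      \<exists>d. ((\<lambda>r. wave k (x1 / rad x1 x2 * r - (-1)) (x2 / rad x1 x2 * r - b)) has_vector_derivative d) (at (rad x1 x2)) \<and>
        norm (d - \<i> * of_real k * wave k (x1 - (-1)) (x2 - b)) \<le> B1 * rad x1 x2 powr (-3/2)"
    by (rule point_source_radiation[OF k, of "-1" b]) (rule that)
  \<comment> \<open>Beyond \<open>R0\<close> a point is at least twice as far from the origin as
    each source and as S.\<close>
  define R0 where "R0 = 1 + 2 * rad (-1) 0 + 2 * rad (-1) b + 2 * S"
  have R0: "R0 \<ge> 1" "R0 \<ge> 2 * rad (-1) 0" "R0 \<ge> 2 * rad (-1) b" "R0 \<ge> 2 * S"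
    using S by (auto simp: R0_def)
  show ?thesis
  proof (rule conjI)
    obtain B2 where B2: "B2 \<ge> 0"
      "\<And>x1 x2. x1 > 0 \<Longrightarrow> rad x1 x2 \<ge> 1 \<Longrightarrow> rad x1 x2 \<ge> 2 * S \<Longrightarrow> norm (P x1 x2) \<le> B2 * rad x1 x2 powr (-1/2)"
      by (rule potential_bound[OF k \<psi>i q(1) D decAE, unfolded Pd]) (rule that)
    define C where "C = 1 + 2 * (norm \<alpha> * B0 + norm \<beta> * B1 + B2)"
    have K: "norm \<alpha> * B0 + norm \<beta> * B1 + B2 \<ge> 0" using B0 B1 B2 by simp
    have "norm (u x) \<le> C * (1 + norm x) powr (-1/2)" if x: "fst x > 0 \<and> norm x > R0" for x
    proof -
      obtain x1 x2 where xx: "x = (x1, x2)" by (cases x)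
      define R where "R = rad x1 x2"
      have nR: "norm x = R" by (simp add: xx norm_pair_rad R_def)
      have x1: "x1 > 0" and R: "R > R0" using x by (auto simp: xx nR[unfolded xx])
      have "norm (u x) \<le> norm \<alpha> * (B0 * R powr (-1/2)) + norm \<beta> * (B1 * R powr (-1/2)) + B2 * R powr (-1/2)"
        unfolding xx u[OF x1] using B0(2)[of x1 x2] B1(2)[of x1 x2] B2(2)[OF x1, of x2] R R0 unfolding R_def[symmetric]
        by (intro norm_triangle_mono) (auto simp: norm_mult intro!: mult_left_mono)
      also have "\<dots> = (norm \<alpha> * B0 + norm \<beta> * B1 + B2) * R powr (-1/2)" by (simp add: algebra_simps)
      also have "\<dots> \<le> (norm \<alpha> * B0 + norm \<beta> * B1 + B2) * (2 * (1 + R) powr (-1/2))"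
      proof (rule mult_left_mono[OF _ K])
        \<comment> \<open>R >= 1 gives (1 + R) / 2 <= R; the factor 2 obtained below rounds up sqrt
          2.\<close>
        have "R powr (-1/2) \<le> ((1 + R) / 2) powr (-1/2)" using R R0 by (intro powr_mono2') auto
        also have "\<dots> = 2 powr (1/2) * (1 + R) powr (-1/2)" using R R0 by (simp add: powr_divide powr_minus_divide)
        also have "\<dots> \<le> 2 powr 1 * (1 + R) powr (-1/2)" by (intro mult_right_mono powr_mono) auto
        finally show "R powr (-1/2) \<le> 2 * (1 + R) powr (-1/2)" by simp
      qed
      also have "\<dots> = (2 * (norm \<alpha> * B0 + norm \<beta> * B1 + B2)) * (1 + R) powr (-1/2)" by simp
      also have "\<dots> \<le> C * (1 + R) powr (-1/2)" by (intro mult_right_mono) (auto simp: C_def)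
      finally show ?thesis unfolding nR .
    qed
    moreover have "C > 0" using K by (simp add: C_def)
    ultimately show "\<exists>C>0. \<exists>R>0. \<forall>x. fst x > 0 \<and> norm x > R \<longrightarrow> norm (u x) \<le> C * (1 + norm x) powr (-1/2)"
      using R0(1) by (intro exI[of _ C] conjI exI[of _ R0]) auto
    show "\<forall>\<epsilon>>0. ((\<lambda>R. ereal (R powr (1/2)) *
                       (SUP x\<in>{x. fst x > \<epsilon> \<and> norm x = R}.
                          ereal (norm (radial_deriv u x - \<i> * of_real k * u x))))
                   \<longlongrightarrow> 0) at_top"
    proof (intro allI impI)
      fix \<epsilon> :: real assume \<epsilon>: "\<epsilon> > 0"
      obtain \<eta> where \<eta>: "(\<eta> \<longlongrightarrow> 0) at_top"
        "\<And>x1 x2. x1 > \<epsilon> \<Longrightarrow> rad x1 x2 \<ge> 1 \<Longrightarrow> rad x1 x2 \<ge> 2 * S \<Longrightarrow>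
          \<exists>d. ((\<lambda>r. P (x1 / rad x1 x2 * r) (x2 / rad x1 x2 * r)) has_vector_derivative d) (at (rad x1 x2)) \<and>
            norm (d - \<i> * of_real k * P x1 x2) \<le> rad x1 x2 powr (-1/2) * \<eta> (rad x1 x2)"
        by (rule potential_radiation[OF k \<psi>i q(1) D decAE \<epsilon>, unfolded Pd]) (rule that)
      \<comment> \<open>The point sources miss the radiation condition by order R^(-3/2), one power
        better than R^(-1/2); hence the summand of order 1 / R.\<close>
      define \<zeta> where "\<zeta> = (\<lambda>R. (norm \<alpha> * B0 + norm \<beta> * B1) / R + \<eta> R)"
      have "((\<lambda>R. (norm \<alpha> * B0 + norm \<beta> * B1) / R) \<longlongrightarrow> 0) at_top" by real_asymp
      from tendsto_add[OF this \<eta>(1)] have \<zeta>0: "(\<zeta> \<longlongrightarrow> 0) at_top" by (simp add: \<zeta>_def)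
      have main: "norm (radial_deriv u x - \<i> * of_real k * u x) \<le> R powr (-1/2) * \<zeta> R"
        if x: "fst x > \<epsilon>" "norm x = R" and R: "R \<ge> R0" for x R
      proof -
        obtain x1 x2 where xx: "x = (x1, x2)" by (cases x)
        have nR: "rad x1 x2 = R" using x by (simp add: xx norm_pair_rad)
        have x1: "x1 > \<epsilon>" "x1 > 0" using x \<epsilon> by (auto simp: xx)
        have Rp: "R > 0" using R R0 by simp
        have R': "R \<ge> 1" "R \<ge> 2 * rad (-1) 0" "R \<ge> 2 * rad (-1) b" "R \<ge> 2 * S" using R R0 by auto
        define n1 where "n1 = x1 / R"
        define n2 where "n2 = x2 / R"
        have n1: "n1 > 0" using x1 Rp by (simp add: n1_def)
        obtain d0 where d0: "((\<lambda>r. wave k (n1 * r - (-1)) (n2 * r - 0)) has_vector_derivative d0) (at R)"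
          "norm (d0 - \<i> * of_real k * wave k (x1 - (-1)) (x2 - 0)) \<le> B0 * R powr (-3/2)"
          using B0(3)[of x1 x2] R' unfolding nR n1_def n2_def by blast
        obtain d1 where d1: "((\<lambda>r. wave k (n1 * r - (-1)) (n2 * r - b)) has_vector_derivative d1) (at R)"
          "norm (d1 - \<i> * of_real k * wave k (x1 - (-1)) (x2 - b)) \<le> B1 * R powr (-3/2)"
          using B1(3)[of x1 x2] R' unfolding nR n1_def n2_def by blast
        obtain d2 where d2: "((\<lambda>r. P (n1 * r) (n2 * r)) has_vector_derivative d2) (at R)"
          "norm (d2 - \<i> * of_real k * P x1 x2) \<le> R powr (-1/2) * \<eta> R"
          using \<eta>(2)[of x1 x2] x1 R' unfolding nR n1_def n2_def by blast
        have sg: "r *\<^sub>R sgn x = (n1 * r, n2 * r)" for r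
          using x(2) by (simp add: xx sgn_div_norm n1_def n2_def divide_inverse mult_ac)
        have "((\<lambda>r. \<alpha> * wave k (n1 * r - (-1)) (n2 * r - 0) + \<beta> * wave k (n1 * r - (-1)) (n2 * r - b) + P (n1 * r) (n2 * r))
            has_vector_derivative \<alpha> * d0 + \<beta> * d1 + d2) (at R)"
          by (intro has_vector_derivative_add has_vector_derivative_mult_right d0 d1 d2)
        then have "((\<lambda>r. u (r *\<^sub>R sgn x)) has_vector_derivative \<alpha> * d0 + \<beta> * d1 + d2) (at R)"
        \<comment> \<open>The formula for u holds only for a positive first coordinate, which along
          the ray means r > 0.\<close>
        proof (rule has_vector_derivative_transform_within_open[of _ _ _ "{0<..}"])
          show "\<alpha> * wave k (n1 * r - (-1)) (n2 * r - 0) + \<beta> * wave k (n1 * r - (-1)) (n2 * r - b) + P (n1 * r) (n2 * r) = u (r *\<^sub>R sgn x)"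
            if "r \<in> {0<..}" for r
            unfolding sg using u[of "n1 * r" "n2 * r"] n1 that by simp
        qed (use Rp in auto)
        then have rd: "radial_deriv u x = \<alpha> * d0 + \<beta> * d1 + d2"
          unfolding radial_deriv_def x(2) by (rule vector_derivative_at)
        have "radial_deriv u x - \<i> * of_real k * u x = \<alpha> * (d0 - \<i> * of_real k * wave k (x1 - (-1)) (x2 - 0))
            + \<beta> * (d1 - \<i> * of_real k * wave k (x1 - (-1)) (x2 - b)) + (d2 - \<i> * of_real k * P x1 x2)"
          unfolding rd unfolding xx u[OF x1(2)] by (simp only: algebra_simps)
        also have "norm \<dots> \<le> norm \<alpha> * (B0 * R powr (-3/2)) + norm \<beta> * (B1 * R powr (-3/2)) + R powr (-1/2) * \<eta> R"
          using d0(2) d1(2) d2(2) by (intro norm_triangle_mono) (auto simp: norm_mult intro!: mult_left_mono)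
        also have "R powr (-3/2) = R powr (-1/2) / R" using powr_diff[of R "-1/2" 1] Rp by simp
        also have "norm \<alpha> * (B0 * (R powr (-1/2) / R)) + norm \<beta> * (B1 * (R powr (-1/2) / R)) + R powr (-1/2) * \<eta> R = R powr (-1/2) * \<zeta> R"
          using Rp by (simp add: \<zeta>_def field_simps)
        finally show ?thesis .
      qed
      let ?F = "\<lambda>R. ereal (R powr (1/2)) * (SUP x\<in>{x. fst x > \<epsilon> \<and> norm x = R}. ereal (norm (radial_deriv u x - \<i> * of_real k * u x)))"
      have ev: "\<forall>\<^sub>F R in at_top. R \<ge> R0 \<and> R > \<epsilon>"
        using eventually_ge_at_top[of R0] eventually_gt_at_top[of \<epsilon>] by eventually_elim simp
      show "(?F \<longlongrightarrow> 0) at_top"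
      proof (rule tendsto_sandwich[of "\<lambda>_. 0" _ _ "\<lambda>R. ereal (\<zeta> R)"])
        show "\<forall>\<^sub>F R in at_top. 0 \<le> ?F R"
          using ev
        proof eventually_elim
          case (elim R)
          \<comment> \<open>This point shows that the set is nonempty. Over an empty set the
            extended-real supremum would be - infinity, hence the restriction to R >
            \<epsilon>.\<close>
          have "(R, 0) \<in> {x :: real \<times> real. fst x > \<epsilon> \<and> norm x = R}"
            using elim \<epsilon> by (simp add: norm_Pair)
          then have "0 \<le> (SUP x\<in>{x. fst x > \<epsilon> \<and> norm x = R}. ereal (norm (radial_deriv u x - \<i> * of_real k * u x)))"
            by (rule SUP_upper2) simp
          then show ?case by simp
        qed
        show "\<forall>\<^sub>F R in at_top. ?F R \<le> ereal (\<zeta> R)"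
          using ev
        proof eventually_elim
          case (elim R)
          have Rp: "R > 0" using elim R0 by simp
          have "(SUP x\<in>{x. fst x > \<epsilon> \<and> norm x = R}. ereal (norm (radial_deriv u x - \<i> * of_real k * u x))) \<le> ereal (R powr (-1/2) * \<zeta> R)"
            by (rule SUP_least) (use main elim in auto)
          then have "?F R \<le> ereal (R powr (1/2)) * ereal (R powr (-1/2) * \<zeta> R)"
            by (rule ereal_mult_left_mono) simp
          also have "\<dots> = ereal (\<zeta> R)"
            using Rp powr_add[of R "1/2" "-1/2"] by (simp flip: mult.assoc)
          finally show ?case .
        qed
        show "((\<lambda>R. ereal (\<zeta> R)) \<longlongrightarrow> 0) at_top"
          using \<zeta>0 by (simp add: zero_ereal_def)
      qed simp
    qed
  qed
qed

end
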